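(* Let $\tilde u(t)$, $t\in[0,t_1]$, be an admissible control, and let $q_0$ be an $M$-valued random variable on a probability space $(\Omega,\mathcal F,P)$ with probability density $\rho$. Suppose that the control system $\dot q=f_{u}(q)$, $q\in M$, $u\in U$, with $u=\tilde u(t)$ and with the random initial condition $q(0)=q_0$, has a solution $\tilde q(t)=q_{\tilde u}(t)$, $t\in[0,t_1]$ (a random trajectory). Suppose further that (i) $E\,\tilde q(t_1)\in\partial A^E_{q_0}(t_1)$, where $A^E_{q_0}(t_1)$ is the expected attainable set from $q_0$ at time $t_1$; and (ii) (injectivity) for every admissible control $u$, distinct initial points $q_0^{(1)}\neq q_0^{(2)}$ are sent by the system driven by $u$ to distinct terminal points $q_1^{(1)}\neq q_1^{(2)}$ at time $t_1$. Then there exists a stochastic Lipschitzian curve of covectors $\lambda^*_t\in T^*_{\tilde q(t)}M$, $t\in[0,t_1]$ (i.e. a random covector curve defined on $(\Omega,\mathcal F,P)$, lying over the random trajectory $\tilde q(t)$, with Lipschitz paths in $t$), such that for almost all $t\in[0,t_1]$ $$\lambda^*_t\not\equiv 0,$$ $$\dot\lambda^*_t=\vec h_{\tilde u(t)}(\lambda^*_t),$$ $$E\,h_{\tilde u(t)}(\lambda^*_t)=\max_{u\in U}E\,h_{u}(\lambda^*_t).$$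
   Context: $M$ is the configuration space, a smooth manifold on which expectations of $M$-valued random variables make sense (an open subset of a finite-dimensional vector space). $U\subset\mathbb R^n$ is the set of control values, and for each $u\in U$, $f_u$ is a vector field on $M$ under the usual regularity assumptions of geometric control theory ($f_u(q)$ smooth in $q$, jointly continuous in $(q,u)$ together with its $q$-derivatives). An admissible control is a bounded measurable function $u:[0,t_1]\to U$, chosen in advance (non-feedback, hence deterministic and not depending on the realization of $q_0$). For $x\in M$, the attainable set $A_x(t)$ is the set of points $q_u(t)$ reached at time $t$ by solutions of $\dot q=f_{u(t)}(q)$, $q(0)=x$, over all admissible controls $u$. When the initial point is random with density $\rho$ on $M$, the expected attainable set is $$A^E_{q_0}(t)=\Big\{\int_M a_x\,\rho(x)\,dx \ \Big|\ a_x\in A_x(t)\text{ for each }x\Big\},$$ where $x\mapsto a_x$ ranges over selections for which the integral is defined. For $u\in U$ the Hamiltonian $h_u:T^*M\to\mathbb R$ is $h_u(\lambda)=\langle\lambda,f_u(q)\rangle$ for $\lambda\in T^*_qM$, and $\vec h_u$ is the corresponding Hamiltonian vector field on $T^*M$ with its canonical symplectic structure. $E$ is expectation with respect to $P$. *)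

theory Defs
  imports "HOL-Probability.Probability"
begin

section \<open>Control systems on an open subset of a Euclidean space\<close>

text \<open>Iterated directional derivatives of \<open>g\<close> along the vectors of a list; for a smooth \<open>g\<close>
  these are all the values of all its higher Frechet derivatives.\<close>

primrec iter_deriv ::
  "'a list \<Rightarrow> ('a::real_normed_vector \<Rightarrow> 'b::real_normed_vector) \<Rightarrow> 'a \<Rightarrow> 'b" where
  "iter_deriv [] g = g"
| "iter_deriv (v # vs) g = (\<lambda>q. frechet_derivative (iter_deriv vs g) (at q) v)"

definition smooth_vf :: "('a::real_normed_vector) set \<Rightarrow> ('a \<Rightarrow> 'a) \<Rightarrow> bool" where
  "smooth_vf M g \<longleftrightarrow> (\<forall>vs. iter_deriv vs g differentiable_on M)"

text \<open>As usual in geometric control theory, the joint continuity of the right-hand side and of its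
  \<open>q\<close>-derivatives is required up to the closure of \<open>U\<close>: for non-closed \<open>U\<close> this is what
  keeps \<open>f\<^sub>u\<^sub>(\<^sub>t\<^sub>)(q)\<close> bounded along bounded controls and trajectories Lipschitz.\<close>

definition control_system ::
  "('a::euclidean_space) set \<Rightarrow> (real ^ 'n) set \<Rightarrow> (real ^ 'n \<Rightarrow> 'a \<Rightarrow> 'a) \<Rightarrow> bool" where
  "control_system M U f \<longleftrightarrow>
     open M \<and>
     (\<forall>u\<in>closure U. smooth_vf M (f u)) \<and>
     (\<forall>vs. continuous_on (M \<times> closure U) (\<lambda>(q, u). iter_deriv vs (f u) q))"

definition admissible_control :: "(real ^ 'n) set \<Rightarrow> real \<Rightarrow> (real \<Rightarrow> real ^ 'n) \<Rightarrow> bool" where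
  "admissible_control U T u \<longleftrightarrow>
     u \<in> borel_measurable (lebesgue_on {0..T}) \<and> bounded (u ` {0..T}) \<and> u ` {0..T} \<subseteq> U"

text \<open>Caratheodory solutions. Since admissible controls are bounded, an absolutely continuous
  solution on a compact interval is automatically Lipschitz.\<close>

definition trajectory ::
  "('a::euclidean_space) set \<Rightarrow> (real ^ 'n \<Rightarrow> 'a \<Rightarrow> 'a) \<Rightarrow> real \<Rightarrow> (real \<Rightarrow> real ^ 'n) \<Rightarrow> 'a \<Rightarrow> (real \<Rightarrow> 'a) \<Rightarrow> bool"
  where
  "trajectory M f T u x q \<longleftrightarrow>
     q 0 = x \<and> q ` {0..T} \<subseteq> M \<and> (\<exists>L. L-lipschitz_on {0..T} q) \<and>
     (AE t in lebesgue_on {0..T}. (q has_vector_derivative f (u t) (q t)) (at t within {0..T}))"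

definition attainable ::
  "('a::euclidean_space) set \<Rightarrow> (real ^ 'n) set \<Rightarrow> (real ^ 'n \<Rightarrow> 'a \<Rightarrow> 'a) \<Rightarrow> real \<Rightarrow> 'a \<Rightarrow> 'a set" where
  "attainable M U f T x = {q T | q u. admissible_control U T u \<and> trajectory M f T u x q}"

text \<open>The Lebesgue (completed) measure admits the largest class of integrable selections.\<close>

definition expected_attainable ::
  "('a::euclidean_space) set \<Rightarrow> (real ^ 'n) set \<Rightarrow> (real ^ 'n \<Rightarrow> 'a \<Rightarrow> 'a) \<Rightarrow> ('a \<Rightarrow> real) \<Rightarrow> real \<Rightarrow> 'a set"
  where
  "expected_attainable M U f \<rho> T =
     {(LINT x:M|lebesgue. \<rho> x *\<^sub>R a x) | a.
        (\<forall>x\<in>M. a x \<in> attainable M U f T x) \<and> set_integrable lebesgue M (\<lambda>x. \<rho> x *\<^sub>R a x)}"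

section \<open>Hamiltonians on the cotangent bundle\<close>

text \<open>For \<open>M\<close> open in the vector space \<open>'a\<close> the cotangent bundle is the product of \<open>M\<close> with the dual
  space; its points are pairs of a base point and a covector.\<close>

type_synonym 'a cotangent = "'a \<times> ('a \<Rightarrow>\<^sub>L real)"

definition hamiltonian ::
  "(real ^ 'n \<Rightarrow> 'a \<Rightarrow> 'a) \<Rightarrow> real ^ 'n \<Rightarrow> ('a::euclidean_space) cotangent \<Rightarrow> real" where
  "hamiltonian f u = (\<lambda>(q, p). blinfun_apply p (f u q))"

text \<open>The canonical form \<open>dp \<and> dq\<close>, the differential of the Liouville form \<open>p dq\<close>.\<close>

definition canonical_symplectic ::
  "('a::euclidean_space) cotangent \<Rightarrow> 'a cotangent \<Rightarrow> real" where
  "canonical_symplectic = (\<lambda>(v, \<alpha>) (w, \<beta>). blinfun_apply \<alpha> w - blinfun_apply \<beta> v)"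

text \<open>Sign convention: \<open>\<sigma>(\<cdot>, X) = dH\<close>, i.e. \<open>X = (\<partial>H/\<partial>p, - \<partial>H/\<partial>q)\<close>.\<close>

definition hamiltonian_vf ::
  "('a cotangent \<Rightarrow> real) \<Rightarrow> ('a::euclidean_space) cotangent \<Rightarrow> 'a cotangent" where
  "hamiltonian_vf H z = (THE X. \<forall>Y. canonical_symplectic Y X = frechet_derivative H (at z) Y)"

end

theory Submission
  imports Defs
begin

text \<open>
  A selection in the expected attainable set may steer every initial point separately. So different needle
  variations of the reference control can be applied on disjoint small sets of initial points, each concentrated
  near a point of the support of the law of \<open>q\<^sub>0\<close>, and the first-order displacements of the mean endpoint add up. If the
  displacement vectors of single needles had \<open>0\<close> in the interior of their convex hull, Brouwer's theorem would put
  the mean endpoint in the interior of the expected attainable set. Hence some \<open>p \<noteq> 0\<close> has nonpositive product with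
  all of them. Transporting \<open>p\<close> backwards by the adjoint equation along each trajectory turns this into the
  maximality of the Hamiltonian of the reference control, pointwise in the initial point; therefore the covectors
  may be cut off outside a compact ball of initial points, which makes all expectations finite.

  The Lebesgue points of the reference control form one set of full measure that serves all initial points at once.
\<close>

section \<open>Integral curves of Caratheodory fields\<close>

text \<open>Nothing is uniform over the random initial point: neither completeness of the fields nor
  global Lipschitz bounds are assumed, and \<open>U\<close> need not be compact. Every estimate is
  therefore local, in a tube around one trajectory and for one needle value, and it is uniform only
  over nearby initial points. This suffices because a convex hull with \<open>0\<close> in its
  interior represents all vectors by finitely many needle vectors. The coefficients are continuous
  and nonnegative; divided by the mass of a set of initial points they become needle lengths. The
  sets themselves stay fixed, so the mean endpoint depends continuously on the lengths, as Brouwer's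
  theorem demands. The law of \<open>q0\<close> has no atoms because it has a density; this allows
  disjoint sets even when several needles are based at the same point. Costates solve a backward
  linear equation and depend continuously on the initial point, which gives the measurability of the
  random covector.\<close>

lemma lipschitz_fundamental_theorem_of_calculus:
  fixes q :: "real \<Rightarrow> 'a::banach"
  assumes ab: "a \<le> b" and lip: "L-lipschitz_on {a..b} q" and N: "negligible N"
    and der: "\<And>t. t \<in> {a..b} - N \<Longrightarrow> (q has_vector_derivative g t) (at t within {a..b})"
  shows "(g has_integral (q b - q a)) {a..b}"
proof -
  \<comment> \<open>With \<open>g\<close> replaced by \<open>0\<close> on \<open>N\<close>, an
    interval tagged in \<open>N\<close> contributes only the increment of \<open>q\<close>, at most
    \<open>L\<close> times its length; the total length of such intervals is small because the
    indicator of \<open>N\<close> has integral \<open>0\<close>.\<close>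
  define g' where "g' = (\<lambda>t. if t \<in> N then 0 else g t)"
  have L0: "0 \<le> L" using lip by (rule lipschitz_on_nonneg)
  have "(g' has_integral (q b - q a)) (cbox a b)"
    unfolding has_integral
  proof safe
    fix e :: real assume e: "e > 0"
    \<comment> \<open>\<open>e1\<close> is the relative linearisation error at tags outside
      \<open>N\<close>, \<open>e2\<close> the total length of the intervals tagged in
      \<open>N\<close>; each costs at most \<open>e / 2\<close>.\<close>
    define e1 where "e1 = e / (2 * (b - a + 1))"
    have e1: "e1 > 0" using e ab by (simp add: e1_def)
    define e2 where "e2 = e / (2 * (L + 1))"
    have e2: "e2 > 0" using e L0 by (simp add: e2_def)
    have "\<forall>x. \<exists>d>0. x \<in> {a..b} - N \<longrightarrow>
         (\<forall>y\<in>{a..b}. norm (y-x) < d \<longrightarrow> norm (q y - q x - (y-x) *\<^sub>R g x) \<le> e1 * norm (y-x))"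
    proof
      fix x
      show "\<exists>d>0. x \<in> {a..b} - N \<longrightarrow>
         (\<forall>y\<in>{a..b}. norm (y-x) < d \<longrightarrow> norm (q y - q x - (y-x) *\<^sub>R g x) \<le> e1 * norm (y-x))"
        using der[of x, unfolded has_vector_derivative_def has_derivative_within_alt] e1
        by (cases "x \<in> {a..b} - N") (auto intro: exI[of _ 1])
    qed
    then obtain d where d: "\<And>x. 0 < d x"
        "\<And>x y. \<lbrakk>x \<in> {a..b} - N; y \<in> {a..b}; norm (y-x) < d x\<rbrakk>
           \<Longrightarrow> norm (q y - q x - (y-x) *\<^sub>R g x) \<le> e1 * norm (y-x)"
      by metis
    have iN: "((indicator N :: real \<Rightarrow> real) has_integral 0) (cbox a b)"
      using N unfolding negligible_def by blast
    have "\<exists>\<gamma>. gauge \<gamma> \<and> (\<forall>D. D tagged_division_of cbox a b \<and> \<gamma> fine D \<longrightarrow>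
        norm ((\<Sum>(x,k)\<in>D. measure lborel k *\<^sub>R (indicator N x :: real)) - 0) < e2)"
      by (rule iN[unfolded has_integral, rule_format, OF e2])
    then obtain \<gamma> where \<gamma>: "gauge \<gamma>" and \<gamma>1: "\<forall>D. D tagged_division_of cbox a b \<and> \<gamma> fine D \<longrightarrow>
        norm ((\<Sum>(x,k)\<in>D. measure lborel k *\<^sub>R (indicator N x :: real)) - 0) < e2"
      by (elim exE conjE)
    show "\<exists>\<gamma>. gauge \<gamma> \<and> (\<forall>D. D tagged_division_of cbox a b \<and> \<gamma> fine D \<longrightarrow>
        norm ((\<Sum>(x, k)\<in>D. measure lborel k *\<^sub>R g' x) - (q b - q a)) < e)"
    proof (rule exI[of _ "\<lambda>x. ball x (d x) \<inter> \<gamma> x"], rule conjI, goal_cases)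
      case 1
      show ?case
        by (rule gauge_Int[OF gauge_ball_dependent \<gamma>]) (use d(1) in blast)
    next
      case 2
      show ?case
      proof (rule allI, rule impI)
      fix p assume p: "p tagged_division_of cbox a b \<and> (\<lambda>x. ball x (d x) \<inter> \<gamma> x) fine p"
      then have ptag: "p tagged_division_of cbox a b" and finep: "(\<lambda>x. ball x (d x)) fine p"
        and fg: "\<gamma> fine p" by (auto simp: fine_Int)
      have ba: "b - a = (\<Sum>(x,K)\<in>p. Sup K - Inf K)" "q b - q a = (\<Sum>(x,K)\<in>p. q(Sup K) - q(Inf K))"
        using additive_tagged_division_1[where f= "\<lambda>x. x"] additive_tagged_division_1[where f= q]
            ab ptag by auto
      have "norm (\<Sum>(x, K) \<in> p. (measure lborel K *\<^sub>R g' x) - (q (Sup K) - q (Inf K)))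
          \<le> (\<Sum>z\<in>p. (case z of (x, K) \<Rightarrow> e1 * (Sup K - Inf K) + L * (measure lborel K * indicator N x)))"
      proof (rule sum_norm_le,safe)
        fix x K
        assume "(x, K) \<in> p"
        then have "x \<in> K" and kab: "K \<subseteq> cbox a b"
          using ptag by blast+
        then obtain u v where k: "K = cbox u v" and "x \<in> K" and kab: "K \<subseteq> cbox a b"
          using ptag \<open>(x, K) \<in> p\<close> by auto
        have "u \<le> v"
          using \<open>x \<in> K\<close> unfolding k by auto
        have ball: "\<forall>y\<in>K. y \<in> ball x (d x)"
          using finep \<open>(x, K) \<in> p\<close> by blast
        have uv: "u \<in> K" "v \<in> K"
          by (simp_all add: \<open>u \<le> v\<close> k)
        show "norm (measure lborel K *\<^sub>R g' x - (q (Sup K) - q (Inf K))) \<le>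
            e1 * (Sup K - Inf K) + L * (measure lborel K * indicator N x)"
        proof (cases "x \<in> N")
          case True
          have "dist (q v) (q u) \<le> L * dist v u"
            using lip uv kab by (auto simp: lipschitz_on_def)
          moreover have "0 \<le> e1 * (v - u)" using e1 \<open>u \<le> v\<close> by simp
          ultimately show ?thesis
            using \<open>u \<le> v\<close> True by (simp add: g'_def k dist_norm norm_minus_commute[of "q u"])
        next
          case False
          have "norm ((v - u) *\<^sub>R g x - (q v - q u)) = norm (q u - q x - (u - x) *\<^sub>R g x - (q v - q x - (v - x) *\<^sub>R g x))"
            by (auto simp: algebra_simps)
          also have "\<dots> \<le> norm (q u - q x - (u - x) *\<^sub>R g x) + norm (q v - q x - (v - x) *\<^sub>R g x)"
            by (rule norm_triangle_ineq4)
          also have "\<dots> \<le> e1 * norm (u - x) + e1 * norm (v - x)"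
          proof (rule add_mono)
            show "norm (q u - q x - (u - x) *\<^sub>R g x) \<le> e1 * norm (u - x)"
            proof (rule d)
              show "norm (u - x) < d x"
                using \<open>u \<in> K\<close> ball by (auto simp: dist_real_def)
            qed (use \<open>x \<in> K\<close> \<open>u \<in> K\<close> kab False in auto)
            show "norm (q v - q x - (v - x) *\<^sub>R g x) \<le> e1 * norm (v - x)"
            proof (rule d)
              show "norm (v - x) < d x"
                using \<open>v \<in> K\<close> ball by (auto simp: dist_real_def)
            qed (use \<open>x \<in> K\<close> \<open>v \<in> K\<close> kab False in auto)
          qed
          also have "\<dots> \<le> e1 * (Sup K - Inf K)"
            using \<open>x \<in> K\<close> by (auto simp: k interval_bounds_real[OF \<open>u \<le> v\<close>] field_simps)
          finally show ?thesis using \<open>u \<le> v\<close> False by (simp add: k g'_def)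
        qed
      qed
      also have "\<dots> = e1 * (b - a) + L * (\<Sum>(x,k)\<in>p. measure lborel k *\<^sub>R (indicator N x :: real))"
        by (simp add: ba split_def sum.distrib sum_distrib_left)
      also have "\<dots> \<le> e1 * (b - a) + L * e2"
        using \<gamma>1[rule_format, OF conjI[OF ptag fg]] L0 by (intro add_left_mono mult_left_mono) auto
      also have "\<dots> < e"
      proof -
        have "e1 * (b - a) < e / 2" using e ab by (simp add: e1_def field_simps)
        moreover have "L * e2 \<le> e / 2" using e L0 by (simp add: e2_def field_simps)
        ultimately show ?thesis by simp
      qed
      finally show "norm ((\<Sum>(x, K)\<in>p. measure lborel K *\<^sub>R g' x) - (q b - q a)) < e"
        by (simp add: ba split_def sum_subtractf [symmetric])
      qed
    qed
  qed
  then have "(g' has_integral (q b - q a)) {a..b}" by simp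
  then show ?thesis
    by (rule has_integral_spike[OF N, rotated]) (auto simp: g'_def)
qed

lemma gronwall:
  fixes \<phi> :: "real \<Rightarrow> real"
  assumes cont: "continuous_on {0..T} \<phi>" and L: "0 \<le> L"
    and le: "\<And>t. t \<in> {0..T} \<Longrightarrow> \<phi> t \<le> a + L * integral {0..t} \<phi>"
    and t: "t \<in> {0..T}"
  shows "\<phi> t \<le> a * exp (L * t)"
proof -
  \<comment> \<open>The integrating factor: by \<open>le\<close> the derivative of
    \<open>\<psi>\<close> is nonpositive, and \<open>\<psi> 0 = a\<close>.\<close>
  define \<psi> where "\<psi> = (\<lambda>t. exp (- L * t) * (a + L * integral {0..t} \<phi>))"
  have der: "(\<psi> has_real_derivative exp (- L * s) * (L * \<phi> s - L * (a + L * integral {0..s} \<phi>))) (at s within {0..T})"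
    if "s \<in> {0..T}" for s
  proof -
    have *: "((\<lambda>t. integral {0..t} \<phi>) has_real_derivative \<phi> s) (at s within {0..T})"
      using integral_has_real_derivative[OF cont] that by simp
    show ?thesis
      unfolding \<psi>_def
      by (rule derivative_eq_intros * refl | simp add: algebra_simps)+
  qed
  have "\<psi> t \<le> \<psi> 0"
  proof (cases "t = 0")
    case False
    then have "0 < t" using t by simp
    have "\<exists>s\<in>{0<..<t}. \<psi> t - \<psi> 0 = (exp (- L * s) * (L * \<phi> s - L * (a + L * integral {0..s} \<phi>))) * (t - 0)"
    proof (rule mvt_simple[OF \<open>0 < t\<close>])
      fix s assume "0 \<le> s" "s \<le> t"
      then show "(\<psi> has_derivative (*) (exp (- L * s) * (L * \<phi> s - L * (a + L * integral {0..s} \<phi>)))) (at s within {0..t})"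
        using der[of s] t by (auto simp: has_field_derivative_def intro: has_derivative_subset)
    qed
    then obtain s where s: "0 < s" "s < t" and eq: "\<psi> t - \<psi> 0 = exp (- L * s) * (L * \<phi> s - L * (a + L * integral {0..s} \<phi>)) * t"
      by auto
    have "L * \<phi> s - L * (a + L * integral {0..s} \<phi>) \<le> 0"
      using le[of s] s t L mult_left_mono[of "\<phi> s" "a + L * integral {0..s} \<phi>" L] by auto
    then have "\<psi> t - \<psi> 0 \<le> 0" unfolding eq using \<open>0 < t\<close>
      by (intro mult_nonpos_nonneg mult_nonneg_nonpos) auto
    then show ?thesis by simp
  qed simp
  then have "exp (- L * t) * (a + L * integral {0..t} \<phi>) \<le> a" by (simp add: \<psi>_def)
  then have "exp (L * t) * (exp (- L * t) * (a + L * integral {0..t} \<phi>)) \<le> exp (L * t) * a" by (intro mult_left_mono) auto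
  then have "a + L * integral {0..t} \<phi> \<le> exp (L * t) * a" by (simp add: mult.assoc[symmetric] exp_add[symmetric])
  with le[OF t] show ?thesis by (simp add: mult.commute)
qed

text \<open>Gronwall with a defect \<open>h\<close> measured by its integral. Fields that differ
  much, but only during a short time, thus give close curves, which is the situation of a
  needle.\<close>

lemma integral_curves_dist_le:
  fixes q1 q2 :: "real \<Rightarrow> 'a::euclidean_space"
  assumes q: "continuous_on {0..T} q1" "continuous_on {0..T} q2" and L: "0 \<le> L"
    and F1: "\<And>t. t \<in> {0..T} \<Longrightarrow> (F1 has_integral (q1 t - x1)) {0..t}"
    and F2: "\<And>t. t \<in> {0..T} \<Longrightarrow> (F2 has_integral (q2 t - x2)) {0..t}"
    and F: "\<And>s. s \<in> {0..T} \<Longrightarrow> norm (F1 s - F2 s) \<le> L * norm (q1 s - q2 s) + h s"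
    and h0: "\<And>s. s \<in> {0..T} \<Longrightarrow> 0 \<le> h s"
    and h: "(h has_integral d) {0..T}" and t: "t \<in> {0..T}"
  shows "norm (q1 t - q2 t) \<le> (norm (x1 - x2) + d) * exp (L * t)"
proof (rule gronwall[OF _ L _ t])
  show "continuous_on {0..T} (\<lambda>t. norm (q1 t - q2 t))" using q by (intro continuous_intros)
  fix t assume t: "t \<in> {0..T}"
  have i1: "((\<lambda>s. F1 s - F2 s) has_integral ((q1 t - x1) - (q2 t - x2))) {0..t}"
    using has_integral_diff[OF F1[OF t] F2[OF t]] .
  have ic: "(\<lambda>s. norm (q1 s - q2 s)) integrable_on {0..t}"
    by (intro integrable_continuous_real continuous_intros continuous_on_subset[OF q(1)] continuous_on_subset[OF q(2)])
      (use t in auto)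
  have ih: "h integrable_on {0..t}"
    by (rule integrable_on_subinterval[OF has_integral_integrable[OF h]]) (use t in auto)
  have dh: "integral {0..t} h \<le> d"
    using integral_subset_le[OF _ ih has_integral_integrable[OF h]] h0 t integral_unique[OF h] by auto
  have "norm ((q1 t - x1) - (q2 t - x2)) \<le> integral {0..t} (\<lambda>s. L * norm (q1 s - q2 s) + h s)"
    unfolding integral_unique[OF i1, symmetric]
    by (rule integral_norm_bound_integral) (use i1 ih F t integrable_on_cmult_left[OF ic, of L] in \<open>auto intro!: integrable_add\<close>)
  also have "\<dots> = L * integral {0..t} (\<lambda>s. norm (q1 s - q2 s)) + integral {0..t} h"
    using ih integrable_on_cmult_left[OF ic, of L] by (subst integral_add) auto
  finally have "norm ((q1 t - x1) - (q2 t - x2)) \<le> L * integral {0..t} (\<lambda>s. norm (q1 s - q2 s)) + d" using dh by simp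
  moreover have "norm (q1 t - q2 t) \<le> norm (x1 - x2) + norm ((q1 t - x1) - (q2 t - x2))"
    using norm_triangle_ineq[of "x1 - x2" "(q1 t - x1) - (q2 t - x2)"] by (simp add: algebra_simps)
  ultimately show "norm (q1 t - q2 t) \<le> (norm (x1 - x2) + d) + L * integral {0..t} (\<lambda>s. norm (q1 s - q2 s))" by simp
qed

text \<open>Measurability in time enters as integrability along every continuous curve. Picard
  iteration needs it in this form, and for a field driven by a control it follows by composition
  with a continuous map.\<close>

definition caratheodory :: "(real \<Rightarrow> 'a \<Rightarrow> 'a::euclidean_space) \<Rightarrow> real \<Rightarrow> real \<Rightarrow> bool" where
  "caratheodory g T L \<longleftrightarrow> 0 \<le> L \<and>
     (\<forall>y. continuous_on {0..T} y \<longrightarrow> (\<lambda>s. g s (y s)) integrable_on {0..T}) \<and>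
     (\<forall>s\<in>{0..T}. \<forall>y z. norm (g s y - g s z) \<le> L * norm (y - z))"

text \<open>The integral form carries no exceptional set of times.\<close>

definition integral_curve :: "(real \<Rightarrow> 'a \<Rightarrow> 'a::euclidean_space) \<Rightarrow> real \<Rightarrow> 'a \<Rightarrow> (real \<Rightarrow> 'a) \<Rightarrow> bool" where
  "integral_curve g T x q \<longleftrightarrow> continuous_on {0..T} q \<and>
     (\<forall>t\<in>{0..T}. ((\<lambda>s. g s (q s)) has_integral (q t - x)) {0..t})"

lemma bounded_measurable_integrable_on:
  fixes F :: "real \<Rightarrow> 'a::euclidean_space"
  assumes "F \<in> borel_measurable (lebesgue_on {0..T})" "\<And>s. s \<in> {0..T} \<Longrightarrow> norm (F s) \<le> C" "{c..d} \<subseteq> {0..T}"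
  shows "F integrable_on {c..d}"
proof -
  have "F integrable_on {0..T}"
    by (rule measurable_bounded_by_integrable_imp_integrable[OF assms(1), of "\<lambda>_. C"]) (use assms(2) in auto)
  then show ?thesis using assms(3) by (rule integrable_on_subinterval)
qed

lemma caratheodory_integrable:
  assumes g: "caratheodory g T L" and y: "continuous_on {0..T} y" and cd: "{c..d} \<subseteq> {0..T}"
  shows "(\<lambda>s. g s (y s)) integrable_on {c..d}"
  using g y cd unfolding caratheodory_def by (blast intro: integrable_on_subinterval)

text \<open>Picard iteration contracts in the norm weighted by \<open>exp (- 2 L t)\<close>, whatever the length of the interval.\<close>

lemma caratheodory_existence:
  fixes g :: "real \<Rightarrow> 'a \<Rightarrow> 'a::euclidean_space"
  assumes g: "caratheodory g T L0" and T: "0 \<le> T"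
  shows "\<exists>q. integral_curve g T x q"
proof -
  define L where "L = L0 + 1"
  have L: "0 < L" using g by (simp add: L_def caratheodory_def)
  have gL: "norm (g s y - g s z) \<le> L * norm (y - z)" if "s \<in> {0..T}" for s y z
  proof -
    have "norm (g s y - g s z) \<le> L0 * norm (y - z)" using g that by (simp add: caratheodory_def)
    moreover have "L0 * norm (y - z) \<le> L * norm (y - z)" by (intro mult_right_mono) (auto simp: L_def)
    ultimately show ?thesis by linarith
  qed
  \<comment> \<open>Bounded continuous functions live on the whole line; clamping time to
    \<open>{0..T}\<close> extends \<open>G y\<close> by constants.\<close>
  define cl where "cl = (\<lambda>t::real. max 0 (min T t))"
  have cl: "cl t \<in> {0..T}" for t using T by (auto simp: cl_def)
  have cl_id: "t \<in> {0..T} \<Longrightarrow> cl t = t" for t by (auto simp: cl_def)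
  \<comment> \<open>The unknown is the curve multiplied by \<open>exp (- 2 * L * t)\<close>, so that
    the sup distance of unknowns is the weighted distance of curves. The \<open>2\<close> in the
    exponent yields the contraction factor \<open>1/2\<close>.\<close>
  define G where "G = (\<lambda>(y::real \<Rightarrow>\<^sub>C 'a) t. exp (- 2 * L * t) *\<^sub>R (x + integral {0..t} (\<lambda>s. g s (exp (2 * L * s) *\<^sub>R apply_bcontfun y s))))"
  have cy: "continuous_on {0..T} (\<lambda>s. exp (2 * L * s) *\<^sub>R apply_bcontfun y s)" for y :: "real \<Rightarrow>\<^sub>C 'a"
    by (intro continuous_intros continuous_on_apply_bcontfun)
  have int: "(\<lambda>s. g s (exp (2 * L * s) *\<^sub>R apply_bcontfun y s)) integrable_on {c..d}"
    if "{c..d} \<subseteq> {0..T}" for c d and y :: "real \<Rightarrow>\<^sub>C 'a"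
    by (rule caratheodory_integrable[OF g cy that])
  have contG: "continuous_on {0..T} (G y)" for y
    unfolding G_def by (intro continuous_intros indefinite_integral_continuous_1 int) auto
  have inbc: "(\<lambda>t. G y (cl t)) \<in> bcontfun" for y
  proof -
    have "continuous_on UNIV cl" unfolding cl_def by (intro continuous_intros)
    then have c: "continuous_on UNIV (\<lambda>t. G y (cl t))"
      by (rule continuous_on_compose2[OF contG]) (use cl in auto)
    have "bounded (G y ` {0..T})" using contG by (intro compact_imp_bounded compact_continuous_image) auto
    then obtain C where "\<And>s. s \<in> {0..T} \<Longrightarrow> norm (G y s) \<le> C" unfolding bounded_iff by blast
    with c cl show ?thesis by (intro bcontfun_normI[of _ C]) auto
  qed
  define S where "S = (\<lambda>y. Bcontfun (\<lambda>t. G y (cl t)))"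
  have S: "apply_bcontfun (S y) t = G y (cl t)" for y t
    unfolding S_def by (simp add: Bcontfun_inverse[OF inbc])
  have "dist (S y) (S z) \<le> (1/2) * dist y z" for y z
  proof (rule dist_bound)
    fix t0
    define t where "t = cl t0"
    have t: "t \<in> {0..T}" using cl by (simp add: t_def)
    let ?Y = "\<lambda>y s. g s (exp (2 * L * s) *\<^sub>R apply_bcontfun y s)"
    have iy: "?Y y integrable_on {0..t}" for y using t by (intro int) auto
    have ie: "((\<lambda>s. exp (2 * L * s) * L * dist y z) has_integral (exp (2 * L * t) / 2 * dist y z - exp (2 * L * 0) / 2 * dist y z)) {0..t}"
    proof (rule fundamental_theorem_of_calculus)
      show "0 \<le> t" using t by simp
      fix s show "((\<lambda>s. exp (2 * L * s) / 2 * dist y z) has_vector_derivative exp (2 * L * s) * L * dist y z) (at s within {0..t})"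
        unfolding has_real_derivative_iff_has_vector_derivative[symmetric]
        by (rule derivative_eq_intros refl | simp)+
    qed
    have "norm (integral {0..t} (?Y y) - integral {0..t} (?Y z)) = norm (integral {0..t} (\<lambda>s. ?Y y s - ?Y z s))"
      by (simp add: integral_diff[OF iy iy])
    also have "\<dots> \<le> integral {0..t} (\<lambda>s. exp (2 * L * s) * L * dist y z)"
    proof (rule integral_norm_bound_integral)
      show "(\<lambda>s. ?Y y s - ?Y z s) integrable_on {0..t}" by (intro integrable_diff iy)
      show "(\<lambda>s. exp (2 * L * s) * L * dist y z) integrable_on {0..t}" using ie by blast
      fix s assume s: "s \<in> {0..t}"
      have "norm (?Y y s - ?Y z s) \<le> L * norm (exp (2 * L * s) *\<^sub>R apply_bcontfun y s - exp (2 * L * s) *\<^sub>R apply_bcontfun z s)"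
        using s t by (intro gL) auto
      also have "\<dots> = L * exp (2 * L * s) * dist (apply_bcontfun y s) (apply_bcontfun z s)"
        by (simp add: scaleR_diff_right[symmetric] dist_norm)
      also have "\<dots> \<le> L * exp (2 * L * s) * dist y z" using L by (intro mult_left_mono dist_bounded) auto
      finally show "norm (?Y y s - ?Y z s) \<le> exp (2 * L * s) * L * dist y z" by (simp add: mult_ac)
    qed
    also have "\<dots> = exp (2 * L * t) / 2 * dist y z - dist y z / 2" using integral_unique[OF ie] by simp
    also have "\<dots> \<le> exp (2 * L * t) * (dist y z / 2)" by simp
    finally have *: "norm (integral {0..t} (?Y y) - integral {0..t} (?Y z)) \<le> exp (2 * L * t) * (dist y z / 2)" .
    have "dist (apply_bcontfun (S y) t0) (apply_bcontfun (S z) t0) = exp (- 2 * L * t) * norm (integral {0..t} (?Y y) - integral {0..t} (?Y z))"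
      by (simp add: S t_def[symmetric] G_def dist_norm scaleR_diff_right[symmetric])
    also have "\<dots> \<le> exp (- 2 * L * t) * (exp (2 * L * t) * (dist y z / 2))" by (intro mult_left_mono *) auto
    also have "\<dots> = 1 / 2 * dist y z" by (simp add: mult.assoc[symmetric] exp_add[symmetric])
    finally show "dist (apply_bcontfun (S y) t0) (apply_bcontfun (S z) t0) \<le> 1 / 2 * dist y z" .
  qed
  then have "\<exists>!y. S y = y" by (intro banach_fix_type[of "1/2"]) auto
  then obtain y where y: "S y = y" by blast
  let ?q = "\<lambda>t. exp (2 * L * t) *\<^sub>R apply_bcontfun y t"
  have "integral_curve g T x ?q"
    unfolding integral_curve_def
  proof safe
    show "continuous_on {0..T} ?q" by (rule cy)
    fix t assume t: "t \<in> {0..T}"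
    have "apply_bcontfun y t = G y t" using S[of y t] y cl_id[OF t] by simp
    then have "?q t = x + integral {0..t} (\<lambda>s. g s (?q s))"
      by (simp add: G_def exp_add[symmetric])
    moreover have "(\<lambda>s. g s (?q s)) integrable_on {0..t}" using t by (intro int) auto
    ultimately show "((\<lambda>s. g s (?q s)) has_integral (?q t - x)) {0..t}"
      by (simp add: has_integral_integral)
  qed
  then show ?thesis by blast
qed

section \<open>Curves with prescribed end value, by time reversal\<close>

definition terminal_curve :: "(real \<Rightarrow> 'a \<Rightarrow> 'a::euclidean_space) \<Rightarrow> real \<Rightarrow> 'a \<Rightarrow> (real \<Rightarrow> 'a) \<Rightarrow> bool" where
  "terminal_curve g T p q \<longleftrightarrow> continuous_on {0..T} q \<and>
     (\<forall>t\<in>{0..T}. ((\<lambda>s. g s (q s)) has_integral (p - q t)) {t..T})"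

lemma has_integral_time_reversal:
  fixes F :: "real \<Rightarrow> 'a::euclidean_space"
  shows "((\<lambda>s. F (T - s)) has_integral i) {T - b..T - a} \<longleftrightarrow> (F has_integral i) {a..b}"
proof -
  have *: "((\<lambda>s. F (T - s)) has_integral i) {T - b..T - a}" if "(F has_integral i) {a..b}"
    for F :: "real \<Rightarrow> 'a" and a b
  proof -
    have im: "(\<lambda>x. T - x) ` {a..b} = {T - b..T - a}"
      by (auto simp: image_iff intro!: bexI[of _ "T - _"])
    have "((\<lambda>x. F ((-1) *\<^sub>R x + T)) has_integral (1 / (\<bar>-1\<bar> ^ DIM(real))) *\<^sub>R i)
        ((\<lambda>x. (1 / (-1)) *\<^sub>R x + - ((1 / (-1)) *\<^sub>R T)) ` cbox a b)"
      by (rule has_integral_affinity) (use that in auto)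
    then show ?thesis by (simp add: im minus_diff_eq diff_conv_add_uminus[symmetric] add.commute[of _ T] flip: diff_conv_add_uminus)
  qed
  from *[of F a b] *[of "\<lambda>s. F (T - s)" "T - b" "T - a"] show ?thesis by auto
qed

lemma terminal_curve_iff_reversed:
  assumes "0 \<le> T"
  shows "terminal_curve g T p q \<longleftrightarrow> integral_curve (\<lambda>s z. - g (T - s) z) T p (\<lambda>s. q (T - s))"
proof -
  have c: "continuous_on {0..T} (\<lambda>s. q (T - s))" if "continuous_on {0..T} q" for q :: "real \<Rightarrow> 'a"
    by (rule continuous_on_compose2[OF that]) (auto intro!: continuous_intros)
  have c': "continuous_on {0..T} (\<lambda>s. q (T - s)) \<longleftrightarrow> continuous_on {0..T} q"
    using c[of q] c[of "\<lambda>s. q (T - s)"] by auto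
  have e: "((\<lambda>s. - g (T - s) (q (T - s))) has_integral (q (T - t) - p)) {0..t} \<longleftrightarrow>
      ((\<lambda>s. g s (q s)) has_integral (p - q (T - t))) {T - t..T}" for t
  proof -
    have "((\<lambda>s. - g (T - s) (q (T - s))) has_integral (q (T - t) - p)) {0..t} \<longleftrightarrow>
        ((\<lambda>s. - g s (q s)) has_integral (q (T - t) - p)) {T - t..T}"
      using has_integral_time_reversal[of "\<lambda>s. - g s (q s)" T "q (T - t) - p" T "T - t"] by simp
    also have "\<dots> \<longleftrightarrow> ((\<lambda>s. g s (q s)) has_integral (p - q (T - t))) {T - t..T}"
      using has_integral_neg[of "\<lambda>s. - g s (q s)" "q (T - t) - p" "{T - t..T}"]
        has_integral_neg[of "\<lambda>s. g s (q s)" "p - q (T - t)" "{T - t..T}"] by auto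
    finally show ?thesis .
  qed
  have r: "(\<forall>t\<in>{0..T}. Q (T - t)) \<longleftrightarrow> (\<forall>t\<in>{0..T}. Q t)" for Q :: "real \<Rightarrow> bool"
  proof
    assume A: "\<forall>t\<in>{0..T}. Q (T - t)"
    show "\<forall>t\<in>{0..T}. Q t"
    proof
      fix t assume "t \<in> {0..T}" then show "Q t" using A[rule_format, of "T - t"] by simp
    qed
  qed auto
  show ?thesis
    unfolding terminal_curve_def integral_curve_def c' e
    using r[of "\<lambda>t. ((\<lambda>s. g s (q s)) has_integral (p - q t)) {t..T}"] by simp
qed

lemma caratheodory_reversed:
  assumes g: "caratheodory g T L"
  shows "caratheodory (\<lambda>s z. - g (T - s) z) T L"
  unfolding caratheodory_def
proof (intro conjI allI impI ballI)
  show "0 \<le> L" using g by (simp add: caratheodory_def)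
  fix y :: "real \<Rightarrow> 'a" assume y: "continuous_on {0..T} y"
  have "continuous_on {0..T} (\<lambda>s. y (T - s))"
    by (rule continuous_on_compose2[OF y]) (auto intro!: continuous_intros)
  then have "(\<lambda>s. g s (y (T - s))) integrable_on {0..T}" using g by (simp add: caratheodory_def)
  then obtain i where "((\<lambda>s. g s (y (T - s))) has_integral i) {0..T}" by blast
  then have "((\<lambda>s. g (T - s) (y s)) has_integral i) {0..T}"
    using has_integral_time_reversal[of "\<lambda>s. g s (y (T - s))" T i T 0] by simp
  from has_integral_neg[OF this] show "(\<lambda>s. - g (T - s) (y s)) integrable_on {0..T}" by blast
next
  fix s y z assume "s \<in> {0..T}"
  then have "norm (g (T - s) y - g (T - s) z) \<le> L * norm (y - z)" using g by (simp add: caratheodory_def)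
  then show "norm (- g (T - s) y - - g (T - s) z) \<le> L * norm (y - z)"
    by (simp add: norm_minus_commute)
qed

lemma terminal_curve_existence:
  assumes g: "caratheodory g T L" and T: "0 \<le> T"
  shows "\<exists>q. terminal_curve g T p q"
proof -
  obtain \<mu> where "integral_curve (\<lambda>s z. - g (T - s) z) T p \<mu>"
    using caratheodory_existence[OF caratheodory_reversed[OF g] T] by blast
  then have "terminal_curve g T p (\<lambda>s. \<mu> (T - s))"
    unfolding terminal_curve_iff_reversed[OF T] by simp
  then show ?thesis by blast
qed

lemma terminal_curves_dist_le:
  fixes q1 q2 :: "real \<Rightarrow> 'a::euclidean_space"
  assumes q1: "terminal_curve g1 T p1 q1" and q2: "terminal_curve g2 T p2 q2" and L: "0 \<le> L" and T: "0 \<le> T"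
    and F: "\<And>s. s \<in> {0..T} \<Longrightarrow> norm (g1 s (q1 s) - g2 s (q2 s)) \<le> L * norm (q1 s - q2 s) + d"
    and d: "0 \<le> d" and t: "t \<in> {0..T}"
  shows "norm (q1 t - q2 t) \<le> (norm (p1 - p2) + d * T) * exp (L * T)"
proof -
  note r1 = q1[unfolded terminal_curve_iff_reversed[OF T] integral_curve_def]
  note r2 = q2[unfolded terminal_curve_iff_reversed[OF T] integral_curve_def]
  have "norm (q1 (T - (T - t)) - q2 (T - (T - t))) \<le> (norm (p1 - p2) + d * T) * exp (L * (T - t))"
  proof (rule integral_curves_dist_le[where ?F1.0 = "\<lambda>s. - g1 (T - s) (q1 (T - s))" and ?F2.0 = "\<lambda>s. - g2 (T - s) (q2 (T - s))" and h = "\<lambda>_. d"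
        and ?q1.0 = "\<lambda>s. q1 (T - s)" and ?q2.0 = "\<lambda>s. q2 (T - s)" and T = T])
    fix s assume "s \<in> {0..T}"
    then have "T - s \<in> {0..T}" by auto
    from F[OF this] show "norm (- g1 (T - s) (q1 (T - s)) - - g2 (T - s) (q2 (T - s))) \<le> L * norm (q1 (T - s) - q2 (T - s)) + d"
      by (simp add: norm_minus_commute)
  next
    show "((\<lambda>_. d) has_integral d * T) {0..T}" using has_integral_const_real[of d 0 T] T by (simp add: mult.commute)
  qed (use r1 r2 L d t in auto)
  also have "\<dots> \<le> (norm (p1 - p2) + d * T) * exp (L * T)"
    using L t d T by (intro mult_left_mono) (auto intro: mult_left_mono)
  finally show ?thesis by simp
qed

lemma lipschitz_of_has_integral:
  fixes F :: "real \<Rightarrow> 'a::euclidean_space"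
  assumes q: "\<And>t. t \<in> {0..T} \<Longrightarrow> (F has_integral (q t - x)) {0..t}"
    and B: "\<And>s. s \<in> {0..T} \<Longrightarrow> norm (F s) \<le> B" and "0 \<le> B"
  shows "B-lipschitz_on {0..T} q"
proof (rule lipschitz_onI)
  have *: "norm (q b - q a) \<le> B * (b - a)" if "0 \<le> a" "a \<le> b" "b \<le> T" for a b
  proof -
    have F: "F integrable_on {0..b}" using q[of b] that by auto
    have i: "(F has_integral (q b - q a)) {a..b}"
    proof -
      have "integral {0..a} F + integral {a..b} F = integral {0..b} F"
        using that F by (intro Henstock_Kurzweil_Integration.integral_combine) auto
      then have "integral {a..b} F = q b - q a"
        using integral_unique[OF q[of a]] integral_unique[OF q[of b]] that by (simp add: algebra_simps)
      moreover have "F integrable_on {a..b}" by (rule integrable_on_subinterval[OF F]) (use that in auto)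
      ultimately show ?thesis by (simp add: has_integral_integral)
    qed
    have "norm (q b - q a) \<le> B * measure lborel (cbox a b)"
      by (rule has_integral_bound[of B F]) (use \<open>0 \<le> B\<close> i B that in auto)
    then show ?thesis using that by simp
  qed
  fix s t assume "s \<in> {0..T}" "t \<in> {0..T}"
  then show "dist (q s) (q t) \<le> B * dist s t"
    using *[of s t] *[of t s] by (cases "s \<le> t") (auto simp: dist_norm norm_minus_commute)
qed fact

text \<open>Integration by parts almost everywhere: the product of two Lipschitz functions on a
  compact interval is again Lipschitz, so the product rule off the null set \<open>N\<close>
  integrates to the boundary terms.\<close>

lemma inner_has_integral:
  fixes q l :: "real \<Rightarrow> 'a::euclidean_space"
  assumes T: "0 \<le> T" and q: "Lq-lipschitz_on {0..T} q" and l: "Ll-lipschitz_on {0..T} l" and N: "negligible N"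
    and dq: "\<And>t. t \<in> {0..T} - N \<Longrightarrow> (q has_vector_derivative q' t) (at t within {0..T})"
    and dl: "\<And>t. t \<in> {0..T} - N \<Longrightarrow> (l has_vector_derivative l' t) (at t within {0..T})"
  shows "((\<lambda>t. l t \<bullet> q' t + l' t \<bullet> q t) has_integral (l T \<bullet> q T - l 0 \<bullet> q 0)) {0..T}"
proof -
  have "bounded (q ` {0..T})" "bounded (l ` {0..T})"
    using lipschitz_on_continuous_on[OF q] lipschitz_on_continuous_on[OF l]
    by (auto intro!: compact_imp_bounded compact_continuous_image)
  then obtain Cq Cl where Cq: "\<And>t. t \<in> {0..T} \<Longrightarrow> norm (q t) \<le> Cq" and Cl: "\<And>t. t \<in> {0..T} \<Longrightarrow> norm (l t) \<le> Cl"
    unfolding bounded_iff by blast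
  have nn: "0 \<le> Cq" "0 \<le> Cl" using Cq[of 0] Cl[of 0] T norm_ge_zero order_trans by (auto, blast+)
  have nn': "0 \<le> Lq" "0 \<le> Ll" using q l lipschitz_on_nonneg by blast+
  have lip: "(Cl * Lq + Ll * Cq)-lipschitz_on {0..T} (\<lambda>t. l t \<bullet> q t)"
  proof (rule lipschitz_onI)
    fix s t assume st: "s \<in> {0..T}" "t \<in> {0..T}"
    have "l s \<bullet> q s - l t \<bullet> q t = l s \<bullet> (q s - q t) + (l s - l t) \<bullet> q t" by (simp add: inner_diff)
    then have "\<bar>l s \<bullet> q s - l t \<bullet> q t\<bar> \<le> norm (l s) * norm (q s - q t) + norm (l s - l t) * norm (q t)"
      using Cauchy_Schwarz_ineq2[of "l s" "q s - q t"] Cauchy_Schwarz_ineq2[of "l s - l t" "q t"] by linarith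
    also have "\<dots> \<le> Cl * (Lq * dist s t) + (Ll * dist s t) * Cq"
      using lipschitz_onD[OF q st] lipschitz_onD[OF l st] Cq[OF st(2)] Cl[OF st(1)] nn nn'
      by (intro add_mono mult_mono) (auto simp: dist_norm)
    finally show "dist (l s \<bullet> q s) (l t \<bullet> q t) \<le> (Cl * Lq + Ll * Cq) * dist s t"
      by (simp add: dist_norm algebra_simps)
  qed (use nn nn' in simp)
  show ?thesis
  proof (rule lipschitz_fundamental_theorem_of_calculus[OF T lip N])
    fix t assume t: "t \<in> {0..T} - N"
    show "((\<lambda>t. l t \<bullet> q t) has_vector_derivative l t \<bullet> q' t + l' t \<bullet> q t) (at t within {0..T})"
      using dq[OF t] dl[OF t] unfolding has_vector_derivative_def
      by (auto intro!: derivative_eq_intros simp: algebra_simps)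
  qed
qed

section \<open>Lebesgue points of controls\<close>

text \<open>The norm stands inside the integral: averages of \<open>u\<close> alone would say
  nothing about nonlinear functions of \<open>u\<close>. Both one-sided averages are asked for
  because the derivative of a curve at an interior time is two-sided.\<close>

definition lebesgue_point :: "real \<Rightarrow> (real \<Rightarrow> 'b::euclidean_space) \<Rightarrow> real \<Rightarrow> bool" where
  "lebesgue_point T u t \<longleftrightarrow> 0 < t \<and> t < T \<and> (\<forall>e>0. \<exists>d>0. \<forall>h. 0 < h \<and> h < d \<longrightarrow>
     integral {t..t+h} (\<lambda>s. norm (u s - u t)) \<le> e * h \<and> integral {t-h..t} (\<lambda>s. norm (u s - u t)) \<le> e * h)"

lemma norm_diff_integrable_on:
  fixes u :: "real \<Rightarrow> 'b::euclidean_space"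
  assumes u: "u \<in> borel_measurable (lebesgue_on {0..T})" and bd: "bounded (u ` {0..T})" and cd: "{c..d} \<subseteq> {0..T}"
  shows "(\<lambda>s. norm (u s - r)) integrable_on {c..d}"
proof -
  obtain C where C: "\<And>s. s \<in> {0..T} \<Longrightarrow> norm (u s) \<le> C" using bd unfolding bounded_iff by blast
  show ?thesis
  proof (rule bounded_measurable_integrable_on[OF _ _ cd])
    show "(\<lambda>s. norm (u s - r)) \<in> borel_measurable (lebesgue_on {0..T})" using u by measurable
    fix s assume s: "s \<in> {0..T}"
    have "norm (u s - r) \<le> C + norm r" using norm_triangle_ineq4[of "u s" r] C[OF s] by simp
    then show "norm (norm (u s - r)) \<le> C + norm r" by simp
  qed
qed

text \<open>Lebesgue differentiation is applied to the countably many functions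
  \<open>norm (u s - r)\<close> with \<open>r\<close> in a dense set; at a good time
  \<open>u t\<close> itself is approximated by such an \<open>r\<close>. Left averages are right
  averages of the reflected function.\<close>

lemma lebesgue_points_negligible:
  fixes u :: "real \<Rightarrow> 'b::euclidean_space"
  assumes u: "u \<in> borel_measurable (lebesgue_on {0..T})" and bd: "bounded (u ` {0..T})"
  obtains N where "negligible N" "\<And>t. t \<in> {0..T} - N \<Longrightarrow> lebesgue_point T u t"
proof -
  obtain Q :: "'b set" where Q: "countable Q" "\<And>X. open X \<Longrightarrow> X \<noteq> {} \<Longrightarrow> \<exists>d\<in>Q. d \<in> X"
    using countable_dense_exists by blast
  \<comment> \<open>Cut off outside \<open>{0..T}\<close>: the differentiation theorem wants
    integrability on every interval.\<close>
  define F where "F = (\<lambda>r s. if s \<in> {0..T} then norm (u s - r) else 0)"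
  have iF: "F r integrable_on {c..d}" for r c d
  proof -
    have "(\<lambda>s. norm (u s - r)) integrable_on {0..T}" using norm_diff_integrable_on[OF u bd] by blast
    then have "F r integrable_on UNIV" unfolding F_def integrable_restrict_UNIV .
    then show ?thesis by (rule integrable_on_subinterval) auto
  qed
  have iF': "(\<lambda>s. F r (- s)) integrable_on {c..d}" for r c d
    using iF[of r "-d" "-c"] Henstock_Kurzweil_Integration.integrable_reflect_real[where f="F r" and a="-d" and b="-c"] by (simp only: minus_minus)
  have "\<exists>N. negligible N \<and> (\<forall>x e. x \<notin> N \<and> 0 < e \<longrightarrow> (\<exists>d>0. \<forall>h. 0 < h \<and> h < d \<longrightarrow>
      norm (integral {x..x+h} f / h - f x) < e))" if f: "\<And>a b. f integrable_on {a..b}" for f :: "real \<Rightarrow> real"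
  proof -
    have f': "f integrable_on cbox a b" for a b using f by simp
    obtain N where N: "negligible N" "\<And>x e. \<lbrakk>x \<notin> N; 0 < e\<rbrakk> \<Longrightarrow> \<exists>d>0. \<forall>h. 0 < h \<and> h < d \<longrightarrow>
                         norm(integral (cbox x (x + h *\<^sub>R One)) f /\<^sub>R h ^ DIM(real) - f x) < e"
      using integrable_ccontinuous_explicit[of f, OF f'] by blast
    show ?thesis
      by (rule exI[of _ N], rule conjI[OF N(1)], intro allI impI)
        (use N(2) in \<open>simp add: divide_inverse_commute\<close>)
  qed
  note X = this
  have "\<forall>r. \<exists>N. negligible N \<and> (\<forall>x e. x \<notin> N \<and> 0 < e \<longrightarrow> (\<exists>d>0. \<forall>h. 0 < h \<and> h < d \<longrightarrow>
      norm (integral {x..x+h} (F r) / h - F r x) < e))" using X iF by blast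
  then obtain N1 where N1: "\<And>r. negligible (N1 r)" "\<And>r x e. x \<notin> N1 r \<Longrightarrow> 0 < e \<Longrightarrow> \<exists>d>0. \<forall>h. 0 < h \<and> h < d \<longrightarrow>
      norm (integral {x..x+h} (F r) / h - F r x) < e" by metis
  have "\<forall>r. \<exists>N. negligible N \<and> (\<forall>x e. x \<notin> N \<and> 0 < e \<longrightarrow> (\<exists>d>0. \<forall>h. 0 < h \<and> h < d \<longrightarrow>
      norm (integral {x..x+h} (\<lambda>s. F r (- s)) / h - F r (- x)) < e))" 
  proof
    fix r show "\<exists>N. negligible N \<and> (\<forall>x e. x \<notin> N \<and> 0 < e \<longrightarrow> (\<exists>d>0. \<forall>h. 0 < h \<and> h < d \<longrightarrow>
      norm (integral {x..x+h} (\<lambda>s. F r (- s)) / h - F r (- x)) < e))"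
      by (rule X[of "\<lambda>s. F r (- s)"]) (rule iF')
  qed
  then obtain N2 where N2: "\<And>r. negligible (N2 r)" "\<And>r x e. x \<notin> N2 r \<Longrightarrow> 0 < e \<Longrightarrow> \<exists>d>0. \<forall>h. 0 < h \<and> h < d \<longrightarrow>
      norm (integral {x..x+h} (\<lambda>s. F r (- s)) / h - F r (- x)) < e" by metis
  define N where "N = {0, T} \<union> (\<Union>r\<in>Q. N1 r \<union> uminus ` N2 r)"
  have "negligible N"
  proof -
    have "negligible (uminus ` N2 r)" for r
      by (rule negligible_differentiable_image_negligible[OF _ N2(1)]) (auto simp: differentiable_on_def)
    then have "negligible (\<Union>r\<in>Q. N1 r \<union> uminus ` N2 r)"
      using Q(1) N1(1) by (intro negligible_countable_Union) (auto intro: negligible_Un)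
    moreover have "negligible {0, T}" by (intro negligible_finite) auto
    ultimately show ?thesis unfolding N_def by (rule negligible_Un[rotated])
  qed
  moreover have "lebesgue_point T u t" if t: "t \<in> {0..T} - N" for t
    unfolding lebesgue_point_def
  proof (intro conjI allI impI)
    show t0: "0 < t" and tT: "t < T" using t by (auto simp: N_def less_le)
    fix e :: real assume e: "0 < e"
    \<comment> \<open>Three errors of size \<open>e / 4\<close> will occur: the differentiation
      quotient, \<open>F r t\<close>, and the replacement of \<open>u t\<close> by
      \<open>r\<close>.\<close>
    obtain r where r: "r \<in> Q" "norm (u t - r) < e / 4"
      using Q(2)[of "ball (u t) (e/4)"] e by (auto simp: dist_norm)
    have n: "t \<notin> N1 r" "- t \<notin> N2 r" using t r(1) by (force simp: N_def)+
    obtain d1 where d1: "d1 > 0" "\<And>h. 0 < h \<Longrightarrow> h < d1 \<Longrightarrow> norm (integral {t..t+h} (F r) / h - F r t) < e/4"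
      using N1(2)[OF n(1), of "e/4"] e by auto
    obtain d2 where d2: "d2 > 0" "\<And>h. 0 < h \<Longrightarrow> h < d2 \<Longrightarrow> norm (integral {-t..-t+h} (\<lambda>s. F r (-s)) / h - F r t) < e/4"
      using N2(2)[OF n(2), of "e/4"] e by auto
    have Frt: "F r t < e / 4" using r t by (simp add: F_def)
    have key: "integral {a..b} (\<lambda>s. norm (u s - u t)) \<le> e * (b - a)"
      if ab: "{a..b} \<subseteq> {0..T}" "a < b" and I: "norm (integral {a..b} (F r) / (b - a) - F r t) < e/4" for a b
    proof -
      have "integral {a..b} (F r) / (b - a) < e / 2" using I Frt unfolding real_norm_def abs_less_iff by linarith
      then have I2: "integral {a..b} (F r) < (e / 2) * (b - a)" using ab by (simp add: field_simps)
      have "integral {a..b} (\<lambda>s. norm (u s - u t)) \<le> integral {a..b} (\<lambda>s. F r s + e / 4)"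
      proof (rule integral_le)
        show "(\<lambda>s. norm (u s - u t)) integrable_on {a..b}" by (rule norm_diff_integrable_on[OF u bd ab(1)])
        show "(\<lambda>s. F r s + e / 4) integrable_on {a..b}" by (intro integrable_add iF) auto
        fix s assume "s \<in> {a..b}"
        then have "F r s = norm (u s - r)" using ab by (auto simp: F_def)
        then show "norm (u s - u t) \<le> F r s + e / 4"
          using norm_triangle_ineq4[of "u s - r" "u t - r"] r(2) by simp
      qed
      also have "\<dots> = integral {a..b} (F r) + e / 4 * (b - a)" using ab by (subst integral_add) (auto intro: iF)
      also have "\<dots> \<le> e / 2 * (b - a) + e / 4 * (b - a)" using I2 by simp
      also have "\<dots> \<le> e * (b - a)" using e ab by (simp add: field_simps)
      finally show ?thesis .
    qed
    show "\<exists>d>0. \<forall>h. 0 < h \<and> h < d \<longrightarrow>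
         integral {t..t + h} (\<lambda>s. norm (u s - u t)) \<le> e * h \<and>
         integral {t - h..t} (\<lambda>s. norm (u s - u t)) \<le> e * h"
    proof (rule exI[of _ "min (min d1 d2) (min t (T - t))"], intro conjI allI impI)
      show "0 < min (min d1 d2) (min t (T - t))" using d1 d2 t0 tT by simp
      fix h assume h: "0 < h \<and> h < min (min d1 d2) (min t (T - t))"
      show "integral {t..t + h} (\<lambda>s. norm (u s - u t)) \<le> e * h"
        using key[of t "t + h"] d1(2)[of h] h t0 by auto
      have "integral {-t..-t+h} (\<lambda>s. F r (-s)) = integral {t-h..t} (F r)"
        using Henstock_Kurzweil_Integration.integral_reflect_real[where b="t" and a="t-h" and f="F r"] by simp
      then show "integral {t - h..t} (\<lambda>s. norm (u s - u t)) \<le> e * h"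
        using key[of "t - h" t] d2(2)[of h] h tT by auto
    qed
  qed
  ultimately show ?thesis using that by blast
qed

lemma measurable_control_compose:
  fixes u :: "real \<Rightarrow> 'b::euclidean_space" and F :: "real \<Rightarrow> 'b \<Rightarrow> 'a::euclidean_space"
  assumes u: "u \<in> borel_measurable (lebesgue_on {0..T})" and uV: "u ` {0..T} \<subseteq> V"
    and F: "continuous_on ({0..T} \<times> V) (\<lambda>(s, v). F s v)"
  shows "(\<lambda>s. F s (u s)) \<in> borel_measurable (lebesgue_on {0..T})"
proof -
  have "(\<lambda>s. s) \<in> borel_measurable (lebesgue_on {0..T})"
    using id_borel_measurable_lebesgue_on by (simp add: id_def)
  then have "(\<lambda>s. (s, u s)) \<in> borel_measurable (lebesgue_on {0..T})" using u by (rule borel_measurable_Pair)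
  then have "(\<lambda>s. (s, u s)) \<in> measurable (lebesgue_on {0..T}) (restrict_space borel ({0..T} \<times> V))"
    using uV by (intro measurable_restrict_space2) auto
  from measurable_compose[OF this borel_measurable_continuous_on_restrict[OF F]]
  show ?thesis by simp
qed

text \<open>Here a Lebesgue point of \<open>u\<close> becomes a point of differentiability for the
  integral of every continuous \<open>F s (u s)\<close>, with no further null set depending on
  \<open>F\<close>.\<close>

lemma lebesgue_point_average:
  fixes u :: "real \<Rightarrow> 'b::euclidean_space" and F :: "real \<Rightarrow> 'b \<Rightarrow> 'a::euclidean_space"
  assumes u: "u \<in> borel_measurable (lebesgue_on {0..T})" and uV: "u ` {0..T} \<subseteq> V" and V: "compact V"
    and F: "continuous_on ({0..T} \<times> V) (\<lambda>(s, v). F s v)"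
    and t: "lebesgue_point T u t" and e: "0 < e"
  shows "\<exists>d>0. \<forall>h. 0 < h \<and> h < d \<longrightarrow> norm (integral {t..t+h} (\<lambda>s. F s (u s)) - h *\<^sub>R F t (u t)) \<le> e * h \<and>
     norm (integral {t-h..t} (\<lambda>s. F s (u s)) - h *\<^sub>R F t (u t)) \<le> e * h"
proof -
  have bdu: "bounded (u ` {0..T})" using bounded_subset[OF compact_imp_bounded[OF V] uV] .
  have t0: "0 < t" and tT: "t < T" using t by (auto simp: lebesgue_point_def)
  have cK: "compact ({0..T} \<times> V)" using V by (intro compact_Times) auto
  have "bounded ((\<lambda>(s, v). F s v) ` ({0..T} \<times> V))"
    by (intro compact_imp_bounded compact_continuous_image F cK)
  then obtain B0 where B0: "\<And>z. z \<in> (\<lambda>(s, v). F s v) ` ({0..T} \<times> V) \<Longrightarrow> norm z \<le> B0" unfolding bounded_iff by blast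
  define B where "B = max B0 1"
  have B1: "0 < B" by (simp add: B_def)
  have B: "norm (F s (u s)) \<le> B" if "s \<in> {0..T}" for s
    using B0[of "F s (u s)"] uV that by (force simp: B_def)
  have mF: "(\<lambda>s. F s (u s)) \<in> borel_measurable (lebesgue_on {0..T})" by (rule measurable_control_compose[OF u uV F])
  have "uniformly_continuous_on ({0..T} \<times> V) (\<lambda>(s, v). F s v)" by (rule compact_uniformly_continuous[OF F cK])
  then obtain \<delta> where \<delta>: "0 < \<delta>" and uc: "\<And>z z'. z \<in> {0..T} \<times> V \<Longrightarrow> z' \<in> {0..T} \<times> V \<Longrightarrow> dist z' z < \<delta> \<Longrightarrow>
     dist ((\<lambda>(s, v). F s v) z') ((\<lambda>(s, v). F s v) z) < e / 2"
    unfolding uniformly_continuous_on_def using half_gt_zero[OF e] by blast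
  \<comment> \<open>Where \<open>u s\<close> is far from \<open>u t\<close>, only the bound
    \<open>2 * B\<close> is known; \<open>c * (\<delta> / 2) = 2 * B\<close> absorbs it into
    \<open>c * norm (u s - u t)\<close>, whose average is small.\<close>
  define c where "c = 4 * B / \<delta>"
  have c: "0 < c" using B1 \<delta> by (simp add: c_def)
  have pw: "norm (F s (u s) - F t (u t)) \<le> e / 2 + c * norm (u s - u t)" if s: "s \<in> {0..T}" "\<bar>s - t\<bar> < \<delta> / 2" for s
  proof (cases "norm (u s - u t) < \<delta> / 2")
    case True
    have "dist (s, u s) (t, u t) \<le> dist s t + dist (u s) (u t)"
      unfolding dist_Pair_Pair by (rule sqrt_sum_squares_le_sum) auto
    also have "\<dots> < \<delta>" using s True by (simp add: dist_norm)
    finally have "dist (F s (u s)) (F t (u t)) < e / 2"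
      using uc[of "(t, u t)" "(s, u s)"] s t0 tT uV by (simp add: image_subset_iff)
    moreover have "0 \<le> c * norm (u s - u t)" using c by simp
    ultimately show ?thesis by (simp add: dist_norm)
  next
    case False
    have "norm (F s (u s) - F t (u t)) \<le> B + B"
      using norm_triangle_ineq4[of "F s (u s)" "F t (u t)"] B[of s] B[of t] s t0 tT by force
    also have "\<dots> = c * (\<delta> / 2)" using \<delta> by (simp add: c_def)
    also have "\<dots> \<le> c * norm (u s - u t)" using False c by (intro mult_left_mono) auto
    finally show ?thesis using e by simp
  qed
  have ec: "0 < e / (2 * c)" using e c by simp
  obtain d where d: "0 < d" "\<And>h. 0 < h \<Longrightarrow> h < d \<Longrightarrow>
     integral {t..t+h} (\<lambda>s. norm (u s - u t)) \<le> e / (2 * c) * h \<and> integral {t-h..t} (\<lambda>s. norm (u s - u t)) \<le> e / (2 * c) * h"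
    using t[unfolded lebesgue_point_def, THEN conjunct2, THEN conjunct2, rule_format, OF ec] by blast
  have key: "norm (integral {a..b} (\<lambda>s. F s (u s)) - (b - a) *\<^sub>R F t (u t)) \<le> e * (b - a)"
    if ab: "{a..b} \<subseteq> {0..T}" "a < b" "\<And>s. s \<in> {a..b} \<Longrightarrow> \<bar>s - t\<bar> < \<delta> / 2"
      and I: "integral {a..b} (\<lambda>s. norm (u s - u t)) \<le> e / (2 * c) * (b - a)" for a b
  proof -
    have iF: "(\<lambda>s. F s (u s)) integrable_on {a..b}" by (rule bounded_measurable_integrable_on[OF mF B ab(1)])
    have iu: "(\<lambda>s. c * norm (u s - u t)) integrable_on {a..b}"
      using integrable_on_cmult_left[OF norm_diff_integrable_on[OF u bdu ab(1)], of c] by simp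
    have "integral {a..b} (\<lambda>s. F s (u s)) - (b - a) *\<^sub>R F t (u t) = integral {a..b} (\<lambda>s. F s (u s) - F t (u t))"
      using ab by (subst integral_diff[OF iF]) auto
    also have "norm \<dots> \<le> integral {a..b} (\<lambda>s. e / 2 + c * norm (u s - u t))"
    proof (rule integral_norm_bound_integral)
      show "(\<lambda>s. F s (u s) - F t (u t)) integrable_on {a..b}" using iF by (intro integrable_diff) auto
      show "(\<lambda>s. e / 2 + c * norm (u s - u t)) integrable_on {a..b}" using iu by (intro integrable_add) auto
    qed (use pw ab in auto)
    also have "\<dots> = e / 2 * (b - a) + c * integral {a..b} (\<lambda>s. norm (u s - u t))"
      using ab by (subst integral_add) (auto intro: iu)
    also have "\<dots> \<le> e / 2 * (b - a) + c * (e / (2 * c) * (b - a))" using I c by (intro add_left_mono mult_left_mono) auto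
    also have "\<dots> = e * (b - a)" using c by simp
    finally show ?thesis .
  qed
  show ?thesis
  proof (rule exI[of _ "min (min d (\<delta>/2)) (min t (T - t))"], intro conjI allI impI)
    show "0 < min (min d (\<delta>/2)) (min t (T - t))" using d t0 tT \<delta> by simp
    fix h assume h: "0 < h \<and> h < min (min d (\<delta>/2)) (min t (T - t))"
    show "norm (integral {t..t+h} (\<lambda>s. F s (u s)) - h *\<^sub>R F t (u t)) \<le> e * h"
      using key[of t "t + h"] d(2)[of h] h t0 by auto
    show "norm (integral {t-h..t} (\<lambda>s. F s (u s)) - h *\<^sub>R F t (u t)) \<le> e * h"
      using key[of "t - h" t] d(2)[of h] h tT by auto
  qed
qed

lemma lebesgue_point_has_vector_derivative:
  fixes u :: "real \<Rightarrow> 'b::euclidean_space" and F :: "real \<Rightarrow> 'b \<Rightarrow> 'a::euclidean_space"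
  assumes u: "u \<in> borel_measurable (lebesgue_on {0..T})" and uV: "u ` {0..T} \<subseteq> V" and V: "compact V"
    and F: "continuous_on ({0..T} \<times> V) (\<lambda>(s, v). F s v)"
    and t: "lebesgue_point T u t"
    and q: "\<And>t. t \<in> {0..T} \<Longrightarrow> ((\<lambda>s. F s (u s)) has_integral (q t - x)) {0..t}"
  shows "(q has_vector_derivative F t (u t)) (at t within {0..T})"
  unfolding has_vector_derivative_def has_derivative_within_alt
proof (intro conjI allI impI)
  show "bounded_linear (\<lambda>h. h *\<^sub>R F t (u t))" by (rule bounded_linear_scaleR_left)
  fix e :: real assume e: "0 < e"
  have t0: "0 < t" and tT: "t < T" using t by (auto simp: lebesgue_point_def)
  obtain d where d: "0 < d" and dh: "\<And>h. 0 < h \<Longrightarrow> h < d \<Longrightarrow> norm (integral {t..t+h} (\<lambda>s. F s (u s)) - h *\<^sub>R F t (u t)) \<le> e * h \<and>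
     norm (integral {t-h..t} (\<lambda>s. F s (u s)) - h *\<^sub>R F t (u t)) \<le> e * h"
    using lebesgue_point_average[OF u uV V F t e] by auto
  have diff: "q b - q a = integral {a..b} (\<lambda>s. F s (u s))" if "0 \<le> a" "a \<le> b" "b \<le> T" for a b
  proof -
    have "integral {0..a} (\<lambda>s. F s (u s)) + integral {a..b} (\<lambda>s. F s (u s)) = integral {0..b} (\<lambda>s. F s (u s))"
      using that q[of b] by (intro Henstock_Kurzweil_Integration.integral_combine) auto
    then show ?thesis using integral_unique[OF q[of a]] integral_unique[OF q[of b]] that by (simp add: algebra_simps)
  qed
  show "\<exists>d>0. \<forall>y\<in>{0..T}. norm (y - t) < d \<longrightarrow> norm (q y - q t - (y - t) *\<^sub>R F t (u t)) \<le> e * norm (y - t)"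
  proof (rule exI[of _ d], intro conjI ballI impI)
    show "0 < d" by (rule d)
    fix y assume y: "y \<in> {0..T}" "norm (y - t) < d"
    consider "y = t" | "y > t" | "y < t" by linarith
    then show "norm (q y - q t - (y - t) *\<^sub>R F t (u t)) \<le> e * norm (y - t)"
    proof cases
      case 2
      then show ?thesis using dh[of "y - t"] diff[of t y] y t0 tT by auto
    next
      case 3
      then have "norm (q t - q y - (t - y) *\<^sub>R F t (u t)) \<le> e * (t - y)" using dh[of "t - y"] diff[of y t] y t0 tT by auto
      moreover have "q y - q t - (y - t) *\<^sub>R F t (u t) = - (q t - q y - (t - y) *\<^sub>R F t (u t))" by (simp add: algebra_simps)
      ultimately show ?thesis using 3 by (simp only: norm_minus_cancel) simp
    qed simp
  qed
qed

section \<open>Control systems near a trajectory\<close>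

lemma control_system_has_derivative:
  assumes "control_system M U f" "v \<in> closure U" "q \<in> M"
  shows "(f v has_derivative frechet_derivative (f v) (at q)) (at q)"
proof -
  have "smooth_vf M (f v)" "open M" using assms by (auto simp: control_system_def)
  then have "iter_deriv [] (f v) differentiable_on M" "open M" unfolding smooth_vf_def by blast+
  then have "f v differentiable (at q within M)" "open M" using assms(3) by (auto simp: differentiable_on_def)
  then have "f v differentiable (at q)" using at_within_open[OF assms(3)] by metis
  then show ?thesis by (simp add: frechet_derivative_works)
qed

lemma control_system_continuous:
  assumes "control_system M U f"
  shows "continuous_on (M \<times> closure U) (\<lambda>(q, v). f v q)"
    and "continuous_on (M \<times> closure U) (\<lambda>(q, v). frechet_derivative (f v) (at q) w)"
proof -
  have *: "continuous_on (M \<times> closure U) (\<lambda>(q, u). iter_deriv vs (f u) q)" for vs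
    using assms by (simp add: control_system_def)
  show "continuous_on (M \<times> closure U) (\<lambda>(q, v). f v q)" using *[of "[]"] by simp
  show "continuous_on (M \<times> closure U) (\<lambda>(q, v). frechet_derivative (f v) (at q) w)" using *[of "[w]"] by simp
qed

lemma AE_lebesgue_on_negligible:
  fixes S :: "real set"
  assumes "AE t in lebesgue_on S. P t" "S \<in> sets lebesgue"
  obtains N where "negligible N" "\<And>t. t \<in> S - N \<Longrightarrow> P t"
proof -
  have "AE t in lebesgue. t \<in> S \<longrightarrow> P t" using assms by (subst (asm) AE_restrict_space_iff) auto
  then obtain N where "{t \<in> space lebesgue. \<not> (t \<in> S \<longrightarrow> P t)} \<subseteq> N" "N \<in> null_sets lebesgue"
    by (auto simp: eventually_ae_filter)
  then show ?thesis using that[of N] by (auto simp: negligible_iff_null_sets)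
qed

lemma negligible_AE_lebesgue_on:
  fixes S :: "real set"
  assumes N: "negligible N" "\<And>t. t \<in> S - N \<Longrightarrow> P t" and S: "S \<in> sets lebesgue"
  shows "AE t in lebesgue_on S. P t"
proof -
  have "AE t in lebesgue. t \<in> S \<longrightarrow> P t"
    by (rule AE_I'[of N]) (use N in \<open>auto simp: negligible_iff_null_sets\<close>)
  then show ?thesis using S by (subst AE_restrict_space_iff) auto
qed

lemma trajectory_integral_curve:
  assumes "trajectory M f T u x q" "0 \<le> T"
  shows "integral_curve (\<lambda>s. f (u s)) T x q" "q ` {0..T} \<subseteq> M"
proof -
  obtain L where L: "L-lipschitz_on {0..T} q" and q0: "q 0 = x" "q ` {0..T} \<subseteq> M"
    and ae: "AE t in lebesgue_on {0..T}. (q has_vector_derivative f (u t) (q t)) (at t within {0..T})"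
    using assms unfolding trajectory_def by blast
  obtain N where N: "negligible N" "\<And>t. t \<in> {0..T} - N \<Longrightarrow> (q has_vector_derivative f (u t) (q t)) (at t within {0..T})"
    using AE_lebesgue_on_negligible[OF ae] by auto
  show "q ` {0..T} \<subseteq> M" by (rule q0)
  show "integral_curve (\<lambda>s. f (u s)) T x q"
    unfolding integral_curve_def
  proof (intro conjI ballI)
    show "continuous_on {0..T} q" by (rule lipschitz_on_continuous_on[OF L])
    fix t assume t: "t \<in> {0..T}"
    have "((\<lambda>s. f (u s) (q s)) has_integral (q t - q 0)) {0..t}"
    proof (rule lipschitz_fundamental_theorem_of_calculus[OF _ _ N(1)])
      show "L-lipschitz_on {0..t} q" by (rule lipschitz_on_subset[OF L]) (use t in auto)
      fix s assume "s \<in> {0..t} - N"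
      then show "(q has_vector_derivative f (u s) (q s)) (at s within {0..t})"
        using t by (intro has_vector_derivative_within_subset[OF N(2)]) auto
    qed (use t in auto)
    then show "((\<lambda>s. f (u s) (q s)) has_integral (q t - x)) {0..t}" using q0 by simp
  qed
qed

lemma admissible_control_compact:
  assumes "admissible_control U T u"
  shows "compact (closure (u ` {0..T}))" "closure (u ` {0..T}) \<subseteq> closure U"
    "u ` {0..T} \<subseteq> closure (u ` {0..T})" "u \<in> borel_measurable (lebesgue_on {0..T})" "bounded (u ` {0..T})"
  using assms closure_mono[of "u ` {0..T}" U] closure_subset[of "u ` {0..T}"]
  by (simp_all add: admissible_control_def compact_closure)

lemma continuous_along_curve:
  assumes F: "continuous_on (M \<times> closure U) (\<lambda>(q, v). F q v)" and q: "continuous_on S q" "q ` S \<subseteq> M" and V: "V \<subseteq> closure U"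
  shows "continuous_on (S \<times> V) (\<lambda>(s, v). F (q s) v)"
proof -
  have "continuous_on (S \<times> V) (\<lambda>z. (q (fst z), snd z))"
    by (intro continuous_intros continuous_on_compose2[OF q(1)]) auto
  then have "continuous_on (S \<times> V) (\<lambda>z. (\<lambda>(q, v). F q v) (q (fst z), snd z))"
    by (rule continuous_on_compose2[OF F]) (use q(2) V in auto)
  then show ?thesis by (simp add: case_prod_beta)
qed

lemma integral_curve_start:
  assumes "integral_curve g T x q" "0 \<le> T"
  shows "q 0 = x"
proof -
  have "((\<lambda>s. g s (q s)) has_integral (q 0 - x)) {0..0}"
    using assms unfolding integral_curve_def by (meson atLeastAtMost_iff order_refl)
  then have "((\<lambda>s. g s (q s)) has_integral (q 0 - x)) {0}" by simp
  from has_integral_unique[OF this has_integral_refl(2)] show ?thesis by simp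
qed

lemma integral_curve_regular:
  assumes sys: "control_system M U f" and u: "admissible_control U T u" and T: "0 \<le> T"
    and q: "integral_curve (\<lambda>s. f (u s)) T x q" and qM: "q ` {0..T} \<subseteq> M"
  shows "trajectory M f T u x q"
    "\<And>t. lebesgue_point T u t \<Longrightarrow> (q has_vector_derivative f (u t) (q t)) (at t within {0..T})"
proof -
  let ?V = "closure (u ` {0..T})"
  note V = admissible_control_compact[OF u]
  have qc: "continuous_on {0..T} q" and qi: "\<And>t. t \<in> {0..T} \<Longrightarrow> ((\<lambda>s. f (u s) (q s)) has_integral (q t - x)) {0..t}"
    using q by (auto simp: integral_curve_def)
  have F: "continuous_on ({0..T} \<times> ?V) (\<lambda>(s, v). f v (q s))"
    by (rule continuous_along_curve[OF control_system_continuous(1)[OF sys] qc qM V(2)])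
  have "bounded ((\<lambda>(s, v). f v (q s)) ` ({0..T} \<times> ?V))"
    by (intro compact_imp_bounded compact_continuous_image F compact_Times V(1)) auto
  then obtain B0 where B0: "\<And>z. z \<in> (\<lambda>(s, v). f v (q s)) ` ({0..T} \<times> ?V) \<Longrightarrow> norm z \<le> B0" unfolding bounded_iff by blast
  have B: "norm (f (u s) (q s)) \<le> max B0 0" if "s \<in> {0..T}" for s
    
  proof -
    have "f (u s) (q s) \<in> (\<lambda>(s, v). f v (q s)) ` ({0..T} \<times> ?V)"
      by (rule image_eqI[of _ _ "(s, u s)"]) (use V(3) that in auto)
    from B0[OF this] show ?thesis by simp
  qed
  have lip: "(max B0 0)-lipschitz_on {0..T} q"
    by (rule lipschitz_of_has_integral[OF qi B]) auto
  show d: "(q has_vector_derivative f (u t) (q t)) (at t within {0..T})" if "lebesgue_point T u t" for t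
    by (rule lebesgue_point_has_vector_derivative[OF V(4) V(3) V(1) F that]) (use qi in auto)
  obtain N where N: "negligible N" "\<And>t. t \<in> {0..T} - N \<Longrightarrow> lebesgue_point T u t"
    using lebesgue_points_negligible[OF V(4) V(5)] by blast
  have "AE t in lebesgue_on {0..T}. (q has_vector_derivative f (u t) (q t)) (at t within {0..T})"
    by (rule negligible_AE_lebesgue_on[OF N(1)]) (use N(2) d in auto)
  moreover have "q 0 = x" by (rule integral_curve_start[OF q T])
  ultimately show "trajectory M f T u x q" using qM lip by (auto simp: trajectory_def)
qed

text \<open>All constants belong to one trajectory and one compact set \<open>V\<close> of control
  values, since the fields are assumed neither globally Lipschitz nor bounded over \<open>U\<close>.
  \<open>B\<close> bounds the speed, \<open>L\<close> the space derivative.\<close>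

locale tube =
  fixes M :: "'a::euclidean_space set" and U :: "(real ^ 'n) set" and f :: "real ^ 'n \<Rightarrow> 'a \<Rightarrow> 'a"
    and T :: real and V :: "(real ^ 'n) set" and \<gamma> :: "real \<Rightarrow> 'a" and r L B :: real
  assumes sys: "control_system M U f" and T: "0 < T" and V: "compact V" "V \<subseteq> closure U"
    and \<gamma>: "continuous_on {0..T} \<gamma>" and r: "0 < r" and L: "0 \<le> L" and B: "0 \<le> B"
    and inM: "\<And>s z. s \<in> {0..T} \<Longrightarrow> z \<in> cball (\<gamma> s) r \<Longrightarrow> z \<in> M"
    and bound: "\<And>s v z. s \<in> {0..T} \<Longrightarrow> v \<in> V \<Longrightarrow> z \<in> cball (\<gamma> s) r \<Longrightarrow> norm (f v z) \<le> B"
    and deriv_bound: "\<And>s v z w. s \<in> {0..T} \<Longrightarrow> v \<in> V \<Longrightarrow> z \<in> cball (\<gamma> s) r \<Longrightarrow>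
       norm (frechet_derivative (f v) (at z) w) \<le> L * norm w"

lemma norm_linear_le_basis:
  fixes A :: "'a::euclidean_space \<Rightarrow> 'b::real_normed_vector" and C :: real
  assumes A: "linear A" and C: "\<And>b. b \<in> Basis \<Longrightarrow> norm (A b) \<le> C"
  shows "norm (A w) \<le> (DIM('a) * C) * norm w"
proof -
  have "A w = (\<Sum>b\<in>Basis. (w \<bullet> b) *\<^sub>R A b)"
    by (subst euclidean_representation[of w, symmetric]) (simp only: linear_sum[OF A] linear_scale[OF A])
  also have "norm \<dots> \<le> (\<Sum>b\<in>(Basis::'a set). C * norm w)"
  proof (rule sum_norm_le)
    fix b :: 'a assume b: "b \<in> Basis"
    have "norm ((w \<bullet> b) *\<^sub>R A b) = \<bar>w \<bullet> b\<bar> * norm (A b)" by simp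
    also have "\<dots> \<le> norm w * C" using C[OF b] Basis_le_norm[OF b, of w] by (intro mult_mono) auto
    finally show "norm ((w \<bullet> b) *\<^sub>R A b) \<le> C * norm w" by (simp add: mult.commute)
  qed
  finally show ?thesis by simp
qed

lemma tube_exists:
  fixes M :: "'a::euclidean_space set" and U :: "(real ^ 'n) set"
  assumes sys: "control_system M U f" and T: "0 < T" and V: "compact V" "V \<subseteq> closure U"
    and \<gamma>: "continuous_on {0..T} \<gamma>" and \<gamma>M: "\<gamma> ` {0..T} \<subseteq> M"
  obtains r L B where "tube M U f T V \<gamma> r L B"
proof -
  have "open M" using sys by (simp add: control_system_def)
  moreover have "compact (\<gamma> ` {0..T})" using \<gamma> by (intro compact_continuous_image) auto
  ultimately obtain r where r: "0 < r" "{x. infdist x (\<gamma> ` {0..T}) \<le> r} \<subseteq> M"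
    using compact_in_open_separated[of "\<gamma> ` {0..T}" M] \<gamma>M T by auto
  have inM: "z \<in> M" if "s \<in> {0..T}" "z \<in> cball (\<gamma> s) r" for s z
  proof -
    have "infdist z (\<gamma> ` {0..T}) \<le> dist z (\<gamma> s)" using that by (intro infdist_le) auto
    then show ?thesis using that r(2) by (auto simp: dist_commute)
  qed
  \<comment> \<open>The closed tube is the image of a compact product under addition, hence
    compact.\<close>
  define K where "K = (\<lambda>(s, y). \<gamma> s + y) ` ({0..T} \<times> cball 0 r)"
  have "continuous_on ({0..T} \<times> cball 0 r) (\<lambda>z. \<gamma> (fst z) + snd z)"
    by (intro continuous_intros continuous_on_compose2[OF \<gamma>]) auto
  then have "compact K" unfolding K_def
    by (intro compact_continuous_image compact_Times) (auto simp: case_prod_beta)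
  then have cKV: "compact (K \<times> V)" using V by (intro compact_Times)
  have KM: "K \<subseteq> M"
  proof
    fix z assume "z \<in> K"
    then obtain s y where "s \<in> {0..T}" "norm y \<le> r" "z = \<gamma> s + y" by (auto simp: K_def)
    then show "z \<in> M" using inM[of s z] by (simp add: dist_norm)
  qed
  have inK: "z \<in> K" if "s \<in> {0..T}" "z \<in> cball (\<gamma> s) r" for s z
    unfolding K_def by (rule image_eqI[of _ _ "(s, z - \<gamma> s)"]) (use that in \<open>auto simp: dist_norm norm_minus_commute\<close>)
  have bd: "\<exists>C. \<forall>q\<in>K. \<forall>v\<in>V. norm (F q v) \<le> C" if F: "continuous_on (M \<times> closure U) (\<lambda>(q, v). F q v)" for F :: "'a \<Rightarrow> real ^ 'n \<Rightarrow> 'a"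
  proof -
    have "continuous_on (K \<times> V) (\<lambda>(q, v). F q v)" by (rule continuous_on_subset[OF F]) (use KM V in auto)
    then have "bounded ((\<lambda>(q, v). F q v) ` (K \<times> V))" by (intro compact_imp_bounded compact_continuous_image cKV)
    then show ?thesis unfolding bounded_iff by force
  qed
  obtain B where B: "\<And>q v. q \<in> K \<Longrightarrow> v \<in> V \<Longrightarrow> norm (f v q) \<le> B" using bd[OF control_system_continuous(1)[OF sys]] by blast
  have "\<forall>w. \<exists>C. \<forall>q\<in>K. \<forall>v\<in>V. norm (frechet_derivative (f v) (at q) w) \<le> C" using bd[OF control_system_continuous(2)[OF sys]] by blast
  then obtain C where C: "\<And>w q v. q \<in> K \<Longrightarrow> v \<in> V \<Longrightarrow> norm (frechet_derivative (f v) (at q) w) \<le> C w" by metis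
  define C' where "C' = (\<Sum>b\<in>Basis. \<bar>C b\<bar>)"
  have C': "C b \<le> C'" if "b \<in> Basis" for b
  proof -
    have "\<bar>C b\<bar> \<le> C'" unfolding C'_def by (rule member_le_sum[OF that]) auto
    then show ?thesis by linarith
  qed
  have "0 \<le> C'" by (auto simp: C'_def intro: sum_nonneg)
  have "tube M U f T V \<gamma> r (DIM('a) * C') (max B 0)"
  proof
    fix s v z w assume s: "s \<in> {0..T}" and v: "v \<in> V" and z: "z \<in> cball (\<gamma> s) r"
    show "norm (frechet_derivative (f v) (at z) w) \<le> DIM('a) * C' * norm w"
    proof (rule norm_linear_le_basis[where A = "frechet_derivative (f v) (at z)" and w = w])
      show "linear (frechet_derivative (f v) (at z))"
        using control_system_has_derivative[OF sys _ inM[OF s z], of v] v V(2) has_derivative_linear by blast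
      fix b :: 'a assume "b \<in> Basis"
      then show "norm (frechet_derivative (f v) (at z) b) \<le> C'" using C[OF inK[OF s z] v, of b] C'[of b] by linarith
    qed
  next
    fix s v z assume s: "s \<in> {0..T}" and v: "v \<in> V" and z: "z \<in> cball (\<gamma> s) r"
    show "norm (f v z) \<le> max B 0" using B[OF inK[OF s z] v] by simp
  qed (use sys T V \<gamma> r(1) inM \<open>0 \<le> C'\<close> in auto)
  then show ?thesis by (rule that)
qed

context tube
begin

lemma deriv:
  assumes "s \<in> {0..T}" "v \<in> V" "z \<in> cball (\<gamma> s) r"
  shows "(f v has_derivative frechet_derivative (f v) (at z)) (at z)"
  using control_system_has_derivative[OF sys _ inM] assms V(2) by blast

lemma lipschitz:
  assumes s: "s \<in> {0..T}" "v \<in> V" and z: "z1 \<in> cball (\<gamma> s) r" "z2 \<in> cball (\<gamma> s) r"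
  shows "norm (f v z1 - f v z2) \<le> L * norm (z1 - z2)"
proof (rule differentiable_bound[OF convex_cball _ _ z])
  fix z assume z: "z \<in> cball (\<gamma> s) r"
  show "(f v has_derivative frechet_derivative (f v) (at z)) (at z within cball (\<gamma> s) r)"
    using deriv[OF s z] by (rule has_derivative_at_withinI)
  show "onorm (frechet_derivative (f v) (at z)) \<le> L"
    by (rule onorm_le) (rule deriv_bound[OF s z])
qed

text \<open>Outside the tube the field is frozen along the rays from \<open>\<gamma> s\<close>, which keeps the Lipschitz constant.\<close>

definition ext :: "(real \<Rightarrow> real ^ 'n) \<Rightarrow> real \<Rightarrow> 'a \<Rightarrow> 'a" where
  "ext u s z = f (u s) (\<gamma> s + closest_point (cball 0 r) (z - \<gamma> s))"

lemma closest_point_tube: "\<gamma> s + closest_point (cball 0 r) (z - \<gamma> s) \<in> cball (\<gamma> s) r"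
proof -
  have "closest_point (cball 0 r) (z - \<gamma> s) \<in> cball 0 r" by (rule closest_point_in_set) (use r in auto)
  then show ?thesis by (simp add: dist_norm)
qed

lemma ext_eq: "z \<in> cball (\<gamma> s) r \<Longrightarrow> ext u s z = f (u s) z"
  unfolding ext_def by (subst closest_point_self) (auto simp: dist_norm norm_minus_commute)

lemma ext_bound: "s \<in> {0..T} \<Longrightarrow> u s \<in> V \<Longrightarrow> norm (ext u s z) \<le> B"
  unfolding ext_def by (rule bound[OF _ _ closest_point_tube])

lemma ext_lipschitz:
  assumes "s \<in> {0..T}" "u s \<in> V"
  shows "norm (ext u s y - ext u s z) \<le> L * norm (y - z)"
proof -
  let ?c = "closest_point (cball 0 r)"
  have "norm (ext u s y - ext u s z) \<le> L * norm ((\<gamma> s + ?c (y - \<gamma> s)) - (\<gamma> s + ?c (z - \<gamma> s)))"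
    unfolding ext_def by (rule lipschitz[OF assms closest_point_tube closest_point_tube])
  also have "norm ((\<gamma> s + ?c (y - \<gamma> s)) - (\<gamma> s + ?c (z - \<gamma> s))) = dist (?c (y - \<gamma> s)) (?c (z - \<gamma> s))" by (simp add: dist_norm)
  also have "\<dots> \<le> dist (y - \<gamma> s) (z - \<gamma> s)"
    by (rule closest_point_lipschitz) (use r in auto)
  finally show ?thesis using L by (simp add: dist_norm mult_left_mono)
qed

lemma ext_caratheodory:
  assumes u: "u \<in> borel_measurable (lebesgue_on {0..T})" and uV: "u ` {0..T} \<subseteq> V"
  shows "caratheodory (ext u) T L"
  unfolding caratheodory_def
proof (intro conjI allI impI ballI)
  fix y :: "real \<Rightarrow> 'a" assume y: "continuous_on {0..T} y"
  let ?q = "\<lambda>s. \<gamma> s + closest_point (cball 0 r) (y s - \<gamma> s)"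
  have "continuous_on {0..T} ?q"
    by (intro continuous_intros \<gamma> continuous_on_compose2[OF continuous_on_closest_point[of "cball 0 r" UNIV]] y) (use r in auto)
  moreover have "?q ` {0..T} \<subseteq> M" using inM closest_point_tube by blast
  ultimately have "continuous_on ({0..T} \<times> V) (\<lambda>(s, v). f v (?q s))"
    by (rule continuous_along_curve[OF control_system_continuous(1)[OF sys] _ _ V(2)])
  from measurable_control_compose[OF u uV this]
  have "(\<lambda>s. ext u s (y s)) \<in> borel_measurable (lebesgue_on {0..T})" by (simp add: ext_def)
  then show "(\<lambda>s. ext u s (y s)) integrable_on {0..T}"
    by (rule bounded_measurable_integrable_on[where C = B]) (use ext_bound uV in \<open>auto simp: image_subset_iff\<close>)
qed (use L ext_lipschitz uV in \<open>auto simp: image_subset_iff\<close>)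

lemma ext_curves_dist_le:
  assumes q1: "integral_curve (ext u1) T x1 q1" and q2: "integral_curve (ext u2) T x2 q2"
    and u1: "u1 ` {0..T} \<subseteq> V" and u2: "u2 ` {0..T} \<subseteq> V" and ab: "a \<le> b"
    and eq: "\<And>s. s \<in> {0..T} \<Longrightarrow> s \<notin> {a..b} \<Longrightarrow> u1 s = u2 s" and t: "t \<in> {0..T}"
  shows "norm (q1 t - q2 t) \<le> (norm (x1 - x2) + 2 * B * (b - a)) * exp (L * T)"
proof -
  \<comment> \<open>Where the controls differ, both fields are merely bounded by \<open>B\<close>.
    The integral of this defect is at most \<open>2 * B * (b - a)\<close> even if
    \<open>{a..b}\<close> sticks out of \<open>{0..T}\<close>.\<close>
  let ?h = "\<lambda>s. if s \<in> {a..b} then 2 * B else 0"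
  have i: "?h integrable_on UNIV" unfolding integrable_restrict_UNIV by auto
  have ih: "?h integrable_on {0..T}" by (rule integrable_on_subinterval[OF i]) auto
  have "integral {0..T} ?h \<le> integral UNIV ?h" by (rule integral_subset_le) (use i ih B in auto)
  also have "\<dots> = 2 * B * (b - a)" unfolding integral_restrict_UNIV using ab by simp
  finally have I: "integral {0..T} ?h \<le> 2 * B * (b - a)" .
  have "norm (q1 t - q2 t) \<le> (norm (x1 - x2) + integral {0..T} ?h) * exp (L * t)"
  proof (rule integral_curves_dist_le[OF _ _ L])
    fix s assume s: "s \<in> {0..T}"
    show "norm (ext u1 s (q1 s) - ext u2 s (q2 s)) \<le> L * norm (q1 s - q2 s) + ?h s"
    proof (cases "s \<in> {a..b}")
      case True
      have "norm (ext u1 s (q1 s) - ext u2 s (q2 s)) \<le> B + B"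
        using norm_triangle_ineq4[of "ext u1 s (q1 s)" "ext u2 s (q2 s)"] ext_bound[OF s, of u1 "q1 s"] ext_bound[OF s, of u2 "q2 s"] s u1 u2 by force
      moreover have "0 \<le> L * norm (q1 s - q2 s)" using L by simp
      ultimately show ?thesis using True by simp
    next
      case False
      then have "ext u1 s (q1 s) = ext u2 s (q1 s)" using eq[OF s] by (simp add: ext_def)
      then show ?thesis using ext_lipschitz[OF s, of u2 "q1 s" "q2 s"] s u2 False by (auto simp: image_subset_iff)
    qed
  qed (use q1 q2 ih t B in \<open>auto simp: integral_curve_def has_integral_integral\<close>)
  also have "\<dots> \<le> (norm (x1 - x2) + 2 * B * (b - a)) * exp (L * T)"
    using I L t B ab by (intro mult_mono) (auto intro: mult_left_mono)
  finally show ?thesis .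
qed

lemma ext_curve_in_tube:
  assumes "integral_curve (ext u) T x q" "\<And>s. s \<in> {0..T} \<Longrightarrow> q s \<in> cball (\<gamma> s) r"
  shows "integral_curve (\<lambda>s. f (u s)) T x q" "q ` {0..T} \<subseteq> M"
proof -
  show "q ` {0..T} \<subseteq> M" using assms(2) inM by blast
  have e: "f (u s) (q s) = ext u s (q s)" if "s \<in> {0..T}" for s using ext_eq[OF assms(2)[OF that], of u] by simp
  show "integral_curve (\<lambda>s. f (u s)) T x q"
    unfolding integral_curve_def
  proof (intro conjI ballI)
    show "continuous_on {0..T} q" using assms(1) by (simp add: integral_curve_def)
    fix t assume t: "t \<in> {0..T}"
    have "((\<lambda>s. ext u s (q s)) has_integral (q t - x)) {0..t}" using assms(1) t by (simp add: integral_curve_def)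
    then show "((\<lambda>s. f (u s) (q s)) has_integral (q t - x)) {0..t}"
      by (rule has_integral_eq[rotated]) (use e t in auto)
  qed
qed

lemma curve_in_tube_ext:
  assumes "integral_curve (\<lambda>s. f (u s)) T' x q" "T' \<le> T" "\<And>s. s \<in> {0..T'} \<Longrightarrow> q s \<in> cball (\<gamma> s) r"
  shows "integral_curve (ext u) T' x q"
  unfolding integral_curve_def
proof (intro conjI ballI)
  show "continuous_on {0..T'} q" using assms(1) by (simp add: integral_curve_def)
  fix t assume t: "t \<in> {0..T'}"
  have "((\<lambda>s. f (u s) (q s)) has_integral (q t - x)) {0..t}" using assms(1) t by (simp add: integral_curve_def)
  then show "((\<lambda>s. ext u s (q s)) has_integral (q t - x)) {0..t}"
    by (rule has_integral_eq[rotated]) (use ext_eq assms t in auto)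
qed

text \<open>The Lipschitz bound holds only inside the tube, so the second curve must be kept from
  leaving it: up to the first time at which its distance from \<open>\<gamma>\<close> would reach
  \<open>r\<close>, Gronwall's inequality makes this distance \<open>0\<close>.\<close>

lemma curve_unique:
  assumes \<gamma>u: "integral_curve (\<lambda>s. f (u s)) T x \<gamma>" and uV: "u ` {0..T} \<subseteq> V"
    and q: "integral_curve (\<lambda>s. f (u s)) T x q" and t: "t \<in> {0..T}"
  shows "q t = \<gamma> t"
proof -
  have key: "q t = \<gamma> t" if in_t: "\<And>s. s \<in> {0..T'} \<Longrightarrow> q s \<in> cball (\<gamma> s) r" and T': "T' \<in> {0..T}" and t: "t \<in> {0..T'}" for T' t
  proof -
    have rs: "integral_curve g T' x y" if "integral_curve g T x y" for g and y :: "real \<Rightarrow> 'a"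
      using that T' by (auto simp: integral_curve_def intro: continuous_on_subset)
    have e1: "integral_curve (ext u) T' x q" by (rule curve_in_tube_ext[OF rs[OF q]]) (use in_t T' in auto)
    have e2: "integral_curve (ext u) T' x \<gamma>" by (rule curve_in_tube_ext[OF rs[OF \<gamma>u]]) (use r T' in auto)
    have "norm (q t - \<gamma> t) \<le> (norm (x - x) + 0) * exp (L * t)"
    proof (rule integral_curves_dist_le[OF _ _ L, where T = T' and ?F1.0 = "\<lambda>s. ext u s (q s)" and ?F2.0 = "\<lambda>s. ext u s (\<gamma> s)" and h = "\<lambda>_. 0"])
      fix s assume "s \<in> {0..T'}"
      then show "norm (ext u s (q s) - ext u s (\<gamma> s)) \<le> L * norm (q s - \<gamma> s) + 0"
        using ext_lipschitz[of s u "q s" "\<gamma> s"] uV T' by (simp add: image_subset_iff)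
    qed (use e1 e2 t in \<open>auto simp: integral_curve_def\<close>)
    then show ?thesis by simp
  qed
  have "q s \<in> cball (\<gamma> s) r" if s: "s \<in> {0..T}" for s
  proof (rule ccontr)
    assume "\<not> ?thesis"
    then have ns: "s \<in> {s \<in> {0..T}. r \<le> norm (q s - \<gamma> s)}" using s by (simp add: dist_norm norm_minus_commute)
    have qc: "continuous_on {0..T} q" using q by (simp add: integral_curve_def)
    have nc: "continuous_on {0..T} (\<lambda>s. norm (q s - \<gamma> s))" using qc \<gamma> by (intro continuous_intros)
    have "closed ({0..T} \<inter> (\<lambda>s. norm (q s - \<gamma> s)) -` {r..})"
      by (rule continuous_closed_preimage[OF nc]) auto
    moreover have "{0..T} \<inter> (\<lambda>s. norm (q s - \<gamma> s)) -` {r..} = {s \<in> {0..T}. r \<le> norm (q s - \<gamma> s)}" by auto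
    moreover have "bounded {s \<in> {0..T}. r \<le> norm (q s - \<gamma> s)}" by (rule bounded_subset[of "{0..T}"]) auto
    ultimately have "compact {s \<in> {0..T}. r \<le> norm (q s - \<gamma> s)}" by (simp add: compact_eq_bounded_closed)
    then obtain T' where T': "T' \<in> {0..T}" "r \<le> norm (q T' - \<gamma> T')" and min: "\<And>s. s \<in> {0..T} \<Longrightarrow> r \<le> norm (q s - \<gamma> s) \<Longrightarrow> T' \<le> s"
      using compact_attains_inf[of "{s \<in> {0..T}. r \<le> norm (q s - \<gamma> s)}"] ns by blast
    have "q 0 = x" "\<gamma> 0 = x"
      using integral_curve_start[OF q] integral_curve_start[OF \<gamma>u] T by auto
    then have T0: "0 < T'" using T' r by (cases "T' = 0") auto
    have lt: "norm (q s - \<gamma> s) < r" if "0 \<le> s" "s < T'" for s using min[of s] that T' by force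
    have le: "norm (q s - \<gamma> s) \<le> r" if "s \<in> {0..T'}" for s
    proof -
      have "continuous_on (closure {0..<T'}) (\<lambda>s. norm (q s - \<gamma> s))"
        using T0 T'(1) by (auto intro: continuous_on_subset[OF nc])
      then show ?thesis
        by (rule continuous_le_on_closure[of _ _ s]) (use lt that T0 in \<open>auto intro: less_imp_le\<close>)
    qed
    have "q T' = \<gamma> T'" by (rule key[of T' T']) (use le T' in \<open>auto simp: dist_norm norm_minus_commute\<close>)
    then show False using T' r by simp
  qed
  then show ?thesis using key[of T t] t T by auto
qed

text \<open>Uniform continuity on a compact set of parameters, one basis direction at a time; the
  radius \<open>c\<close> must depend neither on the time \<open>s\<close> nor on the control value
  \<open>v\<close>.\<close>

lemma deriv_modulus:
  assumes "0 < \<eta>"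
  shows "\<exists>c>0. c \<le> r \<and> (\<forall>s\<in>{0..T}. \<forall>v\<in>V. \<forall>z w. norm (z - \<gamma> s) \<le> c \<longrightarrow>
     norm (frechet_derivative (f v) (at z) w - frechet_derivative (f v) (at (\<gamma> s)) w) \<le> \<eta> * norm w)"
proof -
  have c1: "\<exists>c>0. c \<le> r \<and> (\<forall>s\<in>{0..T}. \<forall>v\<in>V. \<forall>z. norm (z - \<gamma> s) \<le> c \<longrightarrow>
     norm (frechet_derivative (f v) (at z) b - frechet_derivative (f v) (at (\<gamma> s)) b) \<le> \<eta> / DIM('a))" for b
  proof -
    \<comment> \<open>A point of the tube is written as \<open>\<gamma> s\<close> plus a vector of
      \<open>cball 0 r\<close>, which makes the parameter set a compact product.\<close>
    let ?F = "\<lambda>p. frechet_derivative (f (snd p)) (at (\<gamma> (fst (fst p)) + snd (fst p))) b"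
    let ?S = "({0..T} \<times> (cball 0 r :: 'a set)) \<times> V"
    have "continuous_on ?S (\<lambda>p. (\<gamma> (fst (fst p)) + snd (fst p), snd p))"
      by (intro continuous_intros continuous_on_compose2[OF \<gamma>]) auto
    then have "continuous_on ?S (\<lambda>p. (\<lambda>(q, v). frechet_derivative (f v) (at q) b) (\<gamma> (fst (fst p)) + snd (fst p), snd p))"
      by (rule continuous_on_compose2[OF control_system_continuous(2)[OF sys]])
        (use V(2) inM in \<open>auto simp: dist_norm\<close>)
    then have "continuous_on ?S ?F" by simp
    moreover have "compact ?S" by (intro compact_Times V(1) compact_Icc compact_cball)
    ultimately have uc: "uniformly_continuous_on ?S ?F" by (rule compact_uniformly_continuous)
    have e: "0 < \<eta> / DIM('a)" using assms by simp
    obtain d where d: "0 < d" "\<And>p p'. p \<in> ?S \<Longrightarrow> p' \<in> ?S \<Longrightarrow> dist p' p < d \<Longrightarrow> dist (?F p') (?F p) < \<eta> / DIM('a)"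
      using uc[unfolded uniformly_continuous_on_def, rule_format, OF e] by blast
    show ?thesis
    proof (rule exI[of _ "min r (d/2)"], intro conjI ballI allI impI)
      show "0 < min r (d/2)" using r d by simp
      fix s v z assume s: "s \<in> {0..T}" and v: "v \<in> V" and z: "norm (z - \<gamma> s) \<le> min r (d/2)"
      have "dist (?F ((s, z - \<gamma> s), v)) (?F ((s, 0), v)) < \<eta> / DIM('a)"
        by (rule d(2)) (use s v z r d(1) in \<open>auto simp: dist_Pair_Pair dist_norm norm_minus_commute[of "\<gamma> s"]\<close>)
      then show "norm (frechet_derivative (f v) (at z) b - frechet_derivative (f v) (at (\<gamma> s)) b) \<le> \<eta> / DIM('a)"
        by (simp add: dist_norm)
    qed simp
  qed
  then obtain c where c: "\<And>b. 0 < c b" "\<And>b. c b \<le> r" "\<And>b s v z. s \<in> {0..T} \<Longrightarrow> v \<in> V \<Longrightarrow> norm (z - \<gamma> s) \<le> c b \<Longrightarrow>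
     norm (frechet_derivative (f v) (at z) b - frechet_derivative (f v) (at (\<gamma> s)) b) \<le> \<eta> / DIM('a)"
    by metis
  define c0 where "c0 = Min (c ` Basis)"
  have c0: "0 < c0" "\<And>b. b \<in> Basis \<Longrightarrow> c0 \<le> c b" using c(1) by (auto simp: c0_def)
  have "c0 \<le> r" using c0(2) c(2) nonempty_Basis order_trans by (metis all_not_in_conv)
  show ?thesis
  proof (rule exI[of _ c0], intro conjI ballI allI impI)
    fix s v z w assume s: "s \<in> {0..T}" and v: "v \<in> V" and z: "norm (z - \<gamma> s) \<le> c0"
    have zr: "z \<in> cball (\<gamma> s) r" using z \<open>c0 \<le> r\<close> by (simp add: dist_norm norm_minus_commute)
    have "norm (frechet_derivative (f v) (at z) w - frechet_derivative (f v) (at (\<gamma> s)) w) \<le> (DIM('a) * (\<eta> / DIM('a))) * norm w"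
    proof (rule norm_linear_le_basis)
      show "linear (\<lambda>w. frechet_derivative (f v) (at z) w - frechet_derivative (f v) (at (\<gamma> s)) w)"
        using deriv[OF s v zr] deriv[OF s v, of "\<gamma> s"] r by (intro linear_compose_sub has_derivative_linear) auto
      fix b :: 'a assume "b \<in> Basis"
      then show "norm (frechet_derivative (f v) (at z) b - frechet_derivative (f v) (at (\<gamma> s)) b) \<le> \<eta> / DIM('a)"
        using c(3)[OF s v, of z b] z c0(2)[of b] by simp
    qed
    then show "norm (frechet_derivative (f v) (at z) w - frechet_derivative (f v) (at (\<gamma> s)) w) \<le> \<eta> * norm w" by simp
  qed (use c0 \<open>c0 \<le> r\<close> in auto)
qed

text \<open>Both points vary because the variation is taken at initial points near
  \<open>\<gamma> 0\<close>: neither the perturbed nor the unperturbed curve is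
  \<open>\<gamma>\<close> itself, yet the linearisation is the one along
  \<open>\<gamma>\<close>.\<close>

lemma strict_derivative:
  assumes "0 < \<eta>"
  shows "\<exists>c>0. c \<le> r \<and> (\<forall>s\<in>{0..T}. \<forall>v\<in>V. \<forall>z1 z2. norm (z1 - \<gamma> s) \<le> c \<longrightarrow> norm (z2 - \<gamma> s) \<le> c \<longrightarrow>
     norm (f v z1 - f v z2 - frechet_derivative (f v) (at (\<gamma> s)) (z1 - z2)) \<le> \<eta> * norm (z1 - z2))"
proof -
  obtain c where c: "0 < c" "c \<le> r" and cm: "\<And>s v z w. s \<in> {0..T} \<Longrightarrow> v \<in> V \<Longrightarrow> norm (z - \<gamma> s) \<le> c \<Longrightarrow>
     norm (frechet_derivative (f v) (at z) w - frechet_derivative (f v) (at (\<gamma> s)) w) \<le> \<eta> * norm w"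
    using deriv_modulus[OF assms] by blast
  show ?thesis
  proof (rule exI[of _ c], intro conjI ballI allI impI)
    fix s v z1 z2 assume s: "s \<in> {0..T}" and v: "v \<in> V" and z: "norm (z1 - \<gamma> s) \<le> c" "norm (z2 - \<gamma> s) \<le> c"
    let ?A = "frechet_derivative (f v) (at (\<gamma> s))"
    have bl: "bounded_linear ?A" using deriv[OF s v, of "\<gamma> s"] r by (auto dest: has_derivative_bounded_linear)
    have "norm ((f v z1 - ?A z1) - (f v z2 - ?A z2)) \<le> \<eta> * norm (z1 - z2)"
    proof (rule differentiable_bound[OF convex_cball])
      fix z assume z: "z \<in> cball (\<gamma> s) c"
      have "(f v has_derivative frechet_derivative (f v) (at z)) (at z)"
        using deriv[OF s v, of z] z c by auto
      then have "((\<lambda>z. f v z - ?A z) has_derivative (\<lambda>w. frechet_derivative (f v) (at z) w - ?A w)) (at z)"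
        by (intro has_derivative_diff bounded_linear.has_derivative[OF bl] has_derivative_ident)
      then show "((\<lambda>z. f v z - ?A z) has_derivative (\<lambda>w. frechet_derivative (f v) (at z) w - ?A w)) (at z within cball (\<gamma> s) c)"
        by (rule has_derivative_at_withinI)
      show "onorm (\<lambda>w. frechet_derivative (f v) (at z) w - ?A w) \<le> \<eta>"
        by (rule onorm_le, rule cm[OF s v]) (use z in \<open>auto simp: dist_norm norm_minus_commute\<close>)
    qed (use z in \<open>auto simp: dist_norm norm_minus_commute\<close>)
    then show "norm (f v z1 - f v z2 - ?A (z1 - z2)) \<le> \<eta> * norm (z1 - z2)"
      by (simp add: linear_diff[OF bounded_linear.linear[OF bl]] algebra_simps)
  qed (use c in auto)
qed

end

section \<open>Adjoint curves and needle variations\<close>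

text \<open>The transposed Jacobian of \<open>f v\<close> at \<open>q\<close>, applied to
  \<open>l\<close>; covectors are represented by vectors through the inner product.\<close>

definition adj :: "(real ^ 'n \<Rightarrow> 'a \<Rightarrow> 'a) \<Rightarrow> real ^ 'n \<Rightarrow> 'a \<Rightarrow> 'a \<Rightarrow> 'a::euclidean_space" where
  "adj f v q l = (\<Sum>b\<in>Basis. (l \<bullet> frechet_derivative (f v) (at q) b) *\<^sub>R b)"

definition adjoint_curve ::
  "(real ^ 'n \<Rightarrow> 'a \<Rightarrow> 'a) \<Rightarrow> (real \<Rightarrow> real ^ 'n) \<Rightarrow> real \<Rightarrow> (real \<Rightarrow> 'a) \<Rightarrow> 'a::euclidean_space \<Rightarrow> (real \<Rightarrow> 'a) \<Rightarrow> bool" where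
  "adjoint_curve f u T q p l \<longleftrightarrow> terminal_curve (\<lambda>s l. - adj f (u s) (q s) l) T p l"

lemma adj_inner:
  assumes "linear (frechet_derivative (f v) (at q))"
  shows "adj f v q l \<bullet> w = l \<bullet> frechet_derivative (f v) (at q) w"
proof -
  have "frechet_derivative (f v) (at q) w = (\<Sum>b\<in>Basis. (w \<bullet> b) *\<^sub>R frechet_derivative (f v) (at q) b)"
    by (subst euclidean_representation[of w, symmetric]) (simp only: linear_sum[OF assms] linear_scale[OF assms])
  then show ?thesis
    by (simp add: adj_def inner_sum_left inner_sum_right inner_commute[of _ w] mult.commute)
qed

lemma adj_diff: "adj f v q (l1 - l2) = adj f v q l1 - adj f v q l2"
  by (simp add: adj_def inner_diff_left scaleR_diff_left sum_subtractf)

lemma adj_zero [simp]: "adj f v q 0 = 0"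
  by (simp add: adj_def)

lemma terminal_curve_forward:
  assumes l: "terminal_curve g T p l" and T: "0 \<le> T"
  shows "integral_curve g T (l 0) l" "l T = p"
proof -
  have i: "((\<lambda>s. g s (l s)) has_integral (p - l t)) {t..T}" if "t \<in> {0..T}" for t
    using l that by (simp add: terminal_curve_def)
  have "((\<lambda>s. g s (l s)) has_integral (p - l T)) {T}" using i[of T] T by simp
  from has_integral_unique[OF this has_integral_refl(2)] show "l T = p" by simp
  show "integral_curve g T (l 0) l"
    unfolding integral_curve_def
  proof (intro conjI ballI)
    show "continuous_on {0..T} l" using l by (simp add: terminal_curve_def)
    fix t assume t: "t \<in> {0..T}"
    have F: "(\<lambda>s. g s (l s)) integrable_on {0..T}" using i[of 0] T by auto
    have "integral {0..t} (\<lambda>s. g s (l s)) + integral {t..T} (\<lambda>s. g s (l s)) = integral {0..T} (\<lambda>s. g s (l s))"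
      using t F by (intro Henstock_Kurzweil_Integration.integral_combine) auto
    then have "integral {0..t} (\<lambda>s. g s (l s)) = l t - l 0"
      using integral_unique[OF i[OF t]] integral_unique[OF i[of 0]] T by (simp add: algebra_simps)
    moreover have "(\<lambda>s. g s (l s)) integrable_on {0..t}" by (rule integrable_on_subinterval[OF F]) (use t in auto)
    ultimately show "((\<lambda>s. g s (l s)) has_integral (l t - l 0)) {0..t}" by (simp add: has_integral_integral)
  qed
qed

text \<open>A bound on a difference of Jacobians passes to the transposes: the difference
  \<open>X\<close> of the transposes is paired with itself, and one factor \<open>norm X\<close> is
  cancelled.\<close>

lemma norm_adj_diff_le:
  assumes "linear (frechet_derivative (f v) (at y))" "linear (frechet_derivative (f v) (at z))"
    and "\<And>w. norm (frechet_derivative (f v) (at y) w - frechet_derivative (f v) (at z) w) \<le> \<eta> * norm w"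
  shows "norm (adj f v y l - adj f v z l) \<le> \<eta> * norm l"
proof -
  define X where "X = adj f v y l - adj f v z l"
  have "norm X * norm X = X \<bullet> X" by (metis power2_eq_square power2_norm_eq_inner)
  also have "\<dots> = (adj f v y l - adj f v z l) \<bullet> X" by (simp add: X_def)
  also have "\<dots> = l \<bullet> (frechet_derivative (f v) (at y) X - frechet_derivative (f v) (at z) X)"
    by (simp only: inner_diff_left inner_diff_right adj_inner[where f = f and v = v and q = y, OF assms(1)] adj_inner[where f = f and v = v and q = z, OF assms(2)])
  also have "\<dots> \<le> norm l * (\<eta> * norm X)"
    by (rule order_trans[OF norm_cauchy_schwarz]) (rule mult_left_mono[OF assms(3) norm_ge_zero])
  finally have *: "norm X * norm X \<le> (\<eta> * norm l) * norm X" by (simp add: mult_ac)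
  have "norm X \<le> \<eta> * norm l"
  proof (cases "X = 0")
    case True
    have "0 \<le> \<eta> * norm (l :: 'a)"
      by (cases "l = 0") (use order_trans[OF norm_ge_zero assms(3)[of l]] in auto)
    then show ?thesis using True by simp
  next
    case False
    then show ?thesis using * by (simp add: mult_le_cancel_right)
  qed
  then show ?thesis by (simp add: X_def)
qed

locale reference = tube M U f T V \<gamma> r L B
  for M :: "'a::euclidean_space set" and U :: "(real ^ 'n) set" and f :: "real ^ 'n \<Rightarrow> 'a \<Rightarrow> 'a"
    and T :: real and V :: "(real ^ 'n) set" and \<gamma> :: "real \<Rightarrow> 'a" and r L B :: real +
  fixes u0 :: "real \<Rightarrow> real ^ 'n"
  assumes u0: "admissible_control U T u0" and u0V: "u0 ` {0..T} \<subseteq> V"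
    and \<gamma>u0: "integral_curve (\<lambda>s. f (u0 s)) T (\<gamma> 0) \<gamma>"
begin

lemma u0_in: "s \<in> {0..T} \<Longrightarrow> u0 s \<in> V" using u0V by auto

lemma u0_meas: "u0 \<in> borel_measurable (lebesgue_on {0..T})" using u0 by (simp add: admissible_control_def)

lemma deriv_linear:
  assumes "s \<in> {0..T}" "v \<in> V" "z \<in> cball (\<gamma> s) r"
  shows "linear (frechet_derivative (f v) (at z))"
  using has_derivative_linear[OF deriv[OF assms]] .

lemma norm_adj_le:
  assumes "s \<in> {0..T}" "v \<in> V" "z \<in> cball (\<gamma> s) r"
  shows "norm (adj f v z l) \<le> L * norm l"
proof -
  let ?X = "adj f v z l"
  have "norm ?X * norm ?X = ?X \<bullet> ?X" by (metis power2_eq_square power2_norm_eq_inner)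
  also have "\<dots> = l \<bullet> frechet_derivative (f v) (at z) ?X" by (rule adj_inner[where f = f and v = v and q = z, OF deriv_linear[OF assms]])
  also have "\<dots> \<le> norm l * (L * norm ?X)"
    by (rule order_trans[OF norm_cauchy_schwarz]) (rule mult_left_mono[OF deriv_bound[OF assms] norm_ge_zero])
  finally have *: "norm ?X * norm ?X \<le> (L * norm l) * norm ?X" by (simp add: mult_ac)
  show ?thesis
  proof (cases "?X = 0")
    case True then show ?thesis using L by simp
  next
    case False then show ?thesis using * by (simp add: mult_le_cancel_right)
  qed
qed

lemma adj_continuous:
  assumes q: "continuous_on {0..T} q" "\<And>s. s \<in> {0..T} \<Longrightarrow> q s \<in> cball (\<gamma> s) r" and y: "continuous_on {0..T} y"
  shows "continuous_on ({0..T} \<times> V) (\<lambda>(s, v). - adj f v (q s) (y s))"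
proof -
  have "continuous_on ({0..T} \<times> V) (\<lambda>p. frechet_derivative (f (snd p)) (at (q (fst p))) b)" for b
    using continuous_along_curve[OF control_system_continuous(2)[OF sys] q(1) _ V(2)] q(2) inM
    by (force simp: case_prod_beta)
  then show ?thesis unfolding adj_def case_prod_beta
    by (intro continuous_intros continuous_on_compose2[OF y, of _ fst]) auto
qed

lemma adj_caratheodory: "caratheodory (\<lambda>s l. - adj f (u0 s) (\<gamma> s) l) T L"
  unfolding caratheodory_def
proof (intro conjI allI impI ballI)
  have c: "s \<in> {0..T} \<Longrightarrow> \<gamma> s \<in> cball (\<gamma> s) r" for s using r by simp
  fix y :: "real \<Rightarrow> 'a" assume y: "continuous_on {0..T} y"
  have "bounded (y ` {0..T})" using y by (intro compact_imp_bounded compact_continuous_image) auto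
  then obtain C where C: "\<And>s. s \<in> {0..T} \<Longrightarrow> norm (y s) \<le> C" unfolding bounded_iff by blast
  show "(\<lambda>s. - adj f (u0 s) (\<gamma> s) (y s)) integrable_on {0..T}"
  proof (rule bounded_measurable_integrable_on[where C = "L * C"])
    show "(\<lambda>s. - adj f (u0 s) (\<gamma> s) (y s)) \<in> borel_measurable (lebesgue_on {0..T})"
      by (rule measurable_control_compose[OF u0_meas u0V adj_continuous[OF \<gamma> c y]])
    fix s assume s: "s \<in> {0..T}"
    have "norm (adj f (u0 s) (\<gamma> s) (y s)) \<le> L * norm (y s)" by (rule norm_adj_le[OF s u0_in[OF s] c[OF s]])
    also have "\<dots> \<le> L * C" using C[OF s] L by (rule mult_left_mono)
    finally show "norm (- adj f (u0 s) (\<gamma> s) (y s)) \<le> L * C" by simp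
  qed auto
next
  fix s y z assume s: "s \<in> {0..T}"
  show "norm (- adj f (u0 s) (\<gamma> s) y - - adj f (u0 s) (\<gamma> s) z) \<le> L * norm (y - z)"
    using norm_adj_le[OF s u0_in[OF s], of "\<gamma> s" "z - y"] r by (simp add: adj_diff norm_minus_commute)
qed (rule L)

lemma adjoint_exists: "\<exists>l. adjoint_curve f u0 T \<gamma> p l"
  unfolding adjoint_curve_def using terminal_curve_existence[OF adj_caratheodory] T by simp

lemma adjoint_regular:
  assumes "adjoint_curve f u0 T \<gamma> p l"
  shows "\<exists>C. C-lipschitz_on {0..T} l"
    and "lebesgue_point T u0 t \<Longrightarrow> (l has_vector_derivative - adj f (u0 t) (\<gamma> t) (l t)) (at t within {0..T})"
proof -
  have ic: "integral_curve (\<lambda>s l. - adj f (u0 s) (\<gamma> s) l) T (l 0) l"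
    using terminal_curve_forward[OF assms[unfolded adjoint_curve_def]] T by simp
  then have lc: "continuous_on {0..T} l"
    and li: "\<And>t. t \<in> {0..T} \<Longrightarrow> ((\<lambda>s. - adj f (u0 s) (\<gamma> s) (l s)) has_integral (l t - l 0)) {0..t}"
    by (auto simp: integral_curve_def)
  have F: "continuous_on ({0..T} \<times> V) (\<lambda>(s, v). - adj f v (\<gamma> s) (l s))"
    by (rule adj_continuous[OF \<gamma> _ lc]) (use r in auto)
  show "(l has_vector_derivative - adj f (u0 t) (\<gamma> t) (l t)) (at t within {0..T})" if "lebesgue_point T u0 t"
    by (rule lebesgue_point_has_vector_derivative[OF u0_meas u0V V(1) F that li])
  have "bounded (l ` {0..T})" using lc by (intro compact_imp_bounded compact_continuous_image) auto
  then obtain C where C: "\<And>s. s \<in> {0..T} \<Longrightarrow> norm (l s) \<le> C" unfolding bounded_iff by blast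
  have C0: "0 \<le> C" using order_trans[OF norm_ge_zero C[of 0]] T by simp
  have "(L * C)-lipschitz_on {0..T} l"
  proof (rule lipschitz_of_has_integral[OF li])
    fix s assume s: "s \<in> {0..T}"
    have "norm (adj f (u0 s) (\<gamma> s) (l s)) \<le> L * norm (l s)" by (rule norm_adj_le[OF s u0_in[OF s]]) (use r in simp)
    also have "\<dots> \<le> L * C" using C[OF s] L by (rule mult_left_mono)
    finally show "norm (- adj f (u0 s) (\<gamma> s) (l s)) \<le> L * C" by simp
  qed (use L C0 in auto)
  then show "\<exists>C. C-lipschitz_on {0..T} l" by blast
qed

text \<open>A zero of a solution of the linear adjoint equation would propagate forward to the end
  time by Gronwall's inequality, where the value is \<open>p\<close>.\<close>

lemma adjoint_nonzero:
  assumes l: "adjoint_curve f u0 T \<gamma> p l" and p: "p \<noteq> 0" and t: "t \<in> {0..T}"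
  shows "l t \<noteq> 0"
proof
  assume l0: "l t = 0"
  have ic: "integral_curve (\<lambda>s l. - adj f (u0 s) (\<gamma> s) l) T (l 0) l" and lT: "l T = p"
    using terminal_curve_forward[OF l[unfolded adjoint_curve_def]] T by simp_all
  then have lc: "continuous_on {0..T} l"
    and li: "\<And>t. t \<in> {0..T} \<Longrightarrow> ((\<lambda>s. - adj f (u0 s) (\<gamma> s) (l s)) has_integral (l t - l 0)) {0..t}"
    by (auto simp: integral_curve_def)
  let ?F = "\<lambda>s. - adj f (u0 s) (\<gamma> s) (l s)"
  \<comment> \<open>Time is shifted to start at the zero of \<open>l\<close>, because
    \<open>gronwall\<close> starts at \<open>0\<close>; the constant \<open>a\<close> in its
    hypothesis is then \<open>0\<close>.\<close>
  let ?\<phi> = "(\<lambda>s. norm (l s)) \<circ> (+) t"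
  have nc: "continuous_on {0..T} (\<lambda>s. norm (l s))" using lc by (intro continuous_intros)
  have "?\<phi> (T - t) \<le> 0 * exp (L * (T - t))"
  proof (rule gronwall[OF _ L])
    show "continuous_on {0..T - t} ?\<phi>"
      unfolding o_def by (rule continuous_on_compose2[OF nc]) (use t in \<open>auto intro!: continuous_intros\<close>)
    show "T - t \<in> {0..T - t}" using t by simp
    fix s assume s: "s \<in> {0..T - t}"
    have F: "?F integrable_on {0..t + s}" using li[of "t + s"] s t by auto
    have "integral {0..t} ?F + integral {t..t + s} ?F = integral {0..t + s} ?F"
      using s t F by (intro Henstock_Kurzweil_Integration.integral_combine) auto
    moreover have "integral {0..t} ?F = l t - l 0" by (rule integral_unique[OF li[OF t]])
    moreover have "integral {0..t + s} ?F = l (t + s) - l 0" by (rule integral_unique[OF li]) (use s t in auto)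
    ultimately have "(l t - l 0) + integral {t..t + s} ?F = l (t + s) - l 0" by simp
    then have "l (t + s) = integral {t..t + s} ?F" by (simp add: l0)
    also have "norm \<dots> \<le> integral {t..t + s} (\<lambda>s. L * norm (l s))"
    proof (rule integral_norm_bound_integral)
      show "?F integrable_on {t..t + s}" by (rule integrable_on_subinterval[OF F]) (use t in auto)
      show "(\<lambda>s. L * norm (l s)) integrable_on {t..t + s}"
        by (intro integrable_continuous_real continuous_intros continuous_on_subset[OF lc]) (use s t in auto)
      fix s' assume "s' \<in> {t..t + s}"
      then have s': "s' \<in> {0..T}" using s t by auto
      show "norm (?F s') \<le> L * norm (l s')" using norm_adj_le[OF s' u0_in[OF s'], of "\<gamma> s'"] r by simp
    qed
    also have "\<dots> = L * integral {t..t + s} (\<lambda>s. norm (l s))" by simp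
    also have "integral {t..t + s} (\<lambda>s. norm (l s)) = integral {0..s} ?\<phi>"
      unfolding integral_shift_Icc_real by (simp add: add.commute)
    finally show "?\<phi> s \<le> 0 + L * integral {0..s} ?\<phi>" by simp
  qed
  then show False using lT p by simp
qed

text \<open>Serves the continuity of the costate in the initial point. The bound must hold along
  every curve \<open>q\<close> close to \<open>\<gamma>\<close>, since nearby trajectories have
  adjoint equations of their own.\<close>

lemma adjoint_stable:
  assumes \<eta>: "0 < \<eta>" and l0: "adjoint_curve f u0 T \<gamma> p l0"
  shows "\<exists>c>0. \<forall>q l. (\<forall>s\<in>{0..T}. norm (q s - \<gamma> s) \<le> c) \<longrightarrow> adjoint_curve f u0 T q p l \<longrightarrow> (\<forall>t\<in>{0..T}. norm (l t - l0 t) \<le> \<eta>)"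
proof -
  have "continuous_on {0..T} l0" using l0 by (simp add: adjoint_curve_def terminal_curve_def)
  then have "bounded (l0 ` {0..T})" by (intro compact_imp_bounded compact_continuous_image) auto
  then obtain C where C: "\<And>s. s \<in> {0..T} \<Longrightarrow> norm (l0 s) \<le> C" unfolding bounded_iff by blast
  have C0: "0 \<le> C" using order_trans[OF norm_ge_zero C[of 0]] T by simp
  \<comment> \<open>The Gronwall bound will be \<open>\<eta>' * C * T * exp (L * T)\<close>; the
    summand \<open>1\<close> avoids division by \<open>0\<close>.\<close>
  define \<eta>' where "\<eta>' = \<eta> / (C * T * exp (L * T) + 1)"
  have D: "0 \<le> C * T * exp (L * T)" using C0 T by simp
  then have \<eta>': "0 < \<eta>'" using \<eta> by (auto simp: \<eta>'_def intro!: divide_pos_pos)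
  have "\<eta>' * (C * T * exp (L * T)) \<le> \<eta>' * (C * T * exp (L * T) + 1)" using \<eta>' by (intro mult_left_mono) auto
  also have "\<dots> = \<eta>" using D by (simp add: \<eta>'_def)
  finally have le: "\<eta>' * (C * T * exp (L * T)) \<le> \<eta>" .
  obtain c where c: "0 < c" "c \<le> r" and cm: "\<And>s v z w. s \<in> {0..T} \<Longrightarrow> v \<in> V \<Longrightarrow> norm (z - \<gamma> s) \<le> c \<Longrightarrow>
     norm (frechet_derivative (f v) (at z) w - frechet_derivative (f v) (at (\<gamma> s)) w) \<le> \<eta>' * norm w"
    using deriv_modulus[OF \<eta>'] by blast
  show ?thesis
  proof (rule exI[of _ c], intro conjI allI impI ballI)
    fix q l t assume q: "\<forall>s\<in>{0..T}. norm (q s - \<gamma> s) \<le> c" and l: "adjoint_curve f u0 T q p l" and t: "t \<in> {0..T}"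
    have "norm (l t - l0 t) \<le> (norm (p - p) + (\<eta>' * C) * T) * exp (L * T)"
    proof (rule terminal_curves_dist_le[OF l[unfolded adjoint_curve_def] l0[unfolded adjoint_curve_def] L])
      fix s assume s: "s \<in> {0..T}"
      have qs: "q s \<in> cball (\<gamma> s) r" "norm (q s - \<gamma> s) \<le> c" using q s c by (auto simp: dist_norm norm_minus_commute intro: order_trans)
      have "- adj f (u0 s) (q s) (l s) - - adj f (u0 s) (\<gamma> s) (l0 s) =
          - adj f (u0 s) (q s) (l s - l0 s) - (adj f (u0 s) (q s) (l0 s) - adj f (u0 s) (\<gamma> s) (l0 s))"
        by (simp add: adj_diff)
      also have "norm \<dots> \<le> norm (adj f (u0 s) (q s) (l s - l0 s)) + norm (adj f (u0 s) (q s) (l0 s) - adj f (u0 s) (\<gamma> s) (l0 s))"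
        using norm_triangle_ineq4[of "- adj f (u0 s) (q s) (l s - l0 s)"] by simp
      also have "\<dots> \<le> L * norm (l s - l0 s) + \<eta>' * norm (l0 s)"
      proof (rule add_mono)
        show "norm (adj f (u0 s) (q s) (l s - l0 s)) \<le> L * norm (l s - l0 s)" by (rule norm_adj_le[OF s u0_in[OF s] qs(1)])
        show "norm (adj f (u0 s) (q s) (l0 s) - adj f (u0 s) (\<gamma> s) (l0 s)) \<le> \<eta>' * norm (l0 s)"
          by (rule norm_adj_diff_le[where f = f and v = "u0 s"])
            (use deriv_linear[OF s u0_in[OF s]] qs(1) r cm[OF s u0_in[OF s] qs(2)] in auto)
      qed
      also have "\<dots> \<le> L * norm (l s - l0 s) + \<eta>' * C" using C[OF s] \<eta>' by simp
      finally show "norm (- adj f (u0 s) (q s) (l s) - - adj f (u0 s) (\<gamma> s) (l0 s)) \<le> L * norm (l s - l0 s) + \<eta>' * C" .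
    qed (use T \<eta>' C0 t in auto)
    also have "\<dots> = \<eta>' * (C * T * exp (L * T))" by simp
    finally show "norm (l t - l0 t) \<le> \<eta>" using le by linarith
  qed (rule c)
qed

end

section \<open>Needle variations near one reference trajectory\<close>

locale needle = reference M U f T V \<gamma> r L B u0
  for M :: "'a::euclidean_space set" and U :: "(real ^ 'n) set" and f :: "real ^ 'n \<Rightarrow> 'a \<Rightarrow> 'a"
    and T :: real and V :: "(real ^ 'n) set" and \<gamma> :: "real \<Rightarrow> 'a" and r L B :: real and u0 :: "real \<Rightarrow> real ^ 'n" +
  fixes \<tau> :: real and u :: "real ^ 'n"
  assumes u: "u \<in> U" "u \<in> V"
begin

text \<open>The interval is half-open, so that length \<open>0\<close> gives back \<open>u0\<close>
  exactly.\<close>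

definition ctl :: "real \<Rightarrow> real \<Rightarrow> real ^ 'n" where
  "ctl \<epsilon> s = (if \<tau> \<le> s \<and> s < \<tau> + \<epsilon> then u else u0 s)"

text \<open>Curves of the field frozen outside the tube, hence defined for every length and every
  initial point; they are trajectories of the system as long as they stay in the tube.\<close>

definition Q :: "real \<Rightarrow> 'a \<Rightarrow> real \<Rightarrow> 'a" where
  "Q \<epsilon> x = (SOME q. integral_curve (ext (ctl \<epsilon>)) T x q)"

lemma ctl_V: "ctl \<epsilon> ` {0..T} \<subseteq> V"
  using u u0V by (auto simp: ctl_def)

lemma ctl_0: "ctl 0 = u0" by (auto simp: fun_eq_iff ctl_def)

lemma ctl_admissible: "admissible_control U T (ctl \<epsilon>)"
  unfolding admissible_control_def
proof (intro conjI)
  have "ctl \<epsilon> = (\<lambda>s. if s \<in> {\<tau>..<\<tau> + \<epsilon>} then u else u0 s)" by (auto simp: ctl_def)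
  moreover have "(\<lambda>s. if s \<in> {\<tau>..<\<tau> + \<epsilon>} then u else u0 s) \<in> borel_measurable (lebesgue_on {0..T})"
    by (rule measurable_If_set) (use u0_meas in \<open>auto simp: sets_restrict_space\<close>)
  ultimately show "ctl \<epsilon> \<in> borel_measurable (lebesgue_on {0..T})" by simp
  show "bounded (ctl \<epsilon> ` {0..T})" by (rule bounded_subset[OF compact_imp_bounded[OF V(1)] ctl_V])
  show "ctl \<epsilon> ` {0..T} \<subseteq> U" using u u0 by (auto simp: ctl_def admissible_control_def)
qed

lemma Q: "integral_curve (ext (ctl \<epsilon>)) T x (Q \<epsilon> x)"
proof -
  have "ctl \<epsilon> \<in> borel_measurable (lebesgue_on {0..T})" using ctl_admissible by (simp add: admissible_control_def)
  then have "\<exists>q. integral_curve (ext (ctl \<epsilon>)) T x q"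
    using caratheodory_existence[OF ext_caratheodory[OF _ ctl_V]] T by simp
  then show ?thesis unfolding Q_def by (rule someI_ex)
qed

lemma Q_dist:
  assumes "0 \<le> \<epsilon>" "0 \<le> \<epsilon>'" "t \<in> {0..T}"
  shows "norm (Q \<epsilon> x t - Q \<epsilon>' x' t) \<le> (norm (x - x') + 2 * B * \<bar>\<epsilon> - \<epsilon>'\<bar>) * exp (L * T)"
proof -
  \<comment> \<open>Two needles with the same left end differ only between their right ends.\<close>
  have "norm (Q \<epsilon> x t - Q \<epsilon>' x' t) \<le> (norm (x - x') + 2 * B * ((\<tau> + max \<epsilon> \<epsilon>') - (\<tau> + min \<epsilon> \<epsilon>'))) * exp (L * T)"
    by (rule ext_curves_dist_le[OF Q Q ctl_V ctl_V _ _ assms(3)]) (use assms in \<open>auto simp: ctl_def\<close>)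
  also have "(\<tau> + max \<epsilon> \<epsilon>') - (\<tau> + min \<epsilon> \<epsilon>') = \<bar>\<epsilon> - \<epsilon>'\<bar>" by auto
  finally show ?thesis .
qed

lemma Q_ref:
  assumes "t \<in> {0..T}"
  shows "Q 0 (\<gamma> 0) t = \<gamma> t"
proof -
  have e: "integral_curve (ext u0) T (\<gamma> 0) \<gamma>" by (rule curve_in_tube_ext[OF \<gamma>u0]) (use r in auto)
  have "norm (Q 0 (\<gamma> 0) t - \<gamma> t) \<le> (norm (\<gamma> 0 - \<gamma> 0) + 2 * B * (0 - 0)) * exp (L * T)"
    by (rule ext_curves_dist_le[OF Q[of 0] e ctl_V u0V _ _ assms]) (auto simp: ctl_0)
  then show ?thesis by simp
qed

lemma Q_near:
  assumes "0 \<le> \<epsilon>" "t \<in> {0..T}"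
  shows "norm (Q \<epsilon> x t - \<gamma> t) \<le> (norm (x - \<gamma> 0) + 2 * B * \<epsilon>) * exp (L * T)"
  using Q_dist[OF assms(1) _ assms(2), of 0 x "\<gamma> 0"] Q_ref[OF assms(2)] assms(1) by simp

lemma Q_start: "Q \<epsilon> x 0 = x" using integral_curve_start[OF Q] T by simp

lemma Q_trajectory:
  assumes \<epsilon>: "0 \<le> \<epsilon>" and le: "(norm (x - \<gamma> 0) + 2 * B * \<epsilon>) * exp (L * T) \<le> r"
  shows "trajectory M f T (ctl \<epsilon>) x (Q \<epsilon> x)"
    "lebesgue_point T (ctl \<epsilon>) t \<Longrightarrow> (Q \<epsilon> x has_vector_derivative f (ctl \<epsilon> t) (Q \<epsilon> x t)) (at t within {0..T})"
proof -
  have tb: "Q \<epsilon> x s \<in> cball (\<gamma> s) r" if "s \<in> {0..T}" for s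
    using Q_near[OF \<epsilon> that, of x] le by (simp add: dist_norm norm_minus_commute)
  note c = ext_curve_in_tube[OF Q tb]
  show "trajectory M f T (ctl \<epsilon>) x (Q \<epsilon> x)"
    using integral_curve_regular(1)[OF sys ctl_admissible _ c] T by simp
  show "lebesgue_point T (ctl \<epsilon>) t \<Longrightarrow> (Q \<epsilon> x has_vector_derivative f (ctl \<epsilon> t) (Q \<epsilon> x t)) (at t within {0..T})"
    using integral_curve_regular(2)[OF sys ctl_admissible _ c] T by simp
qed

text \<open>Pairing the perturbation with the adjoint curve leaves only the jump of the field on the needle, up to higher order
  terms; the flow need not be differentiated with respect to the initial point.\<close>

lemma adjoint_variation:
  assumes \<tau>: "lebesgue_point T u0 \<tau>" and l: "adjoint_curve f u0 T \<gamma> p l" and \<eta>: "0 < \<eta>"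
  shows "\<exists>\<delta>>0. \<forall>\<epsilon>\<in>{0..\<delta>}. \<forall>x\<in>cball (\<gamma> 0) \<delta>.
     \<bar>p \<bullet> (Q \<epsilon> x T - Q 0 x T) - \<epsilon> * (l \<tau> \<bullet> (f u (\<gamma> \<tau>) - f (u0 \<tau>) (\<gamma> \<tau>)))\<bar> \<le> \<eta> * \<epsilon>"
proof -
  have \<tau>0: "0 < \<tau>" "\<tau> < T" using \<tau> by (auto simp: lebesgue_point_def)
  define C where "C = exp (L * T)"
  have C: "0 < C" by (simp add: C_def)
  have lc: "continuous_on {0..T} l" using l by (simp add: adjoint_curve_def terminal_curve_def)
  then have "bounded (l ` {0..T})" by (intro compact_imp_bounded compact_continuous_image) auto
  then obtain \<Lambda>0 where \<Lambda>0: "\<And>s. s \<in> {0..T} \<Longrightarrow> norm (l s) \<le> \<Lambda>0" unfolding bounded_iff by blast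
  define \<Lambda> where "\<Lambda> = max \<Lambda>0 1"
  have \<Lambda>: "0 < \<Lambda>" "\<And>s. s \<in> {0..T} \<Longrightarrow> norm (l s) \<le> \<Lambda>" using \<Lambda>0 by (auto simp: \<Lambda>_def le_max_iff_disj)
  have lT: "l T = p" using terminal_curve_forward[OF l[unfolded adjoint_curve_def]] T by simp
  \<comment> \<open>The error \<open>\<eta> * \<epsilon>\<close> is spent in thirds: linearisation
    off the needle (through \<open>\<eta>'\<close>), replacement of the curves by
    \<open>\<gamma>\<close> on the needle (through \<open>c\<close>), and averaging of the jump at
    the Lebesgue point (through \<open>d\<close>).\<close>
  define D where "D = \<Lambda> * T * (2 * B * C) + 1"
  have D: "0 < D" using \<Lambda> T B C by (auto simp: D_def intro!: add_nonneg_pos mult_nonneg_nonneg)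
  define \<eta>' where "\<eta>' = \<eta> / (3 * D)"
  have \<eta>': "0 < \<eta>'" using \<eta> D by (simp add: \<eta>'_def)
  have \<eta>'_le: "\<Lambda> * \<eta>' * (2 * B * C) * T \<le> \<eta> / 3"
  proof -
    have "\<Lambda> * \<eta>' * (2 * B * C) * T = \<eta>' * (D - 1)" by (simp add: D_def)
    also have "\<dots> \<le> \<eta>' * D" using \<eta>' by simp
    also have "\<dots> = \<eta> / 3" using D by (simp add: \<eta>'_def)
    finally show ?thesis .
  qed
  obtain c1 where c1: "0 < c1" "c1 \<le> r" and sd: "\<And>s v z1 z2. s \<in> {0..T} \<Longrightarrow> v \<in> V \<Longrightarrow> norm (z1 - \<gamma> s) \<le> c1 \<Longrightarrow> norm (z2 - \<gamma> s) \<le> c1 \<Longrightarrow>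
     norm (f v z1 - f v z2 - frechet_derivative (f v) (at (\<gamma> s)) (z1 - z2)) \<le> \<eta>' * norm (z1 - z2)"
    using strict_derivative[OF \<eta>'] by blast
  \<comment> \<open>On the needle the error is \<open>\<Lambda>\<close> times
    \<open>4 * L * c\<close>: \<open>L * c\<close> for each of the two fields and
    \<open>2 * L * c\<close> for the linear part. Using \<open>L + 1\<close> avoids division by
    \<open>0\<close>.\<close>
  define c where "c = min c1 (\<eta> / (12 * \<Lambda> * (L + 1)))"
  have c: "0 < c" "c \<le> c1" "c \<le> r" using c1 \<eta> \<Lambda> L by (auto simp: c_def)
  have c_le: "\<Lambda> * (4 * (L * c)) \<le> \<eta> / 3"
  proof -
    have "\<Lambda> * (4 * (L * c)) = \<Lambda> * (4 * L * c)" by simp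
    also have "\<dots> \<le> \<Lambda> * (4 * (L + 1) * (\<eta> / (12 * \<Lambda> * (L + 1))))"
      using \<Lambda> L c(1) \<eta> by (intro mult_left_mono mult_mono) (auto simp: c_def)
    also have "\<dots> = 4 * (\<Lambda> * (L + 1)) * (\<eta> / (12 * (\<Lambda> * (L + 1))))" by (simp add: mult_ac)
    also have "\<dots> = \<eta> / 3"
    proof -
      have k: "4 * k * (\<eta> / (12 * k)) = \<eta> / 3" if "0 < k" for k :: real using that by simp
      show ?thesis by (rule k) (use \<Lambda>(1) L in simp)
    qed
    finally show ?thesis .
  qed
  let ?J = "\<lambda>s v. l s \<bullet> (f u (\<gamma> s) - f v (\<gamma> s))"
  have \<gamma>M: "\<gamma> ` {0..T} \<subseteq> M" using inM r by force
  have Jc: "continuous_on ({0..T} \<times> V) (\<lambda>(s, v). ?J s v)"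
  proof -
    have 1: "continuous_on ({0..T} \<times> V) (\<lambda>p. f (snd p) (\<gamma> (fst p)))"
      using continuous_along_curve[OF control_system_continuous(1)[OF sys] \<gamma> \<gamma>M V(2)] by (simp add: case_prod_beta)
    have "continuous_on ({0..T} \<times> V) (\<lambda>p. (\<lambda>p. f (snd p) (\<gamma> (fst p))) (fst p, u))"
      by (rule continuous_on_compose2[OF 1]) (use u in \<open>auto intro!: continuous_intros\<close>)
    then have "continuous_on ({0..T} \<times> V) (\<lambda>p. f u (\<gamma> (fst p)))" by simp
    with 1 show ?thesis unfolding case_prod_beta
      by (intro continuous_intros continuous_on_compose2[OF lc, of _ fst]) auto
  qed
  obtain d where d: "0 < d" and dh: "\<And>h. 0 < h \<Longrightarrow> h < d \<Longrightarrow> norm (integral {\<tau>..\<tau>+h} (\<lambda>s. ?J s (u0 s)) - h *\<^sub>R ?J \<tau> (u0 \<tau>)) \<le> \<eta> / 3 * h"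
    using lebesgue_point_average[OF u0_meas u0V V(1) Jc \<tau>, of "\<eta> / 3"] \<eta> by auto
  \<comment> \<open>Three demands: the averages over the needle are accurate, the needle ends before
    \<open>T\<close>, and both curves stay within \<open>c\<close> of
    \<open>\<gamma>\<close>.\<close>
  define \<delta> where "\<delta> = min (min (d / 2) ((T - \<tau>) / 2)) (c / ((1 + 2 * B) * C))"
  have \<delta>_le: "\<delta> \<le> d / 2" "\<delta> \<le> (T - \<tau>) / 2"
    unfolding \<delta>_def by (rule min.coboundedI1[OF min.cobounded1], rule min.coboundedI1[OF min.cobounded2])
  have "0 < \<delta>" using d \<tau>0 c(1) B C by (simp add: \<delta>_def)
  moreover have "\<delta> < d" using \<delta>_le(1) d by linarith
  moreover have "\<tau> + \<delta> < T" using \<delta>_le(2) \<tau>0(2) by (simp add: field_simps)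
  ultimately have \<delta>: "0 < \<delta>" "\<delta> < d" "\<tau> + \<delta> < T" by blast+
  have \<delta>c: "(\<delta> + 2 * B * \<delta>) * C \<le> c"
  proof -
    have "(\<delta> + 2 * B * \<delta>) * C = \<delta> * ((1 + 2 * B) * C)" by (simp add: algebra_simps)
    also have "\<dots> \<le> c / ((1 + 2 * B) * C) * ((1 + 2 * B) * C)" using B C by (intro mult_right_mono) (auto simp: \<delta>_def)
    also have "\<dots> = c" using B C by simp
    finally show ?thesis .
  qed
  show ?thesis
  proof (rule exI[of _ \<delta>], intro conjI ballI)
    fix \<epsilon> x assume \<epsilon>: "\<epsilon> \<in> {0..\<delta>}" and x: "x \<in> cball (\<gamma> 0) \<delta>"
    have nx: "norm (x - \<gamma> 0) \<le> \<delta>" using x by (simp add: dist_norm norm_minus_commute)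
    have small: "(norm (x - \<gamma> 0) + 2 * B * e) * exp (L * T) \<le> c" if "0 \<le> e" "e \<le> \<delta>" for e
    proof -
      have "(norm (x - \<gamma> 0) + 2 * B * e) * C \<le> (\<delta> + 2 * B * \<delta>) * C"
        using nx that B C by (intro mult_right_mono add_mono mult_left_mono) auto
      also note \<delta>c
      finally show ?thesis by (simp only: C_def)
    qed
    have near: "norm (Q e x s - \<gamma> s) \<le> c" if "0 \<le> e" "e \<le> \<delta>" "s \<in> {0..T}" for e s
      using Q_near[OF that(1,3), of x] small[OF that(1,2)] by linarith
    have near_r: "Q e x s \<in> cball (\<gamma> s) r" if "0 \<le> e" "e \<le> \<delta>" "s \<in> {0..T}" for e s
      using near[OF that] c(3) by (simp add: dist_norm norm_minus_commute)
    have small_r: "(norm (x - \<gamma> 0) + 2 * B * e) * exp (L * T) \<le> r" if "0 \<le> e" "e \<le> \<delta>" for e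
      using small[OF that] c(3) by linarith
    let ?y = "\<lambda>t. Q \<epsilon> x t - Q 0 x t"
    let ?y' = "\<lambda>t. f (ctl \<epsilon> t) (Q \<epsilon> x t) - f (u0 t) (Q 0 x t)"
    let ?A = "\<lambda>t. frechet_derivative (f (u0 t)) (at (\<gamma> t))"
    \<comment> \<open>Almost everywhere this is the time derivative of
      \<open>l t \<bullet> ?y t\<close>: the adjoint equation moves the Jacobian onto
      \<open>?y\<close> and subtracts the linear part.\<close>
    let ?G = "\<lambda>t. l t \<bullet> (?y' t - ?A t (?y t))"
    have yb: "norm (?y t) \<le> 2 * B * C * \<epsilon>" if "t \<in> {0..T}" for t
      using Q_dist[of \<epsilon> 0 t x x] \<epsilon> that by (simp add: C_def mult_ac)
    have G: "(?G has_integral p \<bullet> ?y T) {0..T}"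
    proof -
      have e0: "0 \<le> \<epsilon>" "\<epsilon> \<le> \<delta>" "(0::real) \<le> 0" "0 \<le> \<delta>" using \<epsilon> \<delta> by auto
      note t1 = Q_trajectory[OF e0(1) small_r[OF e0(1,2)]] and t0 = Q_trajectory[OF e0(3) small_r[OF e0(3,4)], unfolded ctl_0]
      note tr = t1(1) t0(1)
      obtain L1 L0 where L1: "L1-lipschitz_on {0..T} (Q \<epsilon> x)" and L0: "L0-lipschitz_on {0..T} (Q 0 x)"
        using tr unfolding trajectory_def by blast
      have Ly: "(L1 + L0)-lipschitz_on {0..T} ?y" by (rule lipschitz_on_diff[OF L1 L0])
      obtain Ll where Ll: "Ll-lipschitz_on {0..T} l" using adjoint_regular(1)[OF l] by blast
      note ac = admissible_control_compact[OF ctl_admissible[of \<epsilon>]] and ac0 = admissible_control_compact[OF u0]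
      obtain N1 where N1: "negligible N1" "\<And>t. t \<in> {0..T} - N1 \<Longrightarrow> lebesgue_point T (ctl \<epsilon>) t"
        using lebesgue_points_negligible[OF ac(4,5)] by blast
      obtain N0 where N0: "negligible N0" "\<And>t. t \<in> {0..T} - N0 \<Longrightarrow> lebesgue_point T u0 t"
        using lebesgue_points_negligible[OF ac0(4,5)] by blast
      have "((\<lambda>t. l t \<bullet> ?y' t + (- adj f (u0 t) (\<gamma> t) (l t)) \<bullet> ?y t) has_integral (l T \<bullet> ?y T - l 0 \<bullet> ?y 0)) {0..T}"
      proof (rule inner_has_integral[OF _ Ly Ll, of "N1 \<union> N0"])
        show "negligible (N1 \<union> N0)" using N1(1) N0(1) by (rule negligible_Un)
        fix t assume t: "t \<in> {0..T} - (N1 \<union> N0)"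
        show "(?y has_vector_derivative ?y' t) (at t within {0..T})"
          by (rule has_vector_derivative_diff[OF t1(2) t0(2)]) (use N1(2) N0(2) t in auto)
        show "(l has_vector_derivative - adj f (u0 t) (\<gamma> t) (l t)) (at t within {0..T})"
          by (rule adjoint_regular(2)[OF l]) (use N0(2) t in auto)
      qed (use T in simp)
      moreover have "l t \<bullet> ?y' t + (- adj f (u0 t) (\<gamma> t) (l t)) \<bullet> ?y t = ?G t" if "t \<in> {0..T}" for t
      proof -
        have "linear (?A t)" by (rule deriv_linear[OF that u0_in[OF that]]) (use r in simp)
        then show ?thesis by (simp only: inner_minus_left adj_inner) (simp add: inner_diff_right)
      qed
      ultimately have "(?G has_integral (l T \<bullet> ?y T - l 0 \<bullet> ?y 0)) {0..T}"
        by (rule has_integral_eq[rotated])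
      then show ?thesis by (simp add: lT Q_start)
    qed
    let ?I = "integral {\<tau>..\<tau>+\<epsilon>} (\<lambda>s. ?J s (u0 s))"
    \<comment> \<open>The jump on the needle and \<open>0\<close> elsewhere. At the right end
      \<open>ctl\<close> has already returned to \<open>u0\<close>; there \<open>?H\<close> is set
      to \<open>?G\<close>, so that the pointwise comparison below is trivial, and a single time
      does not change the integral.\<close>
    let ?H = "\<lambda>t. if t = \<tau> + \<epsilon> then ?G t else if t \<in> {\<tau>..\<tau>+\<epsilon>} then ?J t (u0 t) else 0"
    have H: "(?H has_integral ?I) {0..T}"
    proof -
      have sub: "{\<tau>..\<tau>+\<epsilon>} \<subseteq> {0..T}" using \<tau>0 \<epsilon> \<delta> by auto
      have "bounded ((\<lambda>(s, v). ?J s v) ` ({0..T} \<times> V))"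
        by (intro compact_imp_bounded compact_continuous_image Jc compact_Times V(1)) auto
      then obtain CJ where CJ: "\<And>z. z \<in> (\<lambda>(s, v). ?J s v) ` ({0..T} \<times> V) \<Longrightarrow> norm z \<le> CJ" unfolding bounded_iff by blast
      have "(\<lambda>s. ?J s (u0 s)) integrable_on {\<tau>..\<tau>+\<epsilon>}"
      proof (rule bounded_measurable_integrable_on[OF measurable_control_compose[OF u0_meas u0V Jc] _ sub])
        fix s assume "s \<in> {0..T}"
        then show "norm (?J s (u0 s)) \<le> CJ" by (intro CJ image_eqI[of _ _ "(s, u0 s)"]) (use u0_in in auto)
      qed
      then have "((\<lambda>t. if t \<in> {\<tau>..\<tau>+\<epsilon>} then ?J t (u0 t) else 0) has_integral ?I) {0..T}"
        using sub by (subst has_integral_restrict) (auto simp: has_integral_integral)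
      then show ?thesis by (rule has_integral_spike[of "{\<tau> + \<epsilon>}", rotated 2]) auto
    qed
    let ?h = "\<lambda>t. \<Lambda> * (\<eta>' * (2 * B * C * \<epsilon>)) + (if t \<in> {\<tau>..\<tau>+\<epsilon>} then \<Lambda> * (4 * (L * c)) else 0)"
    have h: "(?h has_integral (\<Lambda> * (\<eta>' * (2 * B * C * \<epsilon>)) * T + \<Lambda> * (4 * (L * c)) * \<epsilon>)) {0..T}"
    proof (rule has_integral_add)
      show "((\<lambda>t. \<Lambda> * (\<eta>' * (2 * B * C * \<epsilon>))) has_integral \<Lambda> * (\<eta>' * (2 * B * C * \<epsilon>)) * T) {0..T}"
        using has_integral_const_real[of "\<Lambda> * (\<eta>' * (2 * B * C * \<epsilon>))" 0 T] T by (simp add: mult.commute)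
      have "((\<lambda>t. \<Lambda> * (4 * (L * c))) has_integral \<Lambda> * (4 * (L * c)) * \<epsilon>) {\<tau>..\<tau>+\<epsilon>}"
        using has_integral_const_real[of "\<Lambda> * (4 * (L * c))" \<tau> "\<tau> + \<epsilon>"] \<epsilon> by (simp add: mult.commute)
      then show "((\<lambda>t. if t \<in> {\<tau>..\<tau>+\<epsilon>} then \<Lambda> * (4 * (L * c)) else 0) has_integral \<Lambda> * (4 * (L * c)) * \<epsilon>) {0..T}"
        using \<tau>0 \<epsilon> \<delta> by (subst has_integral_restrict) auto
    qed
    have tri: "norm (a - b - d) \<le> norm a + norm b + norm d" for a b d :: 'a
      using norm_triangle_ineq4[of "a - b" d] norm_triangle_ineq4[of a b] by linarith
    have pw: "norm (?G t - ?H t) \<le> ?h t" if t: "t \<in> {0..T}" for t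
    proof -
      have nn: "0 \<le> \<Lambda> * (\<eta>' * (2 * B * C * \<epsilon>))" "0 \<le> \<Lambda> * (4 * (L * c))" using \<Lambda>(1) \<eta>' B C \<epsilon> L c(1) by auto
      have n1: "norm (Q \<epsilon> x t - \<gamma> t) \<le> c" and n0: "norm (Q 0 x t - \<gamma> t) \<le> c" using near \<epsilon> \<delta> t by auto
      have r1: "Q \<epsilon> x t \<in> cball (\<gamma> t) r" and r0: "Q 0 x t \<in> cball (\<gamma> t) r" and rg: "\<gamma> t \<in> cball (\<gamma> t) r"
        using near_r \<epsilon> \<delta> t r by auto
      consider "t = \<tau> + \<epsilon>" | "t \<noteq> \<tau> + \<epsilon>" "t \<in> {\<tau>..\<tau>+\<epsilon>}" | "t \<noteq> \<tau> + \<epsilon>" "t \<notin> {\<tau>..\<tau>+\<epsilon>}" by blast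
      then show ?thesis
      proof cases
        case 1
        then show ?thesis using nn by simp
      next
        case 2
        then have ct: "ctl \<epsilon> t = u" by (simp add: ctl_def)
        have e1: "norm (f u (Q \<epsilon> x t) - f u (\<gamma> t)) \<le> L * c"
          using lipschitz[OF t u(2) r1 rg] mult_left_mono[OF n1 L] by linarith
        have e2: "norm (f (u0 t) (Q 0 x t) - f (u0 t) (\<gamma> t)) \<le> L * c"
          using lipschitz[OF t u0_in[OF t] r0 rg] mult_left_mono[OF n0 L] by linarith
        have e3: "norm (?A t (?y t)) \<le> 2 * (L * c)"
        proof -
          have "norm (?y t) \<le> c + c" using norm_triangle_ineq4[of "Q \<epsilon> x t - \<gamma> t" "Q 0 x t - \<gamma> t"] n1 n0 by simp
          then have "L * norm (?y t) \<le> L * (2 * c)" using L by (intro mult_left_mono) auto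
          then show ?thesis using deriv_bound[OF t u0_in[OF t] rg, of "?y t"] by (simp add: mult_ac)
        qed
        define R where "R = (f u (Q \<epsilon> x t) - f u (\<gamma> t)) - (f (u0 t) (Q 0 x t) - f (u0 t) (\<gamma> t)) - ?A t (?y t)"
        have R: "norm R \<le> 4 * (L * c)" unfolding R_def
          by (rule order_trans[OF tri]) (use e1 e2 e3 in linarith)
        have eq: "?G t - ?H t = l t \<bullet> R"
          using 2 by (simp add: R_def ct inner_diff_right)
        have "norm (?G t - ?H t) \<le> norm (l t) * norm R"
          unfolding eq real_norm_def by (rule Cauchy_Schwarz_ineq2)
        also have "\<dots> \<le> \<Lambda> * (4 * (L * c))"
          by (rule mult_mono) (use \<Lambda> t R in auto)
        finally have "norm (?G t - ?H t) \<le> \<Lambda> * (4 * (L * c))" .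
        moreover have "?h t = \<Lambda> * (\<eta>' * (2 * B * C * \<epsilon>)) + \<Lambda> * (4 * (L * c))" using 2 by simp
        ultimately show ?thesis using nn(1) by linarith
      next
        case 3
        then have ct: "ctl \<epsilon> t = u0 t" by (auto simp: ctl_def)
        have "norm (f (u0 t) (Q \<epsilon> x t) - f (u0 t) (Q 0 x t) - ?A t (?y t)) \<le> \<eta>' * norm (?y t)"
          by (rule sd[OF t u0_in[OF t]]) (use n1 n0 c in auto)
        also have "\<dots> \<le> \<eta>' * (2 * B * C * \<epsilon>)" using \<eta>' yb[OF t] by (intro mult_left_mono) auto
        finally have e: "norm (f (u0 t) (Q \<epsilon> x t) - f (u0 t) (Q 0 x t) - ?A t (?y t)) \<le> \<eta>' * (2 * B * C * \<epsilon>)" .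
        have "norm (?G t - ?H t) \<le> norm (l t) * norm (f (u0 t) (Q \<epsilon> x t) - f (u0 t) (Q 0 x t) - ?A t (?y t))"
        proof -
          have "?H t = 0" by (simp only: 3 if_False)
          then have "norm (?G t - ?H t) = \<bar>?G t\<bar>" by (simp only: diff_0_right real_norm_def)
          then show ?thesis using Cauchy_Schwarz_ineq2[of "l t"] by (simp only: ct)
        qed
        also have "\<dots> \<le> \<Lambda> * (\<eta>' * (2 * B * C * \<epsilon>))" using e \<Lambda> t by (intro mult_mono) auto
        finally have "norm (?G t - ?H t) \<le> \<Lambda> * (\<eta>' * (2 * B * C * \<epsilon>))" .
        moreover have "?h t = \<Lambda> * (\<eta>' * (2 * B * C * \<epsilon>))" by (simp only: 3 if_False add_0_right)
        ultimately show ?thesis by linarith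
      qed
    qed
    have "norm (p \<bullet> ?y T - ?I) \<le> integral {0..T} ?h"
      unfolding integral_unique[OF has_integral_diff[OF G H], symmetric]
      by (rule integral_norm_bound_integral) (use has_integral_diff[OF G H] h pw in auto)
    also have "\<dots> = \<Lambda> * (\<eta>' * (2 * B * C * \<epsilon>)) * T + \<Lambda> * (4 * (L * c)) * \<epsilon>" by (rule integral_unique[OF h])
    also have "\<Lambda> * (\<eta>' * (2 * B * C * \<epsilon>)) * T = (\<Lambda> * \<eta>' * (2 * B * C) * T) * \<epsilon>" by simp
    also have "(\<Lambda> * \<eta>' * (2 * B * C) * T) * \<epsilon> + \<Lambda> * (4 * (L * c)) * \<epsilon> \<le> \<eta> / 3 * \<epsilon> + \<eta> / 3 * \<epsilon>"
      using \<eta>'_le c_le \<epsilon> by (intro add_mono mult_right_mono) auto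
    finally have 1: "\<bar>p \<bullet> ?y T - ?I\<bar> \<le> \<eta> / 3 * \<epsilon> + \<eta> / 3 * \<epsilon>" by simp
    have 2: "\<bar>?I - \<epsilon> * ?J \<tau> (u0 \<tau>)\<bar> \<le> \<eta> / 3 * \<epsilon>"
      using dh[of \<epsilon>] \<epsilon> \<delta> by (cases "\<epsilon> = 0") auto
    from 1 2 show "\<bar>p \<bullet> ?y T - \<epsilon> * ?J \<tau> (u0 \<tau>)\<bar> \<le> \<eta> * \<epsilon>" by linarith
  qed (rule \<delta>)
qed

end

lemma reference_exists:
  assumes sys: "control_system M U f" and T: "0 < T" and u0: "admissible_control U T u0"
    and q: "trajectory M f T u0 x q" and u: "u \<in> U"
  obtains V r L B where "reference M U f T V q r L B u0" "u \<in> V" "q 0 = x"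
proof -
  note ic = trajectory_integral_curve[OF q less_imp_le[OF T]] and ac = admissible_control_compact[OF u0]
  have q0: "q 0 = x" using q by (simp add: trajectory_def)
  \<comment> \<open>Only this needle value is adjoined to the values of the reference control,
    because \<open>U\<close> need not be compact; the tube then depends on \<open>u\<close>.\<close>
  define V where "V = insert u (closure (u0 ` {0..T}))"
  have V: "compact V" "V \<subseteq> closure U" "u0 ` {0..T} \<subseteq> V" "u \<in> V"
    using ac u closure_subset[of U] by (auto simp: V_def)
  have "continuous_on {0..T} q" using ic(1) by (simp add: integral_curve_def)
  from tube_exists[OF sys T V(1,2) this ic(2)] obtain r L B where "tube M U f T V q r L B" by blast
  then have "reference M U f T V q r L B u0"
    by (intro reference.intro reference_axioms.intro) (use u0 V(3) ic(1) q0 in auto)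
  then show ?thesis using that V(4) q0 by blast
qed

lemma trajectory_unique:
  assumes sys: "control_system M U f" and T: "0 < T" and u0: "admissible_control U T u0"
    and q: "trajectory M f T u0 x q" and q': "trajectory M f T u0 x q'" and t: "t \<in> {0..T}"
  shows "q' t = q t"
proof -
  have "u0 0 \<in> U" using u0 T by (auto simp: admissible_control_def)
  then obtain V r L B where R: "reference M U f T V q r L B u0" "u0 0 \<in> V" "q 0 = x"
    by (rule reference_exists[OF sys T u0 q])
  interpret reference M U f T V q r L B u0 by (rule R)
  show ?thesis
    using curve_unique[OF _ u0V, of x q' t] \<gamma>u0 R(3) trajectory_integral_curve[OF q'] T t by simp
qed

text \<open>The jump of the field at \<open>\<tau>\<close>, transported to the end time by the
  linearised flow. It is given by its components: with \<open>l b\<close> the adjoint curve ending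
  in \<open>b\<close>, no fundamental matrix has to be built.\<close>

definition needle_vector ::
  "(real ^ 'n \<Rightarrow> 'a \<Rightarrow> 'a) \<Rightarrow> (real \<Rightarrow> real ^ 'n) \<Rightarrow> ('a \<Rightarrow> real \<Rightarrow> 'a) \<Rightarrow> (real \<Rightarrow> 'a) \<Rightarrow> real \<Rightarrow> real ^ 'n \<Rightarrow> 'a::euclidean_space" where
  "needle_vector f u0 l q \<tau> u = (\<Sum>b\<in>Basis. (l b \<tau> \<bullet> (f u (q \<tau>) - f (u0 \<tau>) (q \<tau>))) *\<^sub>R b)"

text \<open>Assembles the scalar estimates for the basis covectors into a vector estimate. One
  radius \<open>\<delta>\<close> serves all initial points near \<open>x0\<close>, so the displaced
  endpoints can be integrated over a set of positive mass; the Lipschitz bound will make them Borel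
  functions, with integrals continuous in the needle length.\<close>

lemma needle_variation:
  fixes M :: "'a::euclidean_space set" and U :: "(real ^ 'n) set"
  assumes sys: "control_system M U f" and T: "0 < T" and u0: "admissible_control U T u0"
    and q: "trajectory M f T u0 x0 q" and u: "u \<in> U" and \<tau>: "lebesgue_point T u0 \<tau>"
    and l: "\<And>b. b \<in> Basis \<Longrightarrow> adjoint_curve f u0 T q b (l b)" and \<eta>: "0 < \<eta>"
  obtains \<delta> C S where "0 < \<delta>" "0 \<le> C"
    "\<And>\<epsilon> x. \<epsilon> \<in> {0..\<delta>} \<Longrightarrow> x \<in> cball x0 \<delta> \<Longrightarrow> S \<epsilon> x \<in> attainable M U f T x"
    "\<And>x. x \<in> cball x0 \<delta> \<Longrightarrow> \<exists>q. trajectory M f T u0 x q \<and> q T = S 0 x"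
    "\<And>\<epsilon> \<epsilon>' x x'. 0 \<le> \<epsilon> \<Longrightarrow> 0 \<le> \<epsilon>' \<Longrightarrow> norm (S \<epsilon> x - S \<epsilon>' x') \<le> C * (norm (x - x') + \<bar>\<epsilon> - \<epsilon>'\<bar>)"
    "\<And>\<epsilon> x. \<epsilon> \<in> {0..\<delta>} \<Longrightarrow> x \<in> cball x0 \<delta> \<Longrightarrow> norm (S \<epsilon> x - S 0 x - \<epsilon> *\<^sub>R needle_vector f u0 l q \<tau> u) \<le> \<eta> * \<epsilon>"
proof -
  obtain V r L B where R: "reference M U f T V q r L B u0" "u \<in> V" "q 0 = x0"
    by (rule reference_exists[OF sys T u0 q u])
  interpret needle M U f T V q r L B u0 \<tau> u
    by (intro needle.intro needle_axioms.intro R u)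
  \<comment> \<open>The tolerance is divided by \<open>DIM('a)\<close>, because the norm will be
    bounded by the sum of the components.\<close>
  have "\<forall>b. \<exists>\<delta>>0. b \<in> Basis \<longrightarrow> (\<forall>\<epsilon>\<in>{0..\<delta>}. \<forall>x\<in>cball x0 \<delta>.
     \<bar>b \<bullet> (Q \<epsilon> x T - Q 0 x T) - \<epsilon> * (l b \<tau> \<bullet> (f u (q \<tau>) - f (u0 \<tau>) (q \<tau>)))\<bar> \<le> \<eta> / DIM('a) * \<epsilon>)"
  proof
    fix b :: 'a
    show "\<exists>\<delta>>0. b \<in> Basis \<longrightarrow> (\<forall>\<epsilon>\<in>{0..\<delta>}. \<forall>x\<in>cball x0 \<delta>.
     \<bar>b \<bullet> (Q \<epsilon> x T - Q 0 x T) - \<epsilon> * (l b \<tau> \<bullet> (f u (q \<tau>) - f (u0 \<tau>) (q \<tau>)))\<bar> \<le> \<eta> / DIM('a) * \<epsilon>)"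
      using adjoint_variation[OF \<tau> l[of b], of "\<eta> / DIM('a)"] \<eta> R(3) by (cases "b \<in> Basis") (auto intro: exI[of _ 1])
  qed
  then obtain \<delta>1 where \<delta>1: "\<And>b. 0 < \<delta>1 b" and v: "\<And>b \<epsilon> x. b \<in> Basis \<Longrightarrow> \<epsilon> \<in> {0..\<delta>1 b} \<Longrightarrow> x \<in> cball x0 (\<delta>1 b) \<Longrightarrow>
     \<bar>b \<bullet> (Q \<epsilon> x T - Q 0 x T) - \<epsilon> * (l b \<tau> \<bullet> (f u (q \<tau>) - f (u0 \<tau>) (q \<tau>)))\<bar> \<le> \<eta> / DIM('a) * \<epsilon>"
    by metis
  \<comment> \<open>With start and length both within \<open>\<delta>2\<close>, the curve stays
    within \<open>(1 + 2 * B) * exp (L * T) * \<delta>2 = r\<close> of the reference curve, so it is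
    a trajectory.\<close>
  define \<delta>2 where "\<delta>2 = r / ((1 + 2 * B) * exp (L * T))"
  have \<delta>2: "0 < \<delta>2" using r B by (auto simp: \<delta>2_def intro!: divide_pos_pos mult_pos_pos)
  define \<delta> where "\<delta> = Min (insert \<delta>2 (\<delta>1 ` Basis))"
  have \<delta>: "0 < \<delta>" "\<delta> \<le> \<delta>2" "\<And>b. b \<in> Basis \<Longrightarrow> \<delta> \<le> \<delta>1 b" 
  proof -
    have "finite (insert \<delta>2 (\<delta>1 ` Basis))" by simp
    then show "0 < \<delta>" "\<delta> \<le> \<delta>2" "\<And>b. b \<in> Basis \<Longrightarrow> \<delta> \<le> \<delta>1 b"
      unfolding \<delta>_def using \<delta>1 \<delta>2 by (simp, blast intro: Min.coboundedI, blast intro: Min.coboundedI)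
  qed
  have small: "(norm (x - q 0) + 2 * B * \<epsilon>) * exp (L * T) \<le> r" if "\<epsilon> \<in> {0..\<delta>}" "x \<in> cball x0 \<delta>" for \<epsilon> x
  proof -
    have "norm (x - q 0) + 2 * B * \<epsilon> \<le> \<delta>2 + 2 * B * \<delta>2"
      using that \<delta> B R(3) by (intro add_mono mult_left_mono) (auto simp: dist_norm norm_minus_commute)
    then have "(norm (x - q 0) + 2 * B * \<epsilon>) * exp (L * T) \<le> (\<delta>2 + 2 * B * \<delta>2) * exp (L * T)" by (rule mult_right_mono) simp
    also have "\<dots> = \<delta>2 * ((1 + 2 * B) * exp (L * T))" by (simp add: algebra_simps)
    also have "\<dots> = r" using B by (simp add: \<delta>2_def)
    finally show ?thesis .
  qed
  show ?thesis
  proof (rule that[of \<delta> "(1 + 2 * B) * exp (L * T)" "\<lambda>\<epsilon> x. Q \<epsilon> x T"])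
    show "0 < \<delta>" by (rule \<delta>)
    show "0 \<le> (1 + 2 * B) * exp (L * T)" using B by simp
    show "Q \<epsilon> x T \<in> attainable M U f T x" if "\<epsilon> \<in> {0..\<delta>}" "x \<in> cball x0 \<delta>" for \<epsilon> x
      unfolding attainable_def using Q_trajectory(1)[OF _ small[OF that]] ctl_admissible[of \<epsilon>] that by auto
    show "\<exists>q. trajectory M f T u0 x q \<and> q T = Q 0 x T" if "x \<in> cball x0 \<delta>" for x
      using Q_trajectory(1)[OF _ small[OF _ that, of 0]] \<delta> by (auto simp: ctl_0)
    show "norm (Q \<epsilon> x T - Q \<epsilon>' x' T) \<le> (1 + 2 * B) * exp (L * T) * (norm (x - x') + \<bar>\<epsilon> - \<epsilon>'\<bar>)"
      if "0 \<le> \<epsilon>" "0 \<le> \<epsilon>'" for \<epsilon> \<epsilon>' x x'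
    proof -
      have "norm (Q \<epsilon> x T - Q \<epsilon>' x' T) \<le> (norm (x - x') + 2 * B * \<bar>\<epsilon> - \<epsilon>'\<bar>) * exp (L * T)"
        by (rule Q_dist[OF that]) (use T in simp)
      also have "norm (x - x') + 2 * B * \<bar>\<epsilon> - \<epsilon>'\<bar> \<le> (1 + 2 * B) * (norm (x - x') + \<bar>\<epsilon> - \<epsilon>'\<bar>)"
        using B by (simp add: algebra_simps)
      finally show ?thesis by (simp add: mult_ac)
    qed
    show "norm (Q \<epsilon> x T - Q 0 x T - \<epsilon> *\<^sub>R needle_vector f u0 l q \<tau> u) \<le> \<eta> * \<epsilon>"
      if \<epsilon>: "\<epsilon> \<in> {0..\<delta>}" and x: "x \<in> cball x0 \<delta>" for \<epsilon> x
    proof -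
      let ?d = "Q \<epsilon> x T - Q 0 x T - \<epsilon> *\<^sub>R needle_vector f u0 l q \<tau> u"
      have "norm ?d \<le> (\<Sum>b\<in>Basis. \<bar>?d \<bullet> b\<bar>)" by (rule norm_le_l1)
      also have "\<dots> \<le> (\<Sum>b\<in>(Basis::'a set). \<eta> / DIM('a) * \<epsilon>)"
      proof (rule sum_mono)
        fix b :: 'a assume b: "b \<in> Basis"
        have "needle_vector f u0 l q \<tau> u \<bullet> b = l b \<tau> \<bullet> (f u (q \<tau>) - f (u0 \<tau>) (q \<tau>))"
          unfolding needle_vector_def using b by (simp add: inner_sum_left inner_Basis if_distrib sum.delta' cong: if_cong)
        then have "?d \<bullet> b = b \<bullet> (Q \<epsilon> x T - Q 0 x T) - \<epsilon> * (l b \<tau> \<bullet> (f u (q \<tau>) - f (u0 \<tau>) (q \<tau>)))"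
          by (simp only: inner_diff_left[of _ _ b] inner_scaleR_left inner_commute[of b])
        then show "\<bar>?d \<bullet> b\<bar> \<le> \<eta> / DIM('a) * \<epsilon>"
          using v[OF b, of \<epsilon> x] \<epsilon> x \<delta>(3)[OF b] by simp
      qed
      also have "\<dots> = \<eta> * \<epsilon>" by simp
      finally show ?thesis .
    qed
  qed
qed

lemma nearby_trajectories:
  fixes M :: "'a::euclidean_space set" and U :: "(real ^ 'n) set"
  assumes sys: "control_system M U f" and T: "0 < T" and u0: "admissible_control U T u0"
    and q: "trajectory M f T u0 x0 q"
  obtains \<delta> C where "0 < \<delta>" "0 \<le> C" "\<And>x. x \<in> cball x0 \<delta> \<Longrightarrow>
    \<exists>q'. trajectory M f T u0 x q' \<and> (\<forall>t\<in>{0..T}. norm (q' t - q t) \<le> C * norm (x - x0))"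
proof -
  have uU: "u0 0 \<in> U" using u0 T by (auto simp: admissible_control_def)
  obtain V r L B where R: "reference M U f T V q r L B u0" "u0 0 \<in> V" "q 0 = x0"
    by (rule reference_exists[OF sys T u0 q uU])
  \<comment> \<open>Only needles of length \<open>0\<close> will occur, so the instant
    \<open>0\<close> and the value \<open>u0 0\<close> are placeholders.\<close>
  interpret needle M U f T V q r L B u0 0 "u0 0"
    by (intro needle.intro needle_axioms.intro R uU)
  show ?thesis
  proof (rule that[of "r / exp (L * T)" "exp (L * T)"])
    fix x assume x: "x \<in> cball x0 (r / exp (L * T))"
    have "norm (x - q 0) \<le> r / exp (L * T)" using x R(3) by (simp add: dist_norm norm_minus_commute)
    then have "norm (x - q 0) * exp (L * T) \<le> r" by (simp add: pos_le_divide_eq)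
    then have "trajectory M f T u0 x (Q 0 x)" using Q_trajectory(1)[of 0 x] by (simp add: ctl_0)
    moreover have "\<forall>t\<in>{0..T}. norm (Q 0 x t - q t) \<le> exp (L * T) * norm (x - x0)"
      using Q_near[of 0 _ x] R(3) by (simp add: mult.commute)
    ultimately show "\<exists>q'. trajectory M f T u0 x q' \<and> (\<forall>t\<in>{0..T}. norm (q' t - q t) \<le> exp (L * T) * norm (x - x0))" by blast
  qed (use r in auto)
qed

section \<open>The reference flow and its costates as functions of the initial point\<close>

locale flow =
  fixes M :: "'a::euclidean_space set" and U :: "(real ^ 'n) set" and f :: "real ^ 'n \<Rightarrow> 'a \<Rightarrow> 'a"
    and T :: real and u0 :: "real \<Rightarrow> real ^ 'n"
  assumes sys: "control_system M U f" and T: "0 < T" and u0: "admissible_control U T u0"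
begin

text \<open>\<open>fl x\<close> and \<open>costate x p\<close> are arbitrary for \<open>x\<close> outside \<open>W\<close>.\<close>

definition W :: "'a set" where "W = {x. \<exists>q. trajectory M f T u0 x q}"

definition fl :: "'a \<Rightarrow> real \<Rightarrow> 'a" where "fl x = (SOME q. trajectory M f T u0 x q)"

definition basis_costate :: "'a \<Rightarrow> 'a \<Rightarrow> real \<Rightarrow> 'a" where
  "basis_costate x b = (SOME l. adjoint_curve f u0 T (fl x) b l)"

definition costate :: "'a \<Rightarrow> 'a \<Rightarrow> real \<Rightarrow> 'a" where
  "costate x p t = (\<Sum>b\<in>Basis. (p \<bullet> b) *\<^sub>R basis_costate x b t)"

lemma u0_U: "t \<in> {0..T} \<Longrightarrow> u0 t \<in> U" using u0 by (auto simp: admissible_control_def)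

lemma fl: "x \<in> W \<Longrightarrow> trajectory M f T u0 x (fl x)"
  unfolding W_def fl_def using someI_ex[of "\<lambda>q. trajectory M f T u0 x q"] by simp

lemma fl_unique:
  assumes "trajectory M f T u0 x q" "t \<in> {0..T}"
  shows "q t = fl x t"
  using trajectory_unique[OF sys T u0 fl assms(1,2)] assms(1) by (auto simp: W_def)

lemma fl_in: "x \<in> W \<Longrightarrow> t \<in> {0..T} \<Longrightarrow> fl x t \<in> M"
  using fl[of x] unfolding trajectory_def by auto

lemma reference_fl:
  assumes "x \<in> W"
  obtains V r L B where "reference M U f T V (fl x) r L B u0"
proof -
  have "u0 0 \<in> U" using u0_U[of 0] T by simp
  show ?thesis by (rule reference_exists[OF sys T u0 fl[OF assms] \<open>u0 0 \<in> U\<close>]) (rule that)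
qed

lemma basis_costate: "x \<in> W \<Longrightarrow> adjoint_curve f u0 T (fl x) b (basis_costate x b)"
proof -
  assume "x \<in> W"
  obtain V r L B where "reference M U f T V (fl x) r L B u0" by (rule reference_fl[OF \<open>x \<in> W\<close>])
  then interpret reference M U f T V "fl x" r L B u0 .
  from someI_ex[OF adjoint_exists[of b]] show ?thesis unfolding basis_costate_def .
qed

lemma costate:
  assumes "x \<in> W"
  shows "adjoint_curve f u0 T (fl x) p (costate x p)"
  unfolding adjoint_curve_def terminal_curve_def
proof (intro conjI ballI)
  note b = basis_costate[OF assms, unfolded adjoint_curve_def terminal_curve_def]
  show "continuous_on {0..T} (costate x p)" unfolding costate_def using b by (intro continuous_intros) auto
  fix t assume t: "t \<in> {0..T}"
  have "((\<lambda>s. \<Sum>b\<in>Basis. (p \<bullet> b) *\<^sub>R (- adj f (u0 s) (fl x s) (basis_costate x b s))) has_integral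
      (\<Sum>b\<in>Basis. (p \<bullet> b) *\<^sub>R (b - basis_costate x b t))) {t..T}"
    using b t by (intro has_integral_sum has_integral_cmul) auto
  moreover have "(\<Sum>b\<in>Basis. (p \<bullet> b) *\<^sub>R (- adj f v q (l b))) = - adj f v q (\<Sum>b\<in>Basis. (p \<bullet> b) *\<^sub>R l b)" for v q and l :: "'a \<Rightarrow> 'a"
  proof -
    have "linear (adj f v q)"
      by (rule linearI) (simp_all add: adj_def inner_add_left scaleR_add_left sum.distrib scaleR_sum_right)
    then show ?thesis by (simp add: linear_sum linear_scale sum_negf)
  qed
  moreover have "(\<Sum>b\<in>Basis. (p \<bullet> b) *\<^sub>R (b - basis_costate x b t)) = p - costate x p t"
    by (simp add: costate_def scaleR_diff_right sum_subtractf euclidean_representation)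
  ultimately show "((\<lambda>s. - adj f (u0 s) (fl x s) (costate x p s)) has_integral (p - costate x p t)) {t..T}"
    by (simp add: costate_def)
qed

text \<open>The reason for building the costate as a superposition of the basis costates: the needle
  vectors are formed before \<open>p\<close> is known, and the \<open>p\<close> found by separation
  then pairs with them exactly.\<close>

lemma inner_needle_vector:
  "p \<bullet> needle_vector f u0 (basis_costate x) (fl x) \<tau> u = costate x p \<tau> \<bullet> (f u (fl x \<tau>) - f (u0 \<tau>) (fl x \<tau>))"
  by (simp add: needle_vector_def costate_def inner_sum_left inner_sum_right mult.commute)

lemma costate_nonzero:
  assumes "x \<in> W" "p \<noteq> 0" "t \<in> {0..T}"
  shows "costate x p t \<noteq> 0"
proof -
  obtain V r L B where "reference M U f T V (fl x) r L B u0" by (rule reference_fl[OF assms(1)])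
  then interpret reference M U f T V "fl x" r L B u0 .
  show ?thesis by (rule adjoint_nonzero[OF costate[OF assms(1)] assms(2,3)])
qed

lemma costate_regular:
  assumes "x \<in> W"
  shows "\<exists>C. C-lipschitz_on {0..T} (costate x p)"
    and "lebesgue_point T u0 t \<Longrightarrow> (costate x p has_vector_derivative - adj f (u0 t) (fl x t) (costate x p t)) (at t within {0..T})"
proof -
  obtain V r L B where "reference M U f T V (fl x) r L B u0" by (rule reference_fl[OF assms(1)])
  then interpret reference M U f T V "fl x" r L B u0 .
  show "\<exists>C. C-lipschitz_on {0..T} (costate x p)" by (rule adjoint_regular(1)[OF costate[OF assms(1)]])
  show "(costate x p has_vector_derivative - adj f (u0 t) (fl x t) (costate x p t)) (at t within {0..T})" if "lebesgue_point T u0 t"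
    by (rule adjoint_regular(2)[OF costate[OF assms(1)] that])
qed

lemma fl_near:
  assumes "x0 \<in> W"
  obtains \<delta> C where "0 < \<delta>" "0 \<le> C" "cball x0 \<delta> \<subseteq> W"
    "\<And>x t. x \<in> cball x0 \<delta> \<Longrightarrow> t \<in> {0..T} \<Longrightarrow> norm (fl x t - fl x0 t) \<le> C * norm (x - x0)"
proof -
  obtain \<delta> C where d: "0 < \<delta>" "0 \<le> C" and n: "\<And>x. x \<in> cball x0 \<delta> \<Longrightarrow>
    \<exists>q'. trajectory M f T u0 x q' \<and> (\<forall>t\<in>{0..T}. norm (q' t - fl x0 t) \<le> C * norm (x - x0))"
    using nearby_trajectories[OF sys T u0 fl[OF assms]] by blast
  show ?thesis
  proof (rule that[OF d])
    show "cball x0 \<delta> \<subseteq> W" using n unfolding W_def by blast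
    fix x t assume x: "x \<in> cball x0 \<delta>" and t: "t \<in> {0..T}"
    obtain q' where "trajectory M f T u0 x q'" "\<forall>t\<in>{0..T}. norm (q' t - fl x0 t) \<le> C * norm (x - x0)" using n[OF x] by blast
    then show "norm (fl x t - fl x0 t) \<le> C * norm (x - x0)" using fl_unique[of x q' t] t by metis
  qed
qed

text \<open>Solutions started near \<open>x0\<close> remain in the tube, hence cannot cease to exist
  before \<open>T\<close>.\<close>

lemma open_W: "open W"
  unfolding open_contains_cball using fl_near by metis

lemma near_le:
  assumes "0 < e" "0 \<le> C"
  shows "\<exists>d>0. \<forall>x. dist x x0 < d \<longrightarrow> C * norm (x - x0 :: 'a) < e"
proof (rule exI[of _ "e / (C + 1)"], intro conjI allI impI)
  show "0 < e / (C + 1)" using assms by simp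
  fix x assume "dist x x0 < e / (C + 1)"
  then have "(C + 1) * norm (x - x0) < e" using assms by (simp add: dist_norm pos_less_divide_eq mult.commute)
  moreover have "C * norm (x - x0) \<le> (C + 1) * norm (x - x0)" by (rule mult_right_mono) auto
  ultimately show "C * norm (x - x0) < e" by linarith
qed

lemma continuous_fl:
  assumes t: "t \<in> {0..T}"
  shows "continuous_on W (\<lambda>x. fl x t)"
  unfolding continuous_on_iff
proof (intro ballI allI impI)
  fix x0 and e :: real assume x0: "x0 \<in> W" and e: "0 < e"
  obtain \<delta> C where d: "0 < \<delta>" "0 \<le> C" and n: "\<And>x t. x \<in> cball x0 \<delta> \<Longrightarrow> t \<in> {0..T} \<Longrightarrow> norm (fl x t - fl x0 t) \<le> C * norm (x - x0)"
    using fl_near[OF x0] by metis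
  obtain d1 where d1: "0 < d1" "\<And>x. dist x x0 < d1 \<Longrightarrow> C * norm (x - x0) < e" using near_le[OF e d(2), of x0] by blast
  show "\<exists>d>0. \<forall>x\<in>W. dist x x0 < d \<longrightarrow> dist (fl x t) (fl x0 t) < e"
  proof (rule exI[of _ "min \<delta> d1"], intro conjI ballI impI)
    fix x assume "dist x x0 < min \<delta> d1"
    then show "dist (fl x t) (fl x0 t) < e" using n[of x t] d1(2)[of x] t by (simp add: dist_norm norm_minus_commute[of x0])
  qed (use d d1 in auto)
qed

text \<open>The tolerance of the adjoint curve under a change of trajectory is turned into a radius
  for initial points by the Lipschitz dependence of the flow.\<close>

lemma continuous_costate:
  assumes t: "t \<in> {0..T}"
  shows "continuous_on W (\<lambda>x. costate x p t)"
  unfolding continuous_on_iff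
proof (intro ballI allI impI)
  fix x0 and e :: real assume x0: "x0 \<in> W" and e: "0 < e"
  obtain V r L B where "reference M U f T V (fl x0) r L B u0" by (rule reference_fl[OF x0])
  then interpret reference M U f T V "fl x0" r L B u0 .
  obtain c where c: "0 < c" and cl: "\<And>q l t. (\<forall>s\<in>{0..T}. norm (q s - fl x0 s) \<le> c) \<Longrightarrow> adjoint_curve f u0 T q p l \<Longrightarrow> t \<in> {0..T} \<Longrightarrow>
     norm (l t - costate x0 p t) \<le> e / 2"
    using adjoint_stable[OF half_gt_zero[OF e] costate[OF x0]] by blast
  obtain \<delta> C where d: "0 < \<delta>" "0 \<le> C" and n: "\<And>x t. x \<in> cball x0 \<delta> \<Longrightarrow> t \<in> {0..T} \<Longrightarrow> norm (fl x t - fl x0 t) \<le> C * norm (x - x0)"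
    using fl_near[OF x0] by metis
  obtain d1 where d1: "0 < d1" "\<And>x. dist x x0 < d1 \<Longrightarrow> C * norm (x - x0) < c" using near_le[OF c d(2), of x0] by blast
  show "\<exists>d>0. \<forall>x\<in>W. dist x x0 < d \<longrightarrow> dist (costate x p t) (costate x0 p t) < e"
  proof (rule exI[of _ "min \<delta> d1"], intro conjI ballI impI)
    fix x assume x: "x \<in> W" and dx: "dist x x0 < min \<delta> d1"
    have "\<forall>s\<in>{0..T}. norm (fl x s - fl x0 s) \<le> c"
      using n[of x] d1(2)[of x] dx by (force simp: dist_commute)
    from cl[OF this costate[OF x] t] show "dist (costate x p t) (costate x0 p t) < e" using e by (simp add: dist_norm)
  qed (use d d1 in auto)
qed

end

section \<open>Convexity and a Brouwer argument\<close>

text \<open>For \<open>z\<close> near \<open>a\<close>, solving \<open>F y = z\<close> means finding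
  a fixed point of \<open>z - a - (F y - a - y)\<close>. Both parts have norm at most
  \<open>r / 2\<close>, so Brouwer's theorem applies on \<open>cball 0 r\<close>.\<close>

lemma interior_perturbed_identity:
  fixes F :: "'a::euclidean_space \<Rightarrow> 'a"
  assumes r: "0 < r" and F: "continuous_on (cball 0 r) F"
    and le: "\<And>y. y \<in> cball 0 r \<Longrightarrow> norm (F y - a - y) \<le> norm y / 2"
  shows "a \<in> interior (F ` cball 0 r)"
proof -
  have "ball a (r / 2) \<subseteq> F ` cball 0 r"
  proof
    fix z assume z: "z \<in> ball a (r / 2)"
    define h where "h = (\<lambda>y. z - a - (F y - a - y))"
    have "h \<in> cball 0 r \<rightarrow> cball 0 r"
    proof
      fix y :: 'a assume y: "y \<in> cball 0 r"
      have "norm (h y) \<le> norm (z - a) + norm (F y - a - y)" unfolding h_def by (rule norm_triangle_ineq4)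
      also have "\<dots> \<le> r / 2 + r / 2" using z le[OF y] y by (intro add_mono) (auto simp: dist_norm norm_minus_commute)
      finally show "h y \<in> cball 0 r" by simp
    qed
    moreover have "continuous_on (cball 0 r) h" unfolding h_def by (intro continuous_intros F)
    ultimately obtain y where y: "y \<in> cball 0 r" "h y = y" using brouwer_ball[OF r, of 0 h] by blast
    then have "F y = z" by (simp add: h_def algebra_simps)
    then show "z \<in> F ` cball 0 r" using y by blast
  qed
  then show ?thesis using r by (meson centre_in_ball half_gt_zero interiorI open_ball)
qed

text \<open>A hull without interior lies in a hyperplane, and one of the two normals has the right
  sign. Otherwise a hyperplane separates \<open>0\<close> from the interior, and the inequality
  extends to its closure, which contains the hull.\<close>

lemma nonpos_functional_if_not_interior:
  fixes S :: "'a::euclidean_space set"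
  assumes "0 \<notin> interior (convex hull S)"
  obtains p where "p \<noteq> 0" "\<And>w. w \<in> S \<Longrightarrow> p \<bullet> w \<le> 0"
proof (cases "interior (convex hull S) = {}")
  case True
  then obtain a b where ab: "a \<noteq> 0" "convex hull S \<subseteq> {x. a \<bullet> x = b}"
    using empty_interior_subset_hyperplane[OF convex_convex_hull] by blast
  then have "\<And>w. w \<in> S \<Longrightarrow> a \<bullet> w = b" using hull_subset[of S convex] by blast
  then show ?thesis using that[of a] that[of "- a"] ab(1) by (cases "b \<le> 0") auto
next
  case False
  have "\<exists>a b. a \<noteq> 0 \<and> (\<forall>x\<in>{0}. a \<bullet> x \<le> b) \<and> (\<forall>x\<in>interior (convex hull S). b \<le> a \<bullet> x)"
    by (rule separating_hyperplane_sets) (use False assms in \<open>auto intro: convex_interior\<close>)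
  then obtain a b where a: "a \<noteq> 0" "0 \<le> b" and le: "\<And>x. x \<in> interior (convex hull S) \<Longrightarrow> b \<le> a \<bullet> x" by auto
  have "closed {x. 0 \<le> a \<bullet> x}" by (rule closed_halfspace_ge)
  moreover have "interior (convex hull S) \<subseteq> {x. 0 \<le> a \<bullet> x}" using le a(2) by force
  ultimately have "closure (interior (convex hull S)) \<subseteq> {x. 0 \<le> a \<bullet> x}" by (simp add: closure_minimal)
  then have "convex hull S \<subseteq> {x. 0 \<le> a \<bullet> x}"
    using convex_closure_interior[OF convex_convex_hull False] closure_subset[of "convex hull S"] by auto
  then have "\<And>w. w \<in> S \<Longrightarrow> 0 \<le> a \<bullet> w" using hull_subset[of S convex] by blast
  then show ?thesis using that[of "- a"] a(1) by simp
qed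

text \<open>Plus and minus the basis vectors, scaled by \<open>s\<close>, lie in the hull and are
  finite convex combinations; the positive and negative parts of the coordinates of \<open>y\<close>
  then serve as weights. Nonnegativity is demanded because the coefficients become needle lengths,
  continuity because of Brouwer's theorem, linear growth to control the total error.\<close>

lemma continuous_positive_representation:
  fixes S :: "'a::euclidean_space set"
  assumes "0 \<in> interior (convex hull S)"
  obtains I K and c :: "'a \<Rightarrow> 'a \<Rightarrow> real" where "finite I" "I \<subseteq> S" "0 \<le> K"
    "\<And>w. continuous_on UNIV (c w)" "\<And>w y. 0 \<le> c w y" "\<And>w y. w \<in> I \<Longrightarrow> c w y \<le> K * norm y"
    "\<And>y. (\<Sum>w\<in>I. c w y *\<^sub>R w) = y"
proof -
  obtain s where s: "0 < s" "cball 0 s \<subseteq> convex hull S" using assms by (auto simp: mem_interior_cball)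
  define B where "B = Basis \<union> uminus ` (Basis :: 'a set)"
  have "\<forall>v\<in>B. \<exists>\<alpha>. finite {w. \<alpha> w \<noteq> 0} \<and> {w. \<alpha> w \<noteq> 0} \<subseteq> S \<and> (\<forall>w. 0 \<le> \<alpha> w) \<and> (\<Sum>w\<in>{w. \<alpha> w \<noteq> 0}. \<alpha> w *\<^sub>R w) = s *\<^sub>R v"
  proof
    fix v assume "v \<in> B"
    then have "norm v = 1" by (auto simp: B_def)
    then have "s *\<^sub>R v \<in> convex hull S" using s by (intro set_mp[OF s(2)]) auto
    then obtain R u where R: "finite R" "R \<subseteq> S" "\<forall>x\<in>R. 0 \<le> u x" "(\<Sum>w\<in>R. u w *\<^sub>R w) = s *\<^sub>R v"
      unfolding convex_hull_explicit by auto
    define \<alpha> where "\<alpha> = (\<lambda>w. if w \<in> R then u w else 0)"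
    have sub: "{w. \<alpha> w \<noteq> 0} \<subseteq> R" by (auto simp: \<alpha>_def)
    have "(\<Sum>w\<in>{w. \<alpha> w \<noteq> 0}. \<alpha> w *\<^sub>R w) = (\<Sum>w\<in>R. \<alpha> w *\<^sub>R w)"
      by (rule sum.mono_neutral_left[OF R(1) sub]) auto
    also have "\<dots> = s *\<^sub>R v" unfolding R(4)[symmetric] by (rule sum.cong) (auto simp: \<alpha>_def)
    finally have "(\<Sum>w\<in>{w. \<alpha> w \<noteq> 0}. \<alpha> w *\<^sub>R w) = s *\<^sub>R v" .
    moreover have "finite {w. \<alpha> w \<noteq> 0}" using finite_subset[OF sub R(1)] .
    moreover have "{w. \<alpha> w \<noteq> 0} \<subseteq> S" using sub R(2) by blast
    moreover have "\<forall>w. 0 \<le> \<alpha> w" using R(3) by (simp add: \<alpha>_def)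
    ultimately show "\<exists>\<alpha>. finite {w. \<alpha> w \<noteq> 0} \<and> {w. \<alpha> w \<noteq> 0} \<subseteq> S \<and> (\<forall>w. 0 \<le> \<alpha> w) \<and> (\<Sum>w\<in>{w. \<alpha> w \<noteq> 0}. \<alpha> w *\<^sub>R w) = s *\<^sub>R v"
      by blast
  qed
  from bchoice[OF this] obtain \<alpha> where \<alpha>: "\<forall>v\<in>B. finite {w. \<alpha> v w \<noteq> 0} \<and> {w. \<alpha> v w \<noteq> 0} \<subseteq> S \<and> (\<forall>w. 0 \<le> \<alpha> v w) \<and>
    (\<Sum>w\<in>{w. \<alpha> v w \<noteq> 0}. \<alpha> v w *\<^sub>R w) = s *\<^sub>R v" ..
  define R where "R = (\<lambda>v. {w. \<alpha> v w \<noteq> 0})"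
  have R: "finite (R v)" "R v \<subseteq> S" "0 \<le> \<alpha> v w" "w \<notin> R v \<Longrightarrow> \<alpha> v w = 0" "(\<Sum>w\<in>R v. \<alpha> v w *\<^sub>R w) = s *\<^sub>R v"
    if "v \<in> B" for v w
    using \<alpha>[rule_format, OF that] by (simp_all add: R_def)
  have finB: "finite B" by (simp add: B_def)
  have bB: "b \<in> B" "- b \<in> B" if "b \<in> Basis" for b using that by (auto simp: B_def)
  define I where "I = (\<Union>v\<in>B. R v)"
  have I: "finite I" "I \<subseteq> S" using R(1,2) finB by (auto simp: I_def)
  have sumI: "(\<Sum>w\<in>I. \<alpha> v w *\<^sub>R w) = s *\<^sub>R v" if "v \<in> B" for v
  proof -
    have "(\<Sum>w\<in>I. \<alpha> v w *\<^sub>R w) = (\<Sum>w\<in>R v. \<alpha> v w *\<^sub>R w)"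
      by (rule sum.mono_neutral_right[OF I(1)]) (use that R(4) in \<open>auto simp: I_def\<close>)
    then show ?thesis using R(5)[OF that] by simp
  qed
  define c where "c = (\<lambda>w y. (\<Sum>b\<in>Basis. max (y \<bullet> b) 0 * (\<alpha> b w / s) + max (- (y \<bullet> b)) 0 * (\<alpha> (- b) w / s)))"
  define k where "k = (\<lambda>w. \<Sum>b\<in>Basis. \<alpha> b w / s + \<alpha> (- b) w / s)"
  have k0: "0 \<le> k w" for w
    unfolding k_def using R(3) bB s(1) by (intro sum_nonneg add_nonneg_nonneg divide_nonneg_pos) auto
  define K where "K = (\<Sum>w\<in>I. k w)"
  show ?thesis
  proof (rule that[OF I, of K c])
    show "0 \<le> K" unfolding K_def by (intro sum_nonneg k0)
    show "continuous_on UNIV (c w)" for w unfolding c_def by (intro continuous_intros)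
    show "0 \<le> c w y" for w y
      unfolding c_def using R(3) bB s(1) by (intro sum_nonneg add_nonneg_nonneg mult_nonneg_nonneg divide_nonneg_pos) auto
    show "c w y \<le> K * norm y" if "w \<in> I" for w y
    proof -
      have "c w y \<le> (\<Sum>b\<in>Basis. norm y * (\<alpha> b w / s) + norm y * (\<alpha> (- b) w / s))"
        unfolding c_def
      proof (intro sum_mono add_mono mult_right_mono)
        fix b :: 'a assume b: "b \<in> Basis"
        show "max (y \<bullet> b) 0 \<le> norm y" "max (- (y \<bullet> b)) 0 \<le> norm y" using Basis_le_norm[OF b, of y] by auto
        show "0 \<le> \<alpha> b w / s" "0 \<le> \<alpha> (- b) w / s" using R(3) bB[OF b] s(1) by auto
      qed
      also have "\<dots> = k w * norm y" by (simp add: k_def sum_distrib_left distrib_left mult.commute)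
      also have "\<dots> \<le> K * norm y"
        unfolding K_def by (intro mult_right_mono member_le_sum[OF that] k0 I(1)) auto
      finally show ?thesis .
    qed
    show "(\<Sum>w\<in>I. c w y *\<^sub>R w) = y" for y
    proof -
      have "(\<Sum>w\<in>I. c w y *\<^sub>R w) = (\<Sum>b\<in>Basis. \<Sum>w\<in>I. (max (y \<bullet> b) 0 / s) *\<^sub>R (\<alpha> b w *\<^sub>R w) + (max (- (y \<bullet> b)) 0 / s) *\<^sub>R (\<alpha> (- b) w *\<^sub>R w))"
        unfolding c_def by (subst sum.swap) (simp add: scaleR_sum_left scaleR_add_left)
      also have "\<dots> = (\<Sum>b\<in>Basis. (max (y \<bullet> b) 0 / s) *\<^sub>R (s *\<^sub>R b) + (max (- (y \<bullet> b)) 0 / s) *\<^sub>R (s *\<^sub>R (- b)))"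
        by (rule sum.cong) (simp_all only: sum.distrib scaleR_sum_right[symmetric] sumI bB)
      also have "\<dots> = (\<Sum>b\<in>Basis. (y \<bullet> b) *\<^sub>R b)"
      proof (rule sum.cong)
        fix b :: 'a
        have "(max (y \<bullet> b) 0 / s) *\<^sub>R (s *\<^sub>R b) + (max (- (y \<bullet> b)) 0 / s) *\<^sub>R (s *\<^sub>R (- b)) = (max (y \<bullet> b) 0 - max (- (y \<bullet> b)) 0) *\<^sub>R b"
          using s(1) by (simp add: scaleR_diff_left)
        also have "max (y \<bullet> b) 0 - max (- (y \<bullet> b)) 0 = y \<bullet> b" by (simp add: max_def)
        finally show "(max (y \<bullet> b) 0 / s) *\<^sub>R (s *\<^sub>R b) + (max (- (y \<bullet> b)) 0 / s) *\<^sub>R (s *\<^sub>R (- b)) = (y \<bullet> b) *\<^sub>R b" .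
      qed simp
      finally show ?thesis by (simp add: euclidean_representation)
    qed
  qed
qed

text \<open>By Lindelof's theorem countably many of the null pieces already cover
  \<open>A\<close>.\<close>

lemma locally_null_imp_null:
  fixes N :: "'a::euclidean_space measure"
  assumes sets: "sets N = sets borel" and A: "A \<in> sets borel"
    and null: "\<And>y. y \<in> A \<Longrightarrow> \<exists>r>0. emeasure N (A \<inter> ball y r) = 0"
  shows "emeasure N A = 0"
proof -
  obtain r where r: "\<And>y. y \<in> A \<Longrightarrow> 0 < r y" "\<And>y. y \<in> A \<Longrightarrow> emeasure N (A \<inter> ball y (r y)) = 0" using null by metis
  obtain F' where F': "F' \<subseteq> (\<lambda>y. ball y (r y)) ` A" "countable F'" "\<Union>F' = \<Union>((\<lambda>y. ball y (r y)) ` A)"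
    by (rule Lindelof[of "(\<lambda>y. ball y (r y)) ` A"]) auto
  have "A \<subseteq> \<Union>F'" using F'(3) r(1) by force
  then have eq: "A = (\<Union>X\<in>F'. A \<inter> X)" by blast
  have "(\<Union>X\<in>F'. A \<inter> X) \<in> null_sets N"
  proof (rule null_sets_UN'[OF F'(2)])
    fix X assume "X \<in> F'"
    then obtain y where "y \<in> A" "X = ball y (r y)" using F'(1) by blast
    then show "A \<inter> X \<in> null_sets N" using r(2)[of y] A sets by (auto simp: null_sets_def)
  qed
  then show ?thesis using eq by (auto simp: null_sets_def)
qed

text \<open>Greedily: pick a support point of one set and cut out a ball so small that it leaves mass in all the others.\<close>

lemma disjoint_pieces:
  fixes N :: "'a::euclidean_space measure"
  assumes sets: "sets N = sets borel" and fin: "finite_measure N" and atom: "\<And>y. emeasure N {y} = 0"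
    and I: "finite I" and A: "\<And>i. i \<in> I \<Longrightarrow> A i \<in> sets borel" "\<And>i. i \<in> I \<Longrightarrow> 0 < emeasure N (A i)"
  shows "\<exists>K. (\<forall>i\<in>I. K i \<in> sets borel \<and> K i \<subseteq> A i \<and> 0 < emeasure N (K i)) \<and> disjoint_family_on K I"
  using I A
proof (induction I arbitrary: A)
  case empty
  then show ?case by (auto simp: disjoint_family_on_def)
next
  case (insert i I)
  interpret finite_measure N by (rule fin)
  have "\<not> (\<forall>y\<in>A i. \<exists>r>0. emeasure N (A i \<inter> ball y r) = 0)"
  proof
    assume "\<forall>y\<in>A i. \<exists>r>0. emeasure N (A i \<inter> ball y r) = 0"
    then have "emeasure N (A i) = 0"
      by (intro locally_null_imp_null[OF sets insert.prems(1)[of i]]) auto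
    then show False using insert.prems(2)[of i] by simp
  qed
  \<comment> \<open>A point around which \<open>A i\<close> has mass at every scale exists, for
    otherwise \<open>A i\<close> would be locally null.\<close>
  then obtain y where y: "\<And>r. 0 < r \<Longrightarrow> 0 < emeasure N (A i \<inter> ball y r)" by (auto simp: zero_less_iff_neq_zero)
  \<comment> \<open>The absence of atoms enters here: the mass of the shrinking balls tends to the
    mass of their centre.\<close>
  have lim: "(\<lambda>n. measure N (cball y (1 / Suc n))) \<longlonglongrightarrow> 0"
  proof -
    have "(\<lambda>n. measure N (cball y (1 / Suc n))) \<longlonglongrightarrow> measure N (\<Inter>n. cball y (1 / Suc n))"
    proof (rule finite_Lim_measure_decseq)
      show "range (\<lambda>n. cball y (1 / real (Suc n))) \<subseteq> Sigma_Algebra.sets N" unfolding sets by auto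
      show "decseq (\<lambda>n. cball y (1 / real (Suc n)))"
        unfolding decseq_def by (intro allI impI subset_cball frac_le) auto
    qed
    also have "(\<Inter>n. cball y (1 / real (Suc n))) = {y}"
    proof safe
      fix z assume z: "z \<in> (\<Inter>n. cball y (1 / real (Suc n)))"
      show "z = y"
      proof (rule ccontr)
        assume "z \<noteq> y"
        then obtain n where "inverse (real (Suc n)) < dist y z" using reals_Archimedean[of "dist y z"] by auto
        moreover have "dist y z \<le> 1 / real (Suc n)" using z by (simp del: of_nat_Suc)
        ultimately show False by (simp add: inverse_eq_divide del: of_nat_Suc)
      qed
    qed auto
    also have "measure N {y} = 0" using atom by (simp add: measure_def)
    finally show ?thesis .
  qed
  have mpos: "0 < measure N (A j)" if "j \<in> I" for j
    using insert.prems(2)[of j] that by (simp add: emeasure_eq_measure)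
  have "\<forall>\<^sub>F n in sequentially. \<forall>j\<in>I. measure N (cball y (1 / Suc n)) < measure N (A j)"
    using order_tendstoD(2)[OF lim mpos] by (simp add: eventually_ball_finite_distrib[OF insert.hyps(1)])
  then obtain n where n: "\<And>j. j \<in> I \<Longrightarrow> measure N (cball y (1 / Suc n)) < measure N (A j)"
    by (auto simp: eventually_sequentially)
  define b where "b = ball y (1 / real (Suc n))"
  have b: "b \<in> sets borel" by (simp add: b_def)
  have bN: "measure N b \<le> measure N (cball y (1 / Suc n))" unfolding b_def by (rule finite_measure_mono) (use sets in auto)
  have "\<exists>K. (\<forall>j\<in>I. K j \<in> sets borel \<and> K j \<subseteq> A j - b \<and> 0 < emeasure N (K j)) \<and> disjoint_family_on K I"
  proof (rule insert.IH)
    fix j assume j: "j \<in> I"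
    show "A j - b \<in> sets borel" using insert.prems(1)[of j] j b by auto
    have "measure N (A j) \<le> measure N ((A j - b) \<union> b)" by (rule finite_measure_mono) (use insert.prems(1)[of j] j b sets in auto)
    also have "\<dots> \<le> measure N (A j - b) + measure N b"
      by (rule measure_Un_le) (use insert.prems(1)[of j] j b sets in auto)
    finally have "0 < measure N (A j - b)" using n[OF j] bN by linarith
    then show "0 < emeasure N (A j - b)" by (simp add: emeasure_eq_measure)
  qed
  then obtain K where K: "\<And>j. j \<in> I \<Longrightarrow> K j \<in> sets borel \<and> K j \<subseteq> A j - b \<and> 0 < emeasure N (K j)" "disjoint_family_on K I" by blast
  define K' where "K' = (\<lambda>j. if j = i then A i \<inter> b else K j)"
  have "K' j \<in> sets borel \<and> K' j \<subseteq> A j \<and> 0 < emeasure N (K' j)" if "j \<in> insert i I" for j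
    using that K(1)[of j] insert.prems(1)[of i] b y[of "1 / real (Suc n)"] by (auto simp: K'_def b_def)
  moreover have "disjoint_family_on K' (insert i I)"
    unfolding disjoint_family_on_def
  proof (intro ballI impI)
    fix j k assume jk: "j \<in> insert i I" "k \<in> insert i I" "j \<noteq> k"
    show "K' j \<inter> K' k = {}"
    proof (cases "j = i \<or> k = i")
      case True
      then show ?thesis using jk K(1)[of j] K(1)[of k] insert.hyps(2) by (auto simp: K'_def)
    next
      case False
      then have "K j \<inter> K k = {}" using jk K(2) unfolding disjoint_family_on_def by blast
      then show ?thesis using False by (simp add: K'_def)
    qed
  qed
  ultimately show ?case by blast
qed

section \<open>Random initial points\<close>

locale random_flow = flow M U f T u0 + prob_space P
  for M :: "'a::euclidean_space set" and U :: "(real ^ 'n) set" and f :: "real ^ 'n \<Rightarrow> 'a \<Rightarrow> 'a"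
    and T :: real and u0 :: "real \<Rightarrow> real ^ 'n" and P :: "'w measure" +
  fixes q0 :: "'w \<Rightarrow> 'a" and \<rho> :: "'a \<Rightarrow> real" and qt :: "'w \<Rightarrow> real \<Rightarrow> 'a"
  assumes \<rho>_nonneg: "\<And>x. x \<in> M \<Longrightarrow> 0 \<le> \<rho> x"
    and \<rho>: "distributed P (restrict_space lborel M) q0 (\<lambda>x. ennreal (\<rho> x))"
    and qt: "\<And>\<omega>. \<omega> \<in> space P \<Longrightarrow> trajectory M f T u0 (q0 \<omega>) (qt \<omega>)"
    and integrable_qt: "integrable P (\<lambda>\<omega>. qt \<omega> T)"
begin

text \<open>The law of \<open>q0\<close>, taken as a Borel measure on the whole space, so that balls
  need not be cut down to \<open>M\<close>.\<close>

definition N :: "'a measure" where "N = distr P borel q0"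

lemma sets_N [simp]: "sets N = sets borel" and space_N [simp]: "space N = UNIV"
  by (auto simp: N_def)

lemma open_M: "open M" using sys by (simp add: control_system_def)

lemma q0_meas: "q0 \<in> measurable P borel" and q0_M: "\<omega> \<in> space P \<Longrightarrow> q0 \<omega> \<in> M"
proof -
  have m: "q0 \<in> measurable P (restrict_space lborel M)" using \<rho> by (rule distributed_measurable)
  then have "q0 \<in> measurable P lborel" by (rule measurable_restrict_space2_iff[THEN iffD1, THEN conjunct1])
  then show "q0 \<in> measurable P borel" by simp
  show "q0 \<omega> \<in> M" if "\<omega> \<in> space P" using measurable_space[OF m that] by (simp add: space_restrict_space)
qed

lemma prob_space_N: "prob_space N" unfolding N_def by (rule prob_space_distr[OF q0_meas])

lemma q0_W: "\<omega> \<in> space P \<Longrightarrow> q0 \<omega> \<in> W" using qt by (auto simp: W_def)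

lemma qt_fl: "\<omega> \<in> space P \<Longrightarrow> t \<in> {0..T} \<Longrightarrow> qt \<omega> t = fl (q0 \<omega>) t"
  by (rule fl_unique[OF qt])

lemma integral_N:
  fixes g :: "'a \<Rightarrow> 'b::{banach, second_countable_topology}"
  assumes "g \<in> borel_measurable borel"
  shows "integrable N g \<longleftrightarrow> integrable P (\<lambda>\<omega>. g (q0 \<omega>))" "(\<integral>x. g x \<partial>N) = (\<integral>\<omega>. g (q0 \<omega>) \<partial>P)"
  using q0_meas assms unfolding N_def by (auto simp: integrable_distr_eq integral_distr)

text \<open>\<open>distributed\<close> speaks of \<open>ennreal (\<rho> x)\<close>; the sign of
  \<open>\<rho>\<close> on \<open>M\<close> allows \<open>\<rho>\<close> to be recovered by
  \<open>enn2real\<close>.\<close>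

lemma \<rho>_measurable: "\<rho> \<in> borel_measurable (restrict_space borel M)"
proof -
  have "(\<lambda>x. ennreal (\<rho> x)) \<in> borel_measurable (restrict_space lborel M)"
    using \<rho> by (rule distributed_borel_measurable)
  then have "(\<lambda>x. enn2real (ennreal (\<rho> x))) \<in> borel_measurable (restrict_space lborel M)" by measurable
  then have "\<rho> \<in> borel_measurable (restrict_space lborel M)"
    by (rule measurable_cong[THEN iffD1, rotated]) (use \<rho>_nonneg in \<open>auto simp: space_restrict_space\<close>)
  then show ?thesis by (simp cong: measurable_cong_sets add: sets_restrict_space)
qed

lemma distr_eq_density: "distr P (restrict_space lborel M) q0 = density (restrict_space lborel M) (\<lambda>x. ennreal (\<rho> x))"
  using \<rho> by (rule distributed_distr_eq_density)

lemma emeasure_N: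
  assumes "A \<in> sets borel"
  shows "emeasure N A = emeasure (density (restrict_space lborel M) (\<lambda>x. ennreal (\<rho> x))) (A \<inter> M)"
proof -
  have AM: "A \<inter> M \<in> sets (restrict_space lborel M)" using assms by (auto simp: sets_restrict_space)
  have "emeasure N A = emeasure P (q0 -` A \<inter> space P)" unfolding N_def by (rule emeasure_distr[OF q0_meas]) (use assms in auto)
  also have "q0 -` A \<inter> space P = q0 -` (A \<inter> M) \<inter> space P" using q0_M by auto
  also have "emeasure P \<dots> = emeasure (distr P (restrict_space lborel M) q0) (A \<inter> M)"
    by (rule emeasure_distr[symmetric, OF distributed_measurable[OF \<rho>] AM])
  finally show ?thesis by (simp add: distr_eq_density)
qed

lemma M_sets: "M \<in> sets borel" using open_M by simp

lemma emeasure_N_point: "emeasure N {y} = 0"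
proof -
  have "{y} \<inter> M \<in> null_sets (restrict_space lborel M)"
    using M_sets by (subst null_sets_restrict_space) (auto intro: null_sets_subset[of "{y}"] finite_imp_null_set_lborel)
  moreover have "absolutely_continuous (restrict_space lborel M) (density (restrict_space lborel M) (\<lambda>x. ennreal (\<rho> x)))"
    by (rule absolutely_continuousI_density[OF distributed_borel_measurable[OF \<rho>]])
  ultimately have "{y} \<inter> M \<in> null_sets (density (restrict_space lborel M) (\<lambda>x. ennreal (\<rho> x)))"
    unfolding absolutely_continuous_def by blast
  then show ?thesis by (simp add: emeasure_N null_sets_def)
qed

lemma W_sets: "W \<in> sets borel" using open_W by simp

text \<open>Every realization of \<open>q0\<close> starts a reference trajectory, so the law gives
  no mass to the points that start none.\<close>

lemma \<rho>_zero_off_W: "AE x in lebesgue. x \<in> M \<longrightarrow> x \<notin> W \<longrightarrow> \<rho> x = 0"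
proof -
  let ?R = "restrict_space lborel M"
  have "emeasure N (- W) = emeasure P (q0 -` (- W) \<inter> space P)"
    unfolding N_def by (rule emeasure_distr[OF q0_meas]) (use W_sets in auto)
  also have "q0 -` (- W) \<inter> space P = {}" using q0_W by auto
  finally have "emeasure (density ?R (\<lambda>x. ennreal (\<rho> x))) (- W \<inter> M) = 0"
    using emeasure_N[OF borel_comp[OF W_sets]] by simp
  moreover have s: "- W \<inter> M \<in> sets ?R" using W_sets by (auto simp: sets_restrict_space)
  ultimately have "- W \<inter> M \<in> null_sets (density ?R (\<lambda>x. ennreal (\<rho> x)))" by (simp add: null_sets_def)
  then have "AE x in ?R. x \<in> - W \<inter> M \<longrightarrow> ennreal (\<rho> x) = 0"
    using null_sets_density_iff[OF distributed_borel_measurable[OF \<rho>]] by blast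
  then have "AE x in lborel. x \<in> M \<longrightarrow> x \<in> - W \<inter> M \<longrightarrow> ennreal (\<rho> x) = 0"
    using M_sets by (subst (asm) AE_restrict_space_iff) auto
  then have "AE x in lborel. x \<in> M \<longrightarrow> x \<notin> W \<longrightarrow> \<rho> x = 0"
    by eventually_elim (use \<rho>_nonneg in \<open>auto simp: ennreal_eq_0_iff antisym\<close>)
  then show ?thesis by (rule AE_completion)
qed

text \<open>Passes from the law of \<open>q0\<close> to the density on \<open>M\<close>, and from
  Borel to completed Lebesgue measure, in which the expected attainable set is expressed.\<close>

lemma density_integral:
  fixes g :: "'a \<Rightarrow> 'a"
  assumes g: "g \<in> borel_measurable borel" and i: "integrable N g"
  shows "set_integrable lebesgue M (\<lambda>x. \<rho> x *\<^sub>R g x)" "(LINT x:M|lebesgue. \<rho> x *\<^sub>R g x) = (\<integral>x. g x \<partial>N)"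
    "(\<lambda>x. indicator M x *\<^sub>R (\<rho> x *\<^sub>R g x)) \<in> borel_measurable borel"
proof -
  let ?R = "restrict_space lborel M"
  have gR: "g \<in> borel_measurable ?R" by (rule measurable_restrict_space1) (use g in simp)
  have \<rho>R: "\<rho> \<in> borel_measurable ?R" using \<rho>_measurable by (simp cong: measurable_cong_sets add: sets_restrict_space)
  have AE: "AE x in ?R. 0 \<le> \<rho> x" by (rule AE_I2) (use \<rho>_nonneg in \<open>simp add: space_restrict_space\<close>)
  have iP: "integrable P (\<lambda>\<omega>. g (q0 \<omega>))" using i integral_N(1)[OF g] by simp
  then have "integrable (distr P ?R q0) g"
    using integrable_distr_eq[OF distributed_measurable[OF \<rho>] gR] by simp
  then have iR: "integrable ?R (\<lambda>x. \<rho> x *\<^sub>R g x)"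
    unfolding distr_eq_density using integrable_density[OF gR \<rho>R AE] by simp
  then have iL: "set_integrable lborel M (\<lambda>x. \<rho> x *\<^sub>R g x)"
    using M_sets by (subst (asm) integrable_restrict_space) (auto simp: set_integrable_def)
  then have m: "(\<lambda>x. indicator M x *\<^sub>R (\<rho> x *\<^sub>R g x)) \<in> borel_measurable lborel"
    unfolding set_integrable_def by (rule borel_measurable_integrable)
  then show "(\<lambda>x. indicator M x *\<^sub>R (\<rho> x *\<^sub>R g x)) \<in> borel_measurable borel" by simp
  show "set_integrable lebesgue M (\<lambda>x. \<rho> x *\<^sub>R g x)"
    using iL unfolding set_integrable_def by (rule integrable_completion[OF m, THEN iffD2])
  have "(LINT x:M|lebesgue. \<rho> x *\<^sub>R g x) = (LINT x:M|lborel. \<rho> x *\<^sub>R g x)"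
    unfolding set_lebesgue_integral_def by (rule integral_completion[OF m])
  also have "\<dots> = (\<integral>x. \<rho> x *\<^sub>R g x \<partial>?R)"
    using M_sets by (subst integral_restrict_space) (auto simp: set_lebesgue_integral_def)
  also have "\<dots> = (\<integral>x. g x \<partial>distr P ?R q0)"
    unfolding distr_eq_density by (rule integral_density[symmetric, OF gR \<rho>R AE])
  also have "\<dots> = (\<integral>\<omega>. g (q0 \<omega>) \<partial>P)" by (rule integral_distr[OF distributed_measurable[OF \<rho>] gR])
  also have "\<dots> = (\<integral>x. g x \<partial>N)" by (rule integral_N(2)[OF g, symmetric])
  finally show "(LINT x:M|lebesgue. \<rho> x *\<^sub>R g x) = (\<integral>x. g x \<partial>N)" .
qed

text \<open>The extension by \<open>0\<close> off the open set \<open>W\<close> makes the reference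
  endpoint a Borel function on the whole space.\<close>

definition base :: "'a \<Rightarrow> 'a" where "base x = (if x \<in> W then fl x T else 0)"

lemma base: "base \<in> borel_measurable borel" "integrable N base" "(\<integral>x. base x \<partial>N) = (\<integral>\<omega>. qt \<omega> T \<partial>P)"
proof -
  have eq: "base (q0 \<omega>) = qt \<omega> T" if "\<omega> \<in> space P" for \<omega>
    using q0_W[OF that] qt_fl[OF that, of T] T by (simp add: base_def)
  have "(\<lambda>x. indicator W x *\<^sub>R fl x T) \<in> borel_measurable borel"
    by (rule borel_measurable_continuous_on_indicator[OF W_sets continuous_fl]) (use T in simp)
  also have "(\<lambda>x. indicator W x *\<^sub>R fl x T) = base" by (auto simp: base_def)
  finally show b: "base \<in> borel_measurable borel" .
  have "integrable P (\<lambda>\<omega>. base (q0 \<omega>))" using integrable_qt by (subst Bochner_Integration.integrable_cong[OF refl eq]) auto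
  then show "integrable N base" using integral_N(1)[OF b] by simp
  show "(\<integral>x. base x \<partial>N) = (\<integral>\<omega>. qt \<omega> T \<partial>P)"
    unfolding integral_N(2)[OF b] by (rule Bochner_Integration.integral_cong[OF refl eq])
qed

text \<open>A selection must name an attainable point for every \<open>x\<close> in
  \<open>M\<close>, also where no reference trajectory exists. There it follows some given
  selection, which is why the expected attainable set has to be nonempty; the density vanishes
  almost everywhere at those points, so the mean is unaffected.\<close>

lemma modified_selection:
  assumes ne: "expected_attainable M U f \<rho> T \<noteq> {}"
    and I: "finite I" and K: "\<And>w. w \<in> I \<Longrightarrow> K w \<in> sets borel" "\<And>w. w \<in> I \<Longrightarrow> K w \<subseteq> W" "disjoint_family_on K I"
    and s: "\<And>w x. w \<in> I \<Longrightarrow> x \<in> K w \<Longrightarrow> s w x \<in> attainable M U f T x"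
    and z: "\<And>w x. w \<in> I \<Longrightarrow> x \<in> K w \<Longrightarrow> z w x = fl x T"
    and i: "\<And>w. w \<in> I \<Longrightarrow> integrable N (\<lambda>x. indicator (K w) x *\<^sub>R (s w x - z w x))"
  shows "(\<integral>\<omega>. qt \<omega> T \<partial>P) + (\<Sum>w\<in>I. \<integral>x. indicator (K w) x *\<^sub>R (s w x - z w x) \<partial>N) \<in> expected_attainable M U f \<rho> T"
proof -
  obtain a0 where a0: "\<And>x. x \<in> M \<Longrightarrow> a0 x \<in> attainable M U f T x" "set_integrable lebesgue M (\<lambda>x. \<rho> x *\<^sub>R a0 x)"
    using ne unfolding expected_attainable_def by blast
  \<comment> \<open>On \<open>K w\<close> the term \<open>z w x\<close> cancels
    \<open>base x\<close> and leaves \<open>s w x\<close>; disjointness ensures that only one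
    summand is active.\<close>
  define h where "h = (\<lambda>x. base x + (\<Sum>w\<in>I. indicator (K w) x *\<^sub>R (s w x - z w x)))"
  define a where "a = (\<lambda>x. if x \<in> W then h x else a0 x)"
  have ih: "integrable N h" unfolding h_def by (intro Bochner_Integration.integrable_add base Bochner_Integration.integrable_sum i)
  have mh: "h \<in> borel_measurable borel" 
    using borel_measurable_integrable[OF ih] measurable_cong_sets[OF sets_N refl] by blast
  have Ih: "(\<integral>x. h x \<partial>N) = (\<integral>\<omega>. qt \<omega> T \<partial>P) + (\<Sum>w\<in>I. \<integral>x. indicator (K w) x *\<^sub>R (s w x - z w x) \<partial>N)"
    unfolding h_def using base i
    by (simp add: Bochner_Integration.integral_add Bochner_Integration.integrable_sum Bochner_Integration.integral_sum)
  have att: "a x \<in> attainable M U f T x" if x: "x \<in> M" for x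
  proof (cases "x \<in> W")
    case True
    show ?thesis
    proof (cases "\<exists>w\<in>I. x \<in> K w")
      case True
      then obtain w where w: "w \<in> I" "x \<in> K w" by blast
      have "(\<Sum>v\<in>I. indicator (K v) x *\<^sub>R (s v x - z v x)) = (\<Sum>v\<in>I. if v = w then s v x - z v x else 0)"
        by (rule sum.cong) (use w K(3) in \<open>auto simp: disjoint_family_on_def indicator_def\<close>)
      also have "\<dots> = s w x - z w x" using w I by simp
      finally have "a x = s w x" using \<open>x \<in> W\<close> z[OF w] by (simp add: a_def h_def base_def)
      then show ?thesis using s[OF w] by simp
    next
      case False
      then have "(\<Sum>v\<in>I. indicator (K v) x *\<^sub>R (s v x - z v x)) = 0" by (intro sum.neutral) auto
      then have "a x = fl x T" using \<open>x \<in> W\<close> by (simp add: a_def h_def base_def)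
      then show ?thesis unfolding attainable_def using fl[OF \<open>x \<in> W\<close>] u0 by blast
    qed
  next
    case False
    then show ?thesis using a0(1)[OF x] by (simp add: a_def)
  qed
  have hL: "integrable lebesgue (\<lambda>x. indicator M x *\<^sub>R (\<rho> x *\<^sub>R h x))" and
    hI: "(LINT x|lebesgue. indicator M x *\<^sub>R (\<rho> x *\<^sub>R h x)) = (\<integral>x. h x \<partial>N)"
    using density_integral(1,2)[OF mh ih] by (auto simp: set_integrable_def set_lebesgue_integral_def)
  \<comment> \<open>Only Lebesgue measurability can be expected here, since the given selection
    \<open>a0\<close> is no better.\<close>
  have ma: "(\<lambda>x. indicator M x *\<^sub>R (\<rho> x *\<^sub>R a x)) \<in> borel_measurable lebesgue"
  proof -
    have "(\<lambda>x. if x \<in> W then indicator M x *\<^sub>R (\<rho> x *\<^sub>R h x) else indicator M x *\<^sub>R (\<rho> x *\<^sub>R a0 x)) \<in> borel_measurable lebesgue"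
      by (rule measurable_If_set)
        (use borel_measurable_integrable[OF hL] borel_measurable_integrable[OF a0(2)[unfolded set_integrable_def]] W_sets in auto)
    also have "(\<lambda>x. if x \<in> W then indicator M x *\<^sub>R (\<rho> x *\<^sub>R h x) else indicator M x *\<^sub>R (\<rho> x *\<^sub>R a0 x)) =
        (\<lambda>x. indicator M x *\<^sub>R (\<rho> x *\<^sub>R a x))" by (auto simp: a_def)
    finally show ?thesis .
  qed
  have ae: "AE x in lebesgue. indicator M x *\<^sub>R (\<rho> x *\<^sub>R h x) = indicator M x *\<^sub>R (\<rho> x *\<^sub>R a x)"
    using \<rho>_zero_off_W by eventually_elim (auto simp: a_def indicator_def)
  have ae': "AE x in lebesgue. indicator M x *\<^sub>R (\<rho> x *\<^sub>R a x) = indicator M x *\<^sub>R (\<rho> x *\<^sub>R h x)"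
    using ae by eventually_elim (rule sym)
  have "integrable lebesgue (\<lambda>x. indicator M x *\<^sub>R (\<rho> x *\<^sub>R a x))"
    by (rule Bochner_Integration.integrable_cong_AE_imp[OF hL ma ae])
  then have "set_integrable lebesgue M (\<lambda>x. \<rho> x *\<^sub>R a x)" by (simp add: set_integrable_def)
  moreover have "(LINT x:M|lebesgue. \<rho> x *\<^sub>R a x) = (\<integral>x. h x \<partial>N)"
    unfolding set_lebesgue_integral_def hI[symmetric]
    by (rule integral_cong_AE[OF ma borel_measurable_integrable[OF hL] ae'])
  ultimately show ?thesis unfolding expected_attainable_def Ih[symmetric] using att by force
qed

end

section \<open>The support of the initial law and the separating covector\<close>

context random_flow
begin

text \<open>The support of the law of \<open>q0\<close>, within \<open>W\<close>.\<close>

definition charged :: "'a set" where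
  "charged = {x \<in> W. \<forall>r>0. 0 < emeasure N (ball x r)}"

text \<open>The complement of a support is a union of null balls, hence locally null and therefore
  null.\<close>

lemma AE_charged: "AE \<omega> in P. q0 \<omega> \<in> charged"
proof -
  define Z where "Z = \<Union>{ball x r |x r. 0 < r \<and> emeasure N (ball x r) = 0}"
  have oZ: "open Z" unfolding Z_def by blast
  have "emeasure N Z = 0"
  proof (rule locally_null_imp_null)
    show "sets N = sets borel" "Z \<in> sets borel" using oZ by auto
    fix y assume "y \<in> Z"
    then obtain x r where x: "0 < r" "emeasure N (ball x r) = 0" "y \<in> ball x r" by (auto simp: Z_def)
    obtain e where e: "0 < e" "ball y e \<subseteq> ball x r" using openE[OF open_ball x(3)] by blast
    have "emeasure N (Z \<inter> ball y e) \<le> emeasure N (ball x r)" by (rule emeasure_mono) (use e in auto)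
    then show "\<exists>r>0. emeasure N (Z \<inter> ball y r) = 0" using e(1) x(2) by auto
  qed
  then have "Z \<in> null_sets N" using oZ by (simp add: null_sets_def)
  then have "AE x in N. x \<notin> Z" by (rule AE_not_in)
  then have nZ: "AE \<omega> in P. q0 \<omega> \<notin> Z"
    unfolding N_def by (rule AE_distrD[OF q0_meas])
  have ch: "x \<in> charged" if "x \<notin> Z" "x \<in> W" for x
  proof -
    have "0 < emeasure N (ball x r)" if r: "0 < r" for r
    proof (rule ccontr)
      assume "\<not> ?thesis"
      then have "ball x r \<subseteq> Z" unfolding Z_def using r by (auto simp: not_less)
      moreover have "x \<in> ball x r" using r by simp
      ultimately show False using \<open>x \<notin> Z\<close> by blast
    qed
    then show ?thesis using that by (simp add: charged_def)
  qed
  from nZ AE_space[of P] show ?thesis by eventually_elim (use ch q0_W in auto)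
qed

lemma charged_nonempty: "charged \<noteq> {}"
proof
  assume "charged = {}"
  with AE_charged have "AE \<omega> in P. False" by simp
  then show False by simp
qed

text \<open>What remains of a needle once its time, value and tube are forgotten: a set
  \<open>A\<close> of initial points to which it can be applied, a maximal length
  \<open>\<delta>\<close>, and an endpoint map \<open>s\<close> whose displacement is
  \<open>\<epsilon>\<close> times \<open>w\<close> up to the relative error
  \<open>\<eta>\<close>.\<close>

definition good_needle :: "real \<Rightarrow> 'a \<Rightarrow> 'a set \<Rightarrow> real \<Rightarrow> real \<Rightarrow> (real \<Rightarrow> 'a \<Rightarrow> 'a) \<Rightarrow> bool" where
  "good_needle \<eta> w A \<delta> C s \<longleftrightarrow> A \<in> sets borel \<and> 0 < emeasure N A \<and> 0 < \<delta> \<and> 0 \<le> C \<and>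
     (\<forall>\<epsilon>\<in>{0..\<delta>}. \<forall>x\<in>A. s \<epsilon> x \<in> attainable M U f T x) \<and>
     (\<forall>x\<in>A. x \<in> W \<and> s 0 x = fl x T) \<and>
     (\<forall>\<epsilon> \<epsilon>' x x'. 0 \<le> \<epsilon> \<longrightarrow> 0 \<le> \<epsilon>' \<longrightarrow> norm (s \<epsilon> x - s \<epsilon>' x') \<le> C * (norm (x - x') + \<bar>\<epsilon> - \<epsilon>'\<bar>)) \<and>
     (\<forall>\<epsilon>\<in>{0..\<delta>}. \<forall>x\<in>A. norm (s \<epsilon> x - s 0 x - \<epsilon> *\<^sub>R w) \<le> \<eta> * \<epsilon>)"

text \<open>The base point lies in the support, which gives the ball of usable initial points
  positive mass.\<close>

lemma good_needle_exists:
  assumes x: "x0 \<in> charged" and \<tau>: "lebesgue_point T u0 \<tau>" and u: "u \<in> U" and \<eta>: "0 < \<eta>"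
  shows "\<exists>A \<delta> C s. good_needle \<eta> (needle_vector f u0 (basis_costate x0) (fl x0) \<tau> u) A \<delta> C s"
proof -
  have xW: "x0 \<in> W" using x by (simp add: charged_def)
  let ?w = "needle_vector f u0 (basis_costate x0) (fl x0) \<tau> u"
  obtain \<delta> C s where d: "0 < \<delta>" "0 \<le> C"
    and a: "\<And>\<epsilon> x. \<epsilon> \<in> {0..\<delta>} \<Longrightarrow> x \<in> cball x0 \<delta> \<Longrightarrow> s \<epsilon> x \<in> attainable M U f T x"
    and b: "\<And>x. x \<in> cball x0 \<delta> \<Longrightarrow> \<exists>q. trajectory M f T u0 x q \<and> q T = s 0 x"
    and c: "\<And>\<epsilon> \<epsilon>' x x'. 0 \<le> \<epsilon> \<Longrightarrow> 0 \<le> \<epsilon>' \<Longrightarrow> norm (s \<epsilon> x - s \<epsilon>' x') \<le> C * (norm (x - x') + \<bar>\<epsilon> - \<epsilon>'\<bar>)"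
    and e: "\<And>\<epsilon> x. \<epsilon> \<in> {0..\<delta>} \<Longrightarrow> x \<in> cball x0 \<delta> \<Longrightarrow> norm (s \<epsilon> x - s 0 x - \<epsilon> *\<^sub>R ?w) \<le> \<eta> * \<epsilon>"
    apply (rule needle_variation[OF sys T u0 fl[OF xW] u \<tau> basis_costate[OF xW] \<eta>])
    subgoal premises prems for \<delta> C S by (rule prems(1)[of \<delta> C S]; use prems(2-) in blast)
    done
  have "0 < emeasure N (ball x0 \<delta>)" using x d(1) by (simp add: charged_def)
  also have "\<dots> \<le> emeasure N (cball x0 \<delta>)" by (rule emeasure_mono) auto
  finally have pos: "0 < emeasure N (cball x0 \<delta>)" .
  have "x \<in> W \<and> s 0 x = fl x T" if x: "x \<in> cball x0 \<delta>" for x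
  proof -
    obtain q where q: "trajectory M f T u0 x q" "q T = s 0 x" using b[OF x] by blast
    have "x \<in> W" using q(1) by (auto simp: W_def)
    moreover have "q T = fl x T" by (rule fl_unique[OF q(1)]) (use T in simp)
    ultimately show ?thesis using q(2) by simp
  qed
  moreover have "cball x0 \<delta> \<in> sets borel" by simp
  ultimately have "good_needle \<eta> ?w (cball x0 \<delta>) \<delta> C s"
    unfolding good_needle_def using d pos a c e by blast
  then show ?thesis by blast
qed

lemma integral_on_piece:
  fixes h :: "'a \<Rightarrow> 'a"
  assumes K: "K \<in> sets borel" and h: "h \<in> borel_measurable borel" and c: "\<And>x. x \<in> K \<Longrightarrow> norm (h x) \<le> c"
  shows "integrable N (\<lambda>x. indicator K x *\<^sub>R h x)"
    and "norm (\<integral>x. indicator K x *\<^sub>R h x \<partial>N) \<le> c * measure N K"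
proof -
  interpret N: prob_space N by (rule prob_space_N)
  have iK: "integrable N (\<lambda>x. c * indicator K x)"
    using K by (intro integrable_mult_right integrable_real_indicator) (auto simp: N.emeasure_eq_measure)
  have le: "norm (indicator K x *\<^sub>R h x) \<le> c * indicator K x" for x using c[of x] by (auto simp: indicator_def)
  have m: "(\<lambda>x. indicator K x *\<^sub>R h x) \<in> borel_measurable N"
    using h K by (intro borel_measurable_scaleR borel_measurable_indicator) (auto cong: measurable_cong_sets)
  show i: "integrable N (\<lambda>x. indicator K x *\<^sub>R h x)"
    by (rule Bochner_Integration.integrable_bound[OF iK m]) (use le order_trans[OF norm_ge_zero le] in auto)
  have "norm (\<integral>x. indicator K x *\<^sub>R h x \<partial>N) \<le> (\<integral>x. norm (indicator K x *\<^sub>R h x) \<partial>N)" by (rule integral_norm_bound)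
  also have "\<dots> \<le> (\<integral>x. c * indicator K x \<partial>N)" by (rule integral_mono[OF integrable_norm[OF i] iK le])
  also have "\<dots> = c * measure N K" using K by simp
  finally show "norm (\<integral>x. indicator K x *\<^sub>R h x \<partial>N) \<le> c * measure N K" .
qed

lemma covector_exists:
  assumes fr: "(\<integral>\<omega>. qt \<omega> T \<partial>P) \<in> frontier (expected_attainable M U f \<rho> T)"
  obtains p where "p \<noteq> 0" "\<And>x \<tau> u. x \<in> charged \<Longrightarrow> lebesgue_point T u0 \<tau> \<Longrightarrow> u \<in> U \<Longrightarrow>
     costate x p \<tau> \<bullet> (f u (fl x \<tau>) - f (u0 \<tau>) (fl x \<tau>)) \<le> 0"
proof -
  interpret N: prob_space N by (rule prob_space_N)
  let ?A = "expected_attainable M U f \<rho> T" and ?E = "\<integral>\<omega>. qt \<omega> T \<partial>P"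
  \<comment> \<open>The needles at all support points are taken together, because one and the same
    \<open>p\<close> has to be the end value of all costates.\<close>
  define S where "S = {needle_vector f u0 (basis_costate x) (fl x) \<tau> u |x \<tau> u. x \<in> charged \<and> lebesgue_point T u0 \<tau> \<and> u \<in> U}"
  have "0 \<notin> interior (convex hull S)"
  proof
    assume "0 \<in> interior (convex hull S)"
    then obtain I K and c :: "'a \<Rightarrow> 'a \<Rightarrow> real" where I: "finite I" "I \<subseteq> S" and K: "0 \<le> K"
      and cc: "\<And>w. continuous_on UNIV (c w)" and c0: "\<And>w y. 0 \<le> c w y" and cK: "\<And>w y. w \<in> I \<Longrightarrow> c w y \<le> K * norm y"
      and cs: "\<And>y. (\<Sum>w\<in>I. c w y *\<^sub>R w) = y"
      apply (rule continuous_positive_representation)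
      subgoal premises prems for I K c by (rule prems(1)[of I K c]; use prems(2-) in blast)
      done
    \<comment> \<open>Each needle contributes an error of at most
      \<open>\<eta> * K * norm y\<close>; for \<open>card I\<close> needles this must stay below
      \<open>norm y / 2\<close>, as \<open>interior_perturbed_identity\<close> requires.\<close>
    define \<eta> where "\<eta> = 1 / (2 * (K * card I + 1))"
    have Kc: "0 \<le> K * card I" using K by simp
    have \<eta>: "0 < \<eta>" using Kc by (auto simp: \<eta>_def)
    have \<eta>_le: "\<eta> * (K * card I) \<le> 1 / 2" using Kc by (simp add: \<eta>_def field_simps)
    have "\<forall>w\<in>I. \<exists>A \<delta> C s. good_needle \<eta> w A \<delta> C s"
      using I(2) good_needle_exists[OF _ _ _ \<eta>] unfolding S_def by blast
    then obtain A \<delta> C s where g: "\<And>w. w \<in> I \<Longrightarrow> good_needle \<eta> w (A w) (\<delta> w) (C w) (s w)" by metis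
    note g' = g[unfolded good_needle_def]
    obtain Kp where "(\<forall>w\<in>I. Kp w \<in> sets borel \<and> Kp w \<subseteq> A w \<and> 0 < emeasure N (Kp w)) \<and> disjoint_family_on Kp I"
      using disjoint_pieces[OF sets_N N.finite_measure_axioms emeasure_N_point I(1), of A] g' by blast
    then have Kp: "\<And>w. w \<in> I \<Longrightarrow> Kp w \<in> sets borel" "\<And>w x. w \<in> I \<Longrightarrow> x \<in> Kp w \<Longrightarrow> x \<in> A w"
        "\<And>w. w \<in> I \<Longrightarrow> 0 < emeasure N (Kp w)" "disjoint_family_on Kp I" by blast+
    define m where "m = (\<lambda>w. measure N (Kp w))"
    have m: "0 < m w" if "w \<in> I" for w using Kp(3)[OF that] by (simp add: m_def N.emeasure_eq_measure)
    have m1: "m w \<le> 1" for w by (simp add: m_def)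
    \<comment> \<open>For \<open>y\<close> in \<open>cball 0 r\<close> each needle length
      \<open>c w y / m w\<close> stays within \<open>\<delta> w\<close>. Dividing by the mass makes
      the first-order displacement of the mean exactly \<open>c w y\<close> times
      \<open>w\<close>.\<close>
    define r where "r = Min (insert 1 ((\<lambda>w. \<delta> w * m w / (K + 1)) ` I))"
    have r: "0 < r" unfolding r_def using I(1) m g' K by (subst Min_gr_iff) (auto intro!: divide_pos_pos mult_pos_pos)
    have r_le: "r \<le> \<delta> w * m w / (K + 1)" if "w \<in> I" for w
      unfolding r_def using I(1) that by (intro Min.coboundedI) auto
    have small: "c w y / m w \<in> {0..\<delta> w}" if w: "w \<in> I" and y: "y \<in> cball 0 r" for w y
    proof -
      have "c w y \<le> K * r" using cK[OF w, of y] y K by (auto intro: order_trans mult_left_mono)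
      also have "\<dots> \<le> (K + 1) * r" using r by (simp add: algebra_simps)
      also have "\<dots> \<le> (K + 1) * (\<delta> w * m w / (K + 1))" using r_le[OF w] K by (intro mult_left_mono) auto
      also have "\<dots> = \<delta> w * m w" using K by simp
      finally show ?thesis using m[OF w] c0[of w y] by (simp add: pos_divide_le_eq)
    qed
    \<comment> \<open>Lipschitz continuity in the initial point, from the bound in
      \<open>good_needle\<close> with equal lengths, gives Borel measurability.\<close>
    have sm: "s w e \<in> borel_measurable borel" if w: "w \<in> I" and e: "0 \<le> e" for w e
    proof (rule borel_measurable_continuous_onI, rule lipschitz_on_continuous_on, rule lipschitz_onI)
      show "dist (s w e x) (s w e y) \<le> C w * dist x y" for x y
        using g'[OF w] e by (auto simp: dist_norm) (metis abs_zero add.right_neutral diff_self)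
      show "0 \<le> C w" using g'[OF w] by blast
    qed
    \<comment> \<open>The displacement of the mean endpoint caused by needle \<open>w\<close> of
      length \<open>e\<close>, applied to the initial points in \<open>Kp w\<close> only.\<close>
    define G where "G = (\<lambda>w e. \<integral>x. indicator (Kp w) x *\<^sub>R (s w e x - s w 0 x) \<partial>N)"
    have ii: "integrable N (\<lambda>x. indicator (Kp w) x *\<^sub>R (s w e x - s w e' x))"
      and ib: "norm (\<integral>x. indicator (Kp w) x *\<^sub>R (s w e x - s w e' x) \<partial>N) \<le> C w * \<bar>e - e'\<bar>"
      if w: "w \<in> I" and e: "0 \<le> e" "0 \<le> e'" for w e e'
    proof -
      have b: "norm (s w e x - s w e' x) \<le> C w * \<bar>e - e'\<bar>" for x
        using g'[OF w] e by (metis add_0 diff_self norm_zero)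
      have mm: "(\<lambda>x. s w e x - s w e' x) \<in> borel_measurable borel"
        using sm[OF w e(1)] sm[OF w e(2)] by (rule borel_measurable_diff)
      show "integrable N (\<lambda>x. indicator (Kp w) x *\<^sub>R (s w e x - s w e' x))" by (rule integral_on_piece(1)[OF Kp(1)[OF w] mm b])
      have "norm (\<integral>x. indicator (Kp w) x *\<^sub>R (s w e x - s w e' x) \<partial>N) \<le> (C w * \<bar>e - e'\<bar>) * m w"
        unfolding m_def by (rule integral_on_piece(2)[OF Kp(1)[OF w] mm b])
      also have "\<dots> \<le> C w * \<bar>e - e'\<bar>"
        using m1[of w] g'[OF w] mult_left_mono[of "m w" 1 "C w * \<bar>e - e'\<bar>"] by simp
      finally show "norm (\<integral>x. indicator (Kp w) x *\<^sub>R (s w e x - s w e' x) \<partial>N) \<le> C w * \<bar>e - e'\<bar>" .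
    qed
    have Gc: "continuous_on {0..} (G w)" if w: "w \<in> I" for w
    proof (rule lipschitz_on_continuous_on, rule lipschitz_onI)
      fix e e' :: real assume e: "e \<in> {0..}" "e' \<in> {0..}"
      have "G w e - G w e' = (\<integral>x. indicator (Kp w) x *\<^sub>R (s w e x - s w 0 x) - indicator (Kp w) x *\<^sub>R (s w e' x - s w 0 x) \<partial>N)"
        unfolding G_def by (rule Bochner_Integration.integral_diff[symmetric]) (use ii w e in auto)
      also have "\<dots> = (\<integral>x. indicator (Kp w) x *\<^sub>R (s w e x - s w e' x) \<partial>N)"
        by (simp add: scaleR_diff_right[symmetric])
      finally show "dist (G w e) (G w e') \<le> C w * dist e e'"
        using ib[OF w, of e e'] e by (simp add: dist_norm)
    qed (use g'[OF w] in blast)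
    have Gd: "norm (G w e - (e * m w) *\<^sub>R w) \<le> \<eta> * (e * m w)" if w: "w \<in> I" and e: "e \<in> {0..\<delta> w}" for w e
    proof -
      have b: "norm (s w e x - s w 0 x - e *\<^sub>R w) \<le> \<eta> * e" if "x \<in> Kp w" for x
        using g'[OF w] e Kp(2)[OF w that] by blast
      have mm: "(\<lambda>x. s w e x - s w 0 x - e *\<^sub>R w) \<in> borel_measurable borel"
        using sm[OF w, of e] sm[OF w, of 0] e by (intro borel_measurable_diff) auto
      have iK: "integrable N (indicator (Kp w) :: 'a \<Rightarrow> real)"
        using Kp(1)[OF w] by (intro integrable_real_indicator) (auto simp: N.emeasure_eq_measure)
      have "(\<integral>x. indicator (Kp w) x *\<^sub>R (e *\<^sub>R w) \<partial>N) = (\<integral>x. indicator (Kp w) x \<partial>N) *\<^sub>R (e *\<^sub>R w)"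
        by (rule integral_scaleR_left) (rule iK)
      also have "(\<integral>x. indicator (Kp w) x \<partial>N) = m w" using Kp(1)[OF w] by (simp add: m_def)
      finally have Iw: "(\<integral>x. indicator (Kp w) x *\<^sub>R (e *\<^sub>R w) \<partial>N) = (e * m w) *\<^sub>R w" by (simp add: mult.commute)
      have iw: "integrable N (\<lambda>x. indicator (Kp w) x *\<^sub>R (e *\<^sub>R w))"
        by (intro integrable_scaleR_left iK)
      have "G w e - (e * m w) *\<^sub>R w = (\<integral>x. indicator (Kp w) x *\<^sub>R (s w e x - s w 0 x) \<partial>N) - (\<integral>x. indicator (Kp w) x *\<^sub>R (e *\<^sub>R w) \<partial>N)"
        unfolding Iw G_def by (rule refl)
      also have "\<dots> = (\<integral>x. indicator (Kp w) x *\<^sub>R (s w e x - s w 0 x) - indicator (Kp w) x *\<^sub>R (e *\<^sub>R w) \<partial>N)"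
        by (rule Bochner_Integration.integral_diff[symmetric]) (use ii[OF w] e iw in auto)
      also have "\<dots> = (\<integral>x. indicator (Kp w) x *\<^sub>R (s w e x - s w 0 x - e *\<^sub>R w) \<partial>N)"
        by (simp only: scaleR_diff_right[symmetric])
      finally have eq: "G w e - (e * m w) *\<^sub>R w = (\<integral>x. indicator (Kp w) x *\<^sub>R (s w e x - s w 0 x - e *\<^sub>R w) \<partial>N)" .
      have "norm (\<integral>x. indicator (Kp w) x *\<^sub>R (s w e x - s w 0 x - e *\<^sub>R w) \<partial>N) \<le> (\<eta> * e) * m w"
        unfolding m_def by (rule integral_on_piece(2)[OF Kp(1)[OF w] mm b])
      then show ?thesis unfolding eq by (simp only: mult.assoc)
    qed
    \<comment> \<open>By the choice of the coefficients the first-order displacements sum up to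
      \<open>y\<close>, so \<open>F\<close> is a perturbation of the translation by the mean
      endpoint.\<close>
    define F where "F = (\<lambda>y. ?E + (\<Sum>w\<in>I. G w (c w y / m w)))"
    have "?E \<in> interior (F ` cball 0 r)"
    proof (rule interior_perturbed_identity[OF r])
      show "continuous_on (cball 0 r) F" unfolding F_def
      proof (intro continuous_intros)
        fix w assume w: "w \<in> I"
        have "continuous_on (cball 0 r) (\<lambda>y. c w y / m w)"
          using m[OF w] by (intro continuous_intros continuous_on_subset[OF cc]) auto
        then show "continuous_on (cball 0 r) (\<lambda>y. G w (c w y / m w))"
          by (rule continuous_on_compose2[OF Gc[OF w]]) (use c0 m[OF w] in auto)
      qed
      fix y :: 'a assume y: "y \<in> cball 0 r"
      have "F y - ?E - y = (\<Sum>w\<in>I. G w (c w y / m w)) - (\<Sum>w\<in>I. c w y *\<^sub>R w)" by (simp add: F_def cs)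
      also have "\<dots> = (\<Sum>w\<in>I. G w (c w y / m w) - c w y *\<^sub>R w)" by (simp add: sum_subtractf)
      also have "norm \<dots> \<le> (\<Sum>w\<in>I. \<eta> * (K * norm y))"
      proof (rule sum_norm_le)
        fix w assume w: "w \<in> I"
        have e: "c w y / m w * m w = c w y" using m[OF w] by simp
        have "norm (G w (c w y / m w) - c w y *\<^sub>R w) \<le> \<eta> * c w y"
          using Gd[OF w small[OF w y]] unfolding e .
        also have "\<dots> \<le> \<eta> * (K * norm y)" using cK[OF w, of y] \<eta> by (intro mult_left_mono) auto
        finally show "norm (G w (c w y / m w) - c w y *\<^sub>R w) \<le> \<eta> * (K * norm y)" .
      qed
      also have "\<dots> = (\<eta> * (K * card I)) * norm y" by simp
      also have "\<dots> \<le> 1 / 2 * norm y" using \<eta>_le by (rule mult_right_mono) simp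
      finally show "norm (F y - ?E - y) \<le> norm y / 2" by simp
    qed
    moreover have "F ` cball 0 r \<subseteq> ?A"
    proof
      fix z assume "z \<in> F ` cball 0 r"
      then obtain y where y: "y \<in> cball 0 r" and z: "z = F y" by blast
      have "?E + (\<Sum>w\<in>I. \<integral>x. indicator (Kp w) x *\<^sub>R (s w (c w y / m w) x - s w 0 x) \<partial>N) \<in> ?A"
      proof (rule modified_selection[OF _ I(1) Kp(1) _ Kp(4)])
        \<comment> \<open>A set with a frontier point is nonempty; the mean endpoint itself is not
          assumed to belong to it.\<close>
        show "?A \<noteq> {}" using fr by auto
        fix w assume w: "w \<in> I"
        show "Kp w \<subseteq> W" using g'[OF w] Kp(2)[OF w] by blast
        show "s w 0 x = fl x T" if "x \<in> Kp w" for x using g'[OF w] Kp(2)[OF w that] by blast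
        show "s w (c w y / m w) x \<in> attainable M U f T x" if "x \<in> Kp w" for x
          using g'[OF w] Kp(2)[OF w that] small[OF w y] by blast
        show "integrable N (\<lambda>x. indicator (Kp w) x *\<^sub>R (s w (c w y / m w) x - s w 0 x))"
          using ii[OF w] small[OF w y] by auto
      qed
      then show "z \<in> ?A" by (simp add: z F_def G_def)
    qed
    ultimately have "?E \<in> interior ?A" using interior_mono by blast
    then show False using fr by (simp add: frontier_def)
  qed
  then obtain p where p: "p \<noteq> 0" "\<And>w. w \<in> S \<Longrightarrow> p \<bullet> w \<le> 0"
    using nonpos_functional_if_not_interior[of S] by blast
  show ?thesis
  proof (rule that[OF p(1)])
    fix x \<tau> u assume "x \<in> charged" "lebesgue_point T u0 \<tau>" "u \<in> U"
    then have "needle_vector f u0 (basis_costate x) (fl x) \<tau> u \<in> S" unfolding S_def by blast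
    from p(2)[OF this] show "costate x p \<tau> \<bullet> (f u (fl x \<tau>) - f (u0 \<tau>) (fl x \<tau>)) \<le> 0"
      by (simp add: inner_needle_vector)
  qed
qed

end

section \<open>Hamiltonian form of the adjoint equation and the maximum principle\<close>

lemma hamiltonian_vf_eq:
  fixes f :: "real ^ 'n \<Rightarrow> 'a::euclidean_space \<Rightarrow> 'a"
  assumes d: "(f u has_derivative frechet_derivative (f u) (at q)) (at q)"
  shows "hamiltonian_vf (hamiltonian f u) (q, blinfun_inner_left l) = (f u q, blinfun_inner_left (- adj f u q l))"
proof -
  let ?D = "frechet_derivative (f u) (at q)" and ?p = "blinfun_inner_left l"
  have "((\<lambda>z. blinfun_apply (snd z) (f u (fst z))) has_derivative
      (\<lambda>Y. blinfun_apply ?p (?D (fst Y)) + blinfun_apply (snd Y) (f u q))) (at (q, ?p))"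
  proof -
    have 1: "((\<lambda>z. f u (fst z)) has_derivative (\<lambda>Y. ?D (fst Y))) (at (q, ?p))"
      by (rule has_derivative_compose[of fst fst "(q, ?p)" UNIV "f u" ?D, simplified])
        (use d in \<open>auto intro: derivative_eq_intros\<close>)
    have 2: "(snd has_derivative snd) (at (q, ?p))" by (auto intro: derivative_eq_intros)
    show ?thesis
      using bounded_bilinear.FDERIV[OF bounded_bilinear_blinfun_apply 2 1] by simp
  qed
  moreover have "hamiltonian f u = (\<lambda>z. blinfun_apply (snd z) (f u (fst z)))"
    by (auto simp: hamiltonian_def fun_eq_iff)
  ultimately have H: "frechet_derivative (hamiltonian f u) (at (q, ?p)) =
      (\<lambda>Y. blinfun_apply ?p (?D (fst Y)) + blinfun_apply (snd Y) (f u q))"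
    by (simp only: frechet_derivative_at[symmetric])
  have adjD: "l \<bullet> ?D v = adj f u q l \<bullet> v" for v
    using adj_inner[where f = f and v = u and q = q and l = l and w = v] has_derivative_linear[OF d] by simp
  show ?thesis
    unfolding hamiltonian_vf_def
  proof (rule the_equality)
    show "\<forall>Y. canonical_symplectic Y (f u q, blinfun_inner_left (- adj f u q l)) = frechet_derivative (hamiltonian f u) (at (q, ?p)) Y"
      by (auto simp: H canonical_symplectic_def adjD inner_commute[of _ "adj f u q l"] inner_commute[of _ l])
  next
    \<comment> \<open>Nondegeneracy of the symplectic form: vertical test vectors determine the base
      component of \<open>X\<close>, horizontal ones its covector component.\<close>
    fix X assume X: "\<forall>Y. canonical_symplectic Y X = frechet_derivative (hamiltonian f u) (at (q, ?p)) Y"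
    obtain w \<beta> where Xw: "X = (w, \<beta>)" by force
    have D0: "?D 0 = 0" using linear_0[OF has_derivative_linear[OF d]] .
    have "blinfun_apply \<alpha> w = blinfun_apply \<alpha> (f u q)" for \<alpha> :: "'a \<Rightarrow>\<^sub>L real"
      using X[rule_format, of "(0, \<alpha>)"] by (simp add: Xw H canonical_symplectic_def blinfun.zero_right D0)
    from this[of "blinfun_inner_left (w - f u q)"] have "(w - f u q) \<bullet> (w - f u q) = 0" by (simp add: inner_diff_left)
    then have w: "w = f u q" by simp
    have "blinfun_apply \<beta> v = - (adj f u q l \<bullet> v)" for v
      using X[rule_format, of "(v, 0)"] adjD[of v]
      by (simp add: Xw H canonical_symplectic_def inner_commute)
    then have "\<beta> = blinfun_inner_left (- adj f u q l)" by (intro blinfun_eqI) (simp add: inner_commute)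
    then show "X = (f u q, blinfun_inner_left (- adj f u q l))" using Xw w by simp
  qed
qed

theorem theorem2p2:
  fixes M :: "'a::euclidean_space set"
    and U :: "(real ^ 'n) set"
    and f :: "real ^ 'n \<Rightarrow> 'a \<Rightarrow> 'a"
    and t1 :: real
    and utilde :: "real \<Rightarrow> real ^ 'n"
    and P :: "'w measure"
    and q0 :: "'w \<Rightarrow> 'a"
    and \<rho> :: "'a \<Rightarrow> real"
    and qtilde :: "'w \<Rightarrow> real \<Rightarrow> 'a"
  assumes system: "control_system M U f"
    and time: "0 < t1"
    and control: "admissible_control U t1 utilde"
    and prob: "prob_space P"
    and density_nonneg: "\<And>x. x \<in> M \<Longrightarrow> 0 \<le> \<rho> x"
    and density: "distributed P (restrict_space lborel M) q0 (\<lambda>x. ennreal (\<rho> x))"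
    and solution: "\<And>\<omega>. \<omega> \<in> space P \<Longrightarrow> trajectory M f t1 utilde (q0 \<omega>) (qtilde \<omega>)"
    and integrable_endpoint: "integrable P (\<lambda>\<omega>. qtilde \<omega> t1)"
    and boundary: "(\<integral>\<omega>. qtilde \<omega> t1 \<partial>P) \<in> frontier (expected_attainable M U f \<rho> t1)"
    and injectivity:
      "\<And>u x1 x2 q1 q2. admissible_control U t1 u \<Longrightarrow>
         trajectory M f t1 u x1 q1 \<Longrightarrow> trajectory M f t1 u x2 q2 \<Longrightarrow> x1 \<noteq> x2 \<Longrightarrow> q1 t1 \<noteq> q2 t1"
  shows "\<exists>lam :: 'w \<Rightarrow> real \<Rightarrow> 'a cotangent.
      (\<forall>t\<in>{0..t1}. (\<lambda>\<omega>. lam \<omega> t) \<in> borel_measurable P) \<and>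
      (\<forall>\<omega>\<in>space P. \<forall>t\<in>{0..t1}. fst (lam \<omega> t) = qtilde \<omega> t) \<and>
      (\<forall>\<omega>\<in>space P. \<exists>L. L-lipschitz_on {0..t1} (lam \<omega>)) \<and>
      (AE t in lebesgue_on {0..t1}.
         \<not> (AE \<omega> in P. snd (lam \<omega> t) = 0) \<and>
         (\<forall>\<omega>\<in>space P. (lam \<omega> has_vector_derivative
             hamiltonian_vf (hamiltonian f (utilde t)) (lam \<omega> t)) (at t within {0..t1})) \<and>
         (\<forall>u\<in>U. integrable P (\<lambda>\<omega>. hamiltonian f u (lam \<omega> t))) \<and>
         (\<forall>u\<in>U. (\<integral>\<omega>. hamiltonian f u (lam \<omega> t) \<partial>P)
                  \<le> (\<integral>\<omega>. hamiltonian f (utilde t) (lam \<omega> t) \<partial>P)))"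
proof -
  have flow: "random_flow M U f t1 utilde P q0 \<rho> qtilde"
    by (intro random_flow.intro flow.intro random_flow_axioms.intro system time control prob
        density_nonneg density solution integrable_endpoint)
  interpret random_flow M U f t1 utilde P q0 \<rho> qtilde by (rule flow)
  obtain p where p: "p \<noteq> 0" and max: "\<And>x \<tau> u. x \<in> charged \<Longrightarrow> lebesgue_point t1 utilde \<tau> \<Longrightarrow> u \<in> U \<Longrightarrow>
     costate x p \<tau> \<bullet> (f u (fl x \<tau>) - f (utilde \<tau>) (fl x \<tau>)) \<le> 0"
    using covector_exists[OF boundary] by blast
  obtain x0 where x0: "x0 \<in> charged" using charged_nonempty by blast
  then have x0W: "x0 \<in> W" by (simp add: charged_def)
  obtain \<delta> where \<delta>: "0 < \<delta>" "cball x0 \<delta> \<subseteq> W" using open_contains_cball[of W] open_W x0W by blast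
  \<comment> \<open>Centred in the support, so that the cut-off covector is nonzero with positive
    probability; compact and inside \<open>W\<close>, so that its Hamiltonians are bounded.\<close>
  define K where "K = cball x0 \<delta>"
  have KW: "K \<subseteq> W" and K_borel: "K \<in> sets borel" and K_compact: "compact K" using \<delta> by (auto simp: K_def)
  \<comment> \<open>The cut-off depends on the initial point alone, hence is constant along a path;
    since the adjoint equation is linear, \<open>l x\<close> still solves it for \<open>x\<close> in
    \<open>W\<close>.\<close>
  define l where "l = (\<lambda>x t. indicator K x *\<^sub>R costate x p t)"
  define J :: "'a \<Rightarrow> 'a \<Rightarrow>\<^sub>L real" where "J = blinfun_inner_left"
  have J: "bounded_linear J" unfolding J_def by (rule bounded_linear_blinfun_inner_left)
  have J_apply: "blinfun_apply (J y) z = z \<bullet> y" for y z by (simp add: J_def)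
  define lam where "lam = (\<lambda>\<omega> t. (qtilde \<omega> t, J (l (q0 \<omega>) t)))"
  have fl_cont: "continuous_on W (\<lambda>x. fl x t)" and co_cont: "continuous_on W (\<lambda>x. costate x p t)"
    if "t \<in> {0..t1}" for t by (rule continuous_fl[OF that], rule continuous_costate[OF that])

  have "(\<lambda>\<omega>. lam \<omega> t) \<in> borel_measurable P" if t: "t \<in> {0..t1}" for t
  proof -
    \<comment> \<open>The extension by \<open>0\<close> off \<open>W\<close> gives a Borel function
      of the initial point, and \<open>q0\<close> takes all its values in \<open>W\<close>.\<close>
    have m1: "(\<lambda>x. indicator W x *\<^sub>R fl x t) \<in> borel_measurable borel"
      by (rule borel_measurable_continuous_on_indicator[OF W_sets fl_cont[OF t]])
    have m2: "(\<lambda>x. l x t) \<in> borel_measurable borel" unfolding l_def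
      by (rule borel_measurable_continuous_on_indicator[OF K_borel continuous_on_subset[OF co_cont[OF t] KW]])
    have "continuous_on UNIV (\<lambda>z. (fst z, J (snd z)))"
      by (intro continuous_intros bounded_linear.continuous_on[OF J])
    then have "(\<lambda>z. (fst z, J (snd z))) \<in> borel_measurable borel" by (rule borel_measurable_continuous_onI)
    from measurable_compose[OF measurable_compose[OF q0_meas borel_measurable_Pair[OF m1 m2]] this]
    have "(\<lambda>\<omega>. (indicator W (q0 \<omega>) *\<^sub>R fl (q0 \<omega>) t, J (l (q0 \<omega>) t))) \<in> borel_measurable P" by simp
    then show ?thesis
      by (rule measurable_cong[THEN iffD1, rotated]) (use q0_W qt_fl t in \<open>simp add: lam_def\<close>)
  qed
  moreover have "\<exists>L. L-lipschitz_on {0..t1} (lam \<omega>)" if \<omega>: "\<omega> \<in> space P" for \<omega>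
  proof -
    obtain L1 where L1: "L1-lipschitz_on {0..t1} (qtilde \<omega>)" using solution[OF \<omega>] unfolding trajectory_def by blast
    obtain L2 where L2: "L2-lipschitz_on {0..t1} (costate (q0 \<omega>) p)" using costate_regular(1)[OF q0_W[OF \<omega>]] by blast
    obtain C where C: "0 < C" "\<And>y. norm (J y) \<le> norm y * C" using bounded_linear.pos_bounded[OF J] by blast
    have nn: "0 \<le> L1" "0 \<le> L2" using L1 L2 lipschitz_on_nonneg by blast+
    have "(L1 + L2 * C)-lipschitz_on {0..t1} (lam \<omega>)"
    proof (rule lipschitz_onI)
      fix s t assume st: "s \<in> {0..t1}" "t \<in> {0..t1}"
      have "dist (J (l (q0 \<omega>) s)) (J (l (q0 \<omega>) t)) = norm (J (l (q0 \<omega>) s - l (q0 \<omega>) t))"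
        by (simp add: dist_norm linear_diff[OF bounded_linear.linear[OF J]])
      also have "\<dots> \<le> norm (l (q0 \<omega>) s - l (q0 \<omega>) t) * C" by (rule C)
      also have "\<dots> \<le> (L2 * dist s t) * C"
        using lipschitz_onD[OF L2 st] C(1) nn
        by (intro mult_right_mono) (auto simp: l_def dist_norm indicator_def)
      finally have "dist (J (l (q0 \<omega>) s)) (J (l (q0 \<omega>) t)) \<le> L2 * C * dist s t" by (simp add: mult_ac)
      moreover have "dist (qtilde \<omega> s) (qtilde \<omega> t) \<le> L1 * dist s t" by (rule lipschitz_onD[OF L1 st])
      moreover have "dist (lam \<omega> s) (lam \<omega> t) \<le> dist (qtilde \<omega> s) (qtilde \<omega> t) + dist (J (l (q0 \<omega>) s)) (J (l (q0 \<omega>) t))"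
        unfolding lam_def dist_Pair_Pair by (rule sqrt_sum_squares_le_sum) auto
      ultimately show "dist (lam \<omega> s) (lam \<omega> t) \<le> (L1 + L2 * C) * dist s t" by (simp add: distrib_right)
    qed (use nn C in simp)
    then show ?thesis by blast
  qed
  moreover have "AE t in lebesgue_on {0..t1}.
         \<not> (AE \<omega> in P. snd (lam \<omega> t) = 0) \<and>
         (\<forall>\<omega>\<in>space P. (lam \<omega> has_vector_derivative
             hamiltonian_vf (hamiltonian f (utilde t)) (lam \<omega> t)) (at t within {0..t1})) \<and>
         (\<forall>u\<in>U. integrable P (\<lambda>\<omega>. hamiltonian f u (lam \<omega> t))) \<and>
         (\<forall>u\<in>U. (\<integral>\<omega>. hamiltonian f u (lam \<omega> t) \<partial>P)
                  \<le> (\<integral>\<omega>. hamiltonian f (utilde t) (lam \<omega> t) \<partial>P))"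
  proof -
    note ac = admissible_control_compact[OF control]
    obtain Z where Z: "negligible Z" "\<And>t. t \<in> {0..t1} - Z \<Longrightarrow> lebesgue_point t1 utilde t"
      using lebesgue_points_negligible[OF ac(4,5)] by blast
    show ?thesis
    proof (rule negligible_AE_lebesgue_on[OF Z(1)], intro conjI ballI)
      fix t assume "t \<in> {0..t1} - Z"
      then have t: "t \<in> {0..t1}" and lp: "lebesgue_point t1 utilde t" using Z(2) by auto
      have utU: "utilde t \<in> U" by (rule u0_U[OF t])
      have UcU: "u \<in> closure U" if "u \<in> U" for u using closure_subset that by blast
      show "\<not> (AE \<omega> in P. snd (lam \<omega> t) = 0)"
      proof
        assume "AE \<omega> in P. snd (lam \<omega> t) = 0"
        then have "AE \<omega> in P. q0 \<omega> \<notin> K"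
        proof eventually_elim
          fix \<omega> assume "snd (lam \<omega> t) = 0"
          then have "blinfun_apply (J (l (q0 \<omega>) t)) (l (q0 \<omega>) t) = 0" by (simp add: lam_def)
          then have "l (q0 \<omega>) t = 0" by (simp add: J_apply)
          then show "q0 \<omega> \<notin> K" using costate_nonzero[OF _ p t, of "q0 \<omega>"] KW by (auto simp: l_def indicator_def split: if_splits)
        qed
        then have "AE \<omega> in P. \<omega> \<notin> q0 -` K \<inter> space P" by eventually_elim auto
        then have "emeasure P (q0 -` K \<inter> space P) = 0"
          using AE_iff_null_sets[OF measurable_sets[OF q0_meas K_borel]] by (auto simp: null_sets_def)
        then have "emeasure N K = 0" unfolding N_def using emeasure_distr[OF q0_meas] K_borel by simp
        moreover have "0 < emeasure N (ball x0 \<delta>)" using x0 \<delta>(1) by (simp add: charged_def)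
        moreover have "emeasure N (ball x0 \<delta>) \<le> emeasure N K" by (rule emeasure_mono) (auto simp: K_def)
        ultimately show False by simp
      qed
      show "(lam \<omega> has_vector_derivative hamiltonian_vf (hamiltonian f (utilde t)) (lam \<omega> t)) (at t within {0..t1})"
        if \<omega>: "\<omega> \<in> space P" for \<omega>
      proof -
        have qM: "qtilde \<omega> t \<in> M" using solution[OF \<omega>] t unfolding trajectory_def by blast
        have dq: "(qtilde \<omega> has_vector_derivative f (utilde t) (qtilde \<omega> t)) (at t within {0..t1})"
          using integral_curve_regular(2)[OF system control _ trajectory_integral_curve[OF solution[OF \<omega>]] lp] time by simp
        have "(l (q0 \<omega>) has_vector_derivative - adj f (utilde t) (qtilde \<omega> t) (l (q0 \<omega>) t)) (at t within {0..t1})"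
          using costate_regular(2)[OF q0_W[OF \<omega>] lp, of p] qt_fl[OF \<omega> t]
          by (cases "q0 \<omega> \<in> K") (auto simp: l_def)
        then have "((\<lambda>t. J (l (q0 \<omega>) t)) has_vector_derivative J (- adj f (utilde t) (qtilde \<omega> t) (l (q0 \<omega>) t))) (at t within {0..t1})"
          by (rule bounded_linear.has_vector_derivative[OF J])
        with dq have "(lam \<omega> has_vector_derivative (f (utilde t) (qtilde \<omega> t), J (- adj f (utilde t) (qtilde \<omega> t) (l (q0 \<omega>) t)))) (at t within {0..t1})"
          unfolding lam_def by (rule has_vector_derivative_Pair)
        also have "(f (utilde t) (qtilde \<omega> t), J (- adj f (utilde t) (qtilde \<omega> t) (l (q0 \<omega>) t))) =
            hamiltonian_vf (hamiltonian f (utilde t)) (lam \<omega> t)"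
          unfolding lam_def J_def
          by (rule hamiltonian_vf_eq[where f = f and u = "utilde t", symmetric, OF control_system_has_derivative[OF system UcU[OF utU] qM]])
        finally show ?thesis .
      qed
      define h where "h = (\<lambda>u x. indicator K x *\<^sub>R (f u (fl x t) \<bullet> costate x p t))"
      have ham: "hamiltonian f u (lam \<omega> t) = h u (q0 \<omega>)" if "\<omega> \<in> space P" for \<omega> u
        using qt_fl[OF that t] by (simp add: hamiltonian_def lam_def J_apply l_def h_def)
      have int: "integrable P (\<lambda>\<omega>. hamiltonian f u (lam \<omega> t))" if u: "u \<in> U" for u
      proof -
        have "continuous_on M (f u)"
          using control_system_has_derivative[OF system UcU[OF u]]
          by (intro continuous_at_imp_continuous_on) (auto intro: has_derivative_continuous)
        then have "continuous_on K (\<lambda>x. f u (fl x t))"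
          by (rule continuous_on_compose2[OF _ continuous_on_subset[OF fl_cont[OF t] KW]]) (use fl_in KW t in auto)
        then have hc: "continuous_on K (\<lambda>x. f u (fl x t) \<bullet> costate x p t)"
          by (intro continuous_intros continuous_on_subset[OF co_cont[OF t] KW])
        then have "bounded ((\<lambda>x. f u (fl x t) \<bullet> costate x p t) ` K)"
          by (intro compact_imp_bounded compact_continuous_image K_compact)
        then obtain C where C: "\<And>x. x \<in> K \<Longrightarrow> norm (f u (fl x t) \<bullet> costate x p t) \<le> C" unfolding bounded_iff by blast
        have hm: "h u \<in> borel_measurable borel" unfolding h_def by (rule borel_measurable_continuous_on_indicator[OF K_borel hc])
        have hb: "norm (h u x) \<le> max C 0" for x using C[of x] by (auto simp: h_def indicator_def)
        have "integrable P (\<lambda>\<omega>. h u (q0 \<omega>))"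
          by (rule integrable_const_bound[of _ "max C 0"]) (use hb measurable_compose[OF q0_meas hm] in auto)
        then show ?thesis by (subst Bochner_Integration.integrable_cong[OF refl ham])
      qed
      show "integrable P (\<lambda>\<omega>. hamiltonian f u (lam \<omega> t))" if "u \<in> U" for u by (rule int[OF that])
      show "(\<integral>\<omega>. hamiltonian f u (lam \<omega> t) \<partial>P) \<le> (\<integral>\<omega>. hamiltonian f (utilde t) (lam \<omega> t) \<partial>P)" if u: "u \<in> U" for u
      proof (rule integral_mono_AE[OF int[OF u] int[OF utU]])
        \<comment> \<open>The inequality holds for almost every realization separately: on the
          support by the choice of \<open>p\<close>, while both sides vanish off
          \<open>K\<close>.\<close>
        from AE_charged AE_space[of P] show "AE \<omega> in P. hamiltonian f u (lam \<omega> t) \<le> hamiltonian f (utilde t) (lam \<omega> t)"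
        proof eventually_elim
          fix \<omega> assume c: "q0 \<omega> \<in> charged" and \<omega>: "\<omega> \<in> space P"
          show "hamiltonian f u (lam \<omega> t) \<le> hamiltonian f (utilde t) (lam \<omega> t)"
            using max[OF c lp u] unfolding ham[OF \<omega>] h_def
            by (simp add: indicator_def inner_diff_right inner_commute)
        qed
      qed
    qed auto
  qed
  ultimately show ?thesis by (intro exI[of _ lam]) (auto simp: lam_def)
qed

end
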